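(* For every $u\in W$, the tilted Bruhat order $D_u(W)$ is dual to an induced suborder of the affine Bruhat order; that is, there is an injective map $f_u:W\to W_{\mathrm{af}}$ such that for all $w,v\in W$, $w\preceq_u v$ in $D_u(W)$ if and only if $f_u(v)\le f_u(w)$ in the Bruhat order of $W_{\mathrm{af}}$.
   Context: $W$ is the (finite, irreducible) Weyl group of a simple, simply-connected complex algebraic group, with positive roots $R^+$, coroots $\alpha^\vee$, reflections $r_\alpha$, length $\ell$, and $2\rho=\sum_{\alpha\in R^+}\alpha$; $Q^\vee$ is the coroot lattice and $W_{\mathrm{af}}=W\ltimes Q^\vee$ the affine Weyl group, a Coxeter group with generators the simple reflections of $W$ and $r_0=r_\theta t_{-\theta^\vee}$ ($\theta$ the highest root). The quantum Bruhat graph $D(W)$ is the directed graph with vertex set $W$ and a directed edge $w\to wr_\alpha$ ($w\in W$, $\alpha\in R^+$) whenever $\ell(wr_\alpha)=\ell(w)+1$ or $\ell(wr_\alpha)=\ell(w)+1-\langle\alpha^\vee,2\rho\rangle$. For $u\in W$, the tilted Bruhat order $D_u(W)$ is the partial order on $W$ with $w\preceq_u v$ if and only if there is a shortest directed path in $D(W)$ from $u$ to $v$ passing through $w$. *)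

theory Defs
  imports "HOL-Analysis.Analysis" "Graph_Theory.Pair_Digraph"
begin

section \<open>Coxeter groups of transformations\<close>

text \<open>
  Groups are realised faithfully as sets of bijections of a Euclidean space, with composition as
  product. All generating sets below consist of involutions, so the generated group is the set of
  products of finite words; inverses need not be added.
\<close>

definition word_prod :: "('a \<Rightarrow> 'a) list \<Rightarrow> 'a \<Rightarrow> 'a" where
  "word_prod ws = foldr (\<circ>) ws id"

definition generated_by_involutions :: "('a \<Rightarrow> 'a) set \<Rightarrow> ('a \<Rightarrow> 'a) set" where
  "generated_by_involutions S = word_prod ` lists S"

definition word_length :: "('a \<Rightarrow> 'a) set \<Rightarrow> ('a \<Rightarrow> 'a) \<Rightarrow> nat" where
  "word_length S w = (LEAST n. \<exists>ws \<in> lists S. length ws = n \<and> word_prod ws = w)"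

definition coxeter_reflections :: "('a \<Rightarrow> 'a) set \<Rightarrow> ('a \<Rightarrow> 'a) set \<Rightarrow> ('a \<Rightarrow> 'a) set" where
  "coxeter_reflections G S = {g \<circ> s \<circ> inv g | g s. g \<in> G \<and> s \<in> S}"

definition bruhat_le :: "('a \<Rightarrow> 'a) set \<Rightarrow> ('a \<Rightarrow> 'a) set \<Rightarrow> ('a \<Rightarrow> 'a) \<Rightarrow> ('a \<Rightarrow> 'a) \<Rightarrow> bool" where
  "bruhat_le G S x y \<longleftrightarrow>
     (x, y) \<in> {(z, z \<circ> t) | z t. z \<in> G \<and> t \<in> coxeter_reflections G S \<and>
                  word_length S z < word_length S (z \<circ> t)}\<^sup>*"

section \<open>Root systems and Weyl groups\<close>

text \<open>
  The Weyl groups of simple, simply-connected complex algebraic groups are the Weyl groups of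
  irreducible (reduced, crystallographic) root systems. The ambient space carries a Weyl-invariant
  inner product, through which it is identified with its dual; hence coroots are vectors of the
  same space and the pairing of coroots with weights is the inner product.
\<close>

definition coroot :: "'a::euclidean_space \<Rightarrow> 'a" where
  "coroot \<alpha> = (2 / (\<alpha> \<bullet> \<alpha>)) *\<^sub>R \<alpha>"

definition root_reflection :: "'a::euclidean_space \<Rightarrow> 'a \<Rightarrow> 'a" where
  "root_reflection \<alpha> x = x - (coroot \<alpha> \<bullet> x) *\<^sub>R \<alpha>"

definition root_system :: "'a::euclidean_space set \<Rightarrow> bool" where
  "root_system R \<longleftrightarrow> finite R \<and> 0 \<notin> R \<and> span R = UNIV \<and>
     (\<forall>\<alpha>\<in>R. root_reflection \<alpha> ` R = R) \<and>
     (\<forall>\<alpha>\<in>R. \<forall>\<beta>\<in>R. coroot \<alpha> \<bullet> \<beta> \<in> \<int>) \<and>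
     (\<forall>\<alpha>\<in>R. \<forall>c. c *\<^sub>R \<alpha> \<in> R \<longrightarrow> c = 1 \<or> c = -1)"

text \<open>
  Nonemptiness of the root system is automatic below, since Euclidean spaces have positive
  dimension and roots span.
\<close>

definition irreducible_root_system :: "'a::euclidean_space set \<Rightarrow> bool" where
  "irreducible_root_system R \<longleftrightarrow> root_system R \<and>
     (\<forall>A B. A \<union> B = R \<and> A \<inter> B = {} \<and> (\<forall>\<alpha>\<in>A. \<forall>\<beta>\<in>B. \<alpha> \<bullet> \<beta> = 0) \<longrightarrow> A = {} \<or> B = {})"

definition nonneg_combinations :: "'a::euclidean_space set \<Rightarrow> 'a set" where
  "nonneg_combinations \<Delta> = {\<Sum>\<delta>\<in>\<Delta>. real (c \<delta>) *\<^sub>R \<delta> | c :: 'a \<Rightarrow> nat. True}"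

definition simple_roots :: "'a::euclidean_space set \<Rightarrow> 'a set \<Rightarrow> bool" where
  "simple_roots R \<Delta> \<longleftrightarrow> \<Delta> \<subseteq> R \<and> independent \<Delta> \<and>
     (\<forall>\<alpha>\<in>R. \<alpha> \<in> nonneg_combinations \<Delta> \<or> - \<alpha> \<in> nonneg_combinations \<Delta>)"

definition positive_roots :: "'a::euclidean_space set \<Rightarrow> 'a set \<Rightarrow> 'a set" where
  "positive_roots R \<Delta> = R \<inter> nonneg_combinations \<Delta>"

definition highest_root :: "'a::euclidean_space set \<Rightarrow> 'a set \<Rightarrow> 'a" where
  "highest_root R \<Delta> = (THE \<theta>. \<theta> \<in> R \<and> (\<forall>\<alpha>\<in>R. \<theta> - \<alpha> \<in> nonneg_combinations \<Delta>))"

definition two_rho :: "'a::euclidean_space set \<Rightarrow> 'a set \<Rightarrow> 'a" where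
  "two_rho R \<Delta> = (\<Sum>\<alpha>\<in>positive_roots R \<Delta>. \<alpha>)"

definition weyl_group :: "'a::euclidean_space set \<Rightarrow> ('a \<Rightarrow> 'a) set" where
  "weyl_group R = generated_by_involutions (root_reflection ` R)"

definition weyl_length :: "'a::euclidean_space set \<Rightarrow> ('a \<Rightarrow> 'a) \<Rightarrow> nat" where
  "weyl_length \<Delta> = word_length (root_reflection ` \<Delta>)"

section \<open>The affine Weyl group\<close>

definition coroot_lattice :: "'a::euclidean_space set \<Rightarrow> 'a set" where
  "coroot_lattice R = {\<Sum>\<alpha>\<in>R. real_of_int (c \<alpha>) *\<^sub>R coroot \<alpha> | c :: 'a \<Rightarrow> int. True}"

definition translation :: "'a::euclidean_space \<Rightarrow> 'a \<Rightarrow> 'a" where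
  "translation q x = x + q"

text \<open>
  The semidirect product of the Weyl group and the coroot lattice, realised as the group of affine
  transformations generated by them; the pair of \<^term>\<open>w\<close> and \<^term>\<open>q\<close> is
  \<^term>\<open>w \<circ> translation q\<close>, which determines both.
\<close>

definition affine_weyl_group :: "'a::euclidean_space set \<Rightarrow> ('a \<Rightarrow> 'a) set" where
  "affine_weyl_group R = {w \<circ> translation q | w q. w \<in> weyl_group R \<and> q \<in> coroot_lattice R}"

definition affine_simple_reflections ::
    "'a::euclidean_space set \<Rightarrow> 'a set \<Rightarrow> ('a \<Rightarrow> 'a) set" where
  "affine_simple_reflections R \<Delta> =
     insert (root_reflection (highest_root R \<Delta>) \<circ> translation (- coroot (highest_root R \<Delta>)))
            (root_reflection ` \<Delta>)"

definition affine_bruhat_le ::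
    "'a::euclidean_space set \<Rightarrow> 'a set \<Rightarrow> ('a \<Rightarrow> 'a) \<Rightarrow> ('a \<Rightarrow> 'a) \<Rightarrow> bool" where
  "affine_bruhat_le R \<Delta> = bruhat_le (affine_weyl_group R) (affine_simple_reflections R \<Delta>)"

section \<open>The quantum Bruhat graph and tilted Bruhat orders\<close>

definition quantum_bruhat_graph ::
    "'a::euclidean_space set \<Rightarrow> 'a set \<Rightarrow> ('a \<Rightarrow> 'a) pair_pre_digraph" where
  "quantum_bruhat_graph R \<Delta> =
     \<lparr> pverts = weyl_group R,
       parcs = {(w, w \<circ> root_reflection \<alpha>) | w \<alpha>.
         w \<in> weyl_group R \<and> \<alpha> \<in> positive_roots R \<Delta> \<and>
         (weyl_length \<Delta> (w \<circ> root_reflection \<alpha>) = weyl_length \<Delta> w + 1 \<or>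
          real (weyl_length \<Delta> (w \<circ> root_reflection \<alpha>)) =
            real (weyl_length \<Delta> w) + 1 - coroot \<alpha> \<bullet> two_rho R \<Delta>)} \<rparr>"

definition shortest_walk :: "('v, 'e) pre_digraph \<Rightarrow> 'v \<Rightarrow> 'e list \<Rightarrow> 'v \<Rightarrow> bool" where
  "shortest_walk G u p v \<longleftrightarrow> pre_digraph.awalk G u p v \<and>
     (\<forall>q. pre_digraph.awalk G u q v \<longrightarrow> length p \<le> length q)"

definition tilted_bruhat_le ::
    "'a::euclidean_space set \<Rightarrow> 'a set \<Rightarrow> ('a \<Rightarrow> 'a) \<Rightarrow> ('a \<Rightarrow> 'a) \<Rightarrow> ('a \<Rightarrow> 'a) \<Rightarrow> bool" where
  "tilted_bruhat_le R \<Delta> u w v \<longleftrightarrow>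
     (\<exists>p. shortest_walk (with_proj (quantum_bruhat_graph R \<Delta>)) u p v \<and>
          w \<in> set (pre_digraph.awalk_verts (with_proj (quantum_bruhat_graph R \<Delta>)) u p))"

end

theory Submission
  imports Defs
begin

text \<open>
  Write an element of the affine Weyl group as \<open>w t\<^sub>\<mu>\<close>. If \<open>\<mu>\<close> is very antidominant, an edge
  \<open>w \<rightarrow> w r\<^sub>\<alpha>\<close> of the quantum Bruhat graph gives \<open>w r\<^sub>\<alpha> t\<^sub>\<mu> < w t\<^sub>\<mu>\<close> (length increasing) or
  \<open>w r\<^sub>\<alpha> t\<^bsub>\<mu>+\<alpha>\<^sup>\<or>\<^esub> < w t\<^sub>\<mu>\<close> (length decreasing, of weight \<open>\<alpha>\<^sup>\<or>\<close>), and the length of a path is determined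
  by its end points and its weight. There is a weight \<open>wt(w,v)\<close> of a path from \<open>w\<close> to \<open>v\<close> such that
  \<open>v t\<^sub>\<nu> \<le> w t\<^sub>\<mu>\<close> forces \<open>\<nu> - \<mu> \<ge> wt(w,v)\<close> in the dominance order; hence all shortest paths have
  weight \<open>wt(w,v)\<close>, and \<open>f\<^sub>u(w) = w t\<^bsub>\<lambda>+wt(u,w)\<^esub>\<close> is the required embedding, for a fixed very
  antidominant \<open>\<lambda>\<close>.

  To find \<open>wt(w,v)\<close>, multiply both elements on the left by an affine simple reflection \<open>s\<^sub>i\<close> with
  \<open>s\<^sub>i w t\<^sub>\<mu> < w t\<^sub>\<mu>\<close>, replacing \<open>y = v t\<^sub>\<nu>\<close> by \<open>min(y, s\<^sub>i y)\<close>. The lifting property holds for the affine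
  Bruhat order as well as for paths in the quantum Bruhat graph, and whether \<open>s\<^sub>i y < y\<close> does not
  depend on \<open>\<nu>\<close>. The distance from \<open>w\<close> to \<open>v\<close> never grows, and it drops whenever \<open>y\<close> stays; since the
  allowed moves connect the whole Weyl group, it drops until \<open>w = v\<close>. There the claim is that
  \<open>w t\<^sub>\<nu> \<le> w t\<^sub>\<mu>\<close> implies \<open>\<nu> \<ge> \<mu>\<close>, which is a convexity property of Weyl orbits.
\<close>

section \<open>Reflection systems\<close>

text \<open>The order is reversed because the translations are antidominant: every lifted edge loses
  one unit of \<open>height_deg\<close>. One half of the embedding just lifts a shortest path. The
  obstacle is the other half: a Bruhat relation between two deep elements comes with no path in the
  graph, so a lower bound on the translation part is needed that holds for all such relations. The
  dominance inequality supplies it: paired with 2\<rho> and applied to \<open>f_u(v)\<close> and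
  \<open>f_u(w)\<close> it reads d(u,w) + d(w,v) \<le> d(u,v), which says that w lies on a shortest
  path from u to v. It is stated against all dominant vectors, not only 2\<rho>, so that equal
  2\<rho>-pairings force equal weights. Each pair (w,v) has its own depth threshold; since W is
  finite, one translation serves all pairs. Exchange and Bruhat steps are treated once, in an
  abstract \<open>reflection_system\<close>, used for W at the point \<open>h\<close> and for the
  affine group at the alcove point \<open>p0\<close>. Comparisons of lengths thereby become signs of
  affine functions, which are decided at once for deep elements.\<close>

lemma word_prod_Nil [simp]: "word_prod [] = id"
  and word_prod_Cons [simp]: "word_prod (s # ws) = s \<circ> word_prod ws"
  by (auto simp: word_prod_def)

lemma word_prod_append [simp]: "word_prod (us @ vs) = word_prod us \<circ> word_prod vs"
  by (induction us) auto

lemma generated_id [simp]: "id \<in> generated_by_involutions S"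
  unfolding generated_by_involutions_def by (rule image_eqI[of _ _ "[]"]) auto

lemma generated_comp:
  "x \<in> generated_by_involutions S \<Longrightarrow> y \<in> generated_by_involutions S
   \<Longrightarrow> x \<circ> y \<in> generated_by_involutions S"
  unfolding generated_by_involutions_def
  by (clarify, rule image_eqI, rule word_prod_append[symmetric]) auto

lemma generated_base: "s \<in> S \<Longrightarrow> s \<in> generated_by_involutions S"
  unfolding generated_by_involutions_def by (rule image_eqI[of _ _ "[s]"]) auto

lemma generated_induct [consumes 1, case_names id step]:
  assumes "x \<in> generated_by_involutions S"
    and "P id"
    and "\<And>s y. s \<in> S \<Longrightarrow> y \<in> generated_by_involutions S \<Longrightarrow> P y \<Longrightarrow> P (s \<circ> y)"
  shows "P x"
proof -
  obtain ws where "ws \<in> lists S" "x = word_prod ws"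
    using assms(1) by (auto simp: generated_by_involutions_def)
  then show ?thesis
    by (induction ws arbitrary: x) (auto intro!: assms simp: generated_by_involutions_def)
qed

lemma generated_subset:
  assumes "S \<subseteq> generated_by_involutions T"
  shows "generated_by_involutions S \<subseteq> generated_by_involutions T"
proof
  fix x assume "x \<in> generated_by_involutions S"
  then show "x \<in> generated_by_involutions T"
  proof (induction rule: generated_induct)
    case (step s y)
    then show ?case using assms generated_comp by blast
  qed (rule generated_id)
qed

lemma generated_inverse:
  assumes "\<And>s. s \<in> S \<Longrightarrow> s \<circ> s = id" "x \<in> generated_by_involutions S"
  shows "\<exists>y\<in>generated_by_involutions S. x \<circ> y = id \<and> y \<circ> x = id"
  using assms(2)
proof (induction rule: generated_induct)
  case id
  show ?case by (rule bexI[of _ id]) auto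
next
  case (step s y)
  then obtain z where z: "z \<in> generated_by_involutions S" "y \<circ> z = id" "z \<circ> y = id" by blast
  have "s \<circ> s = id" by (rule assms(1)[OF step(1)])
  then have "s \<circ> y \<circ> (z \<circ> s) = id" "z \<circ> s \<circ> (s \<circ> y) = id"
    using z by (metis comp_assoc comp_id)+
  moreover have "z \<circ> s \<in> generated_by_involutions S"
    using z step generated_comp generated_base by blast
  ultimately show ?case
    by (intro bexI[of _ "z \<circ> s"] conjI)
qed

lemma word_length_le: "ws \<in> lists S \<Longrightarrow> word_length S (word_prod ws) \<le> length ws"
  unfolding word_length_def by (rule Least_le) auto

lemma reduced_word:
  assumes "x \<in> generated_by_involutions S"
  obtains ws where "ws \<in> lists S" "length ws = word_length S x" "word_prod ws = x"
proof -
  from assms obtain us where "us \<in> lists S" "word_prod us = x"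
    by (auto simp: generated_by_involutions_def)
  then have "\<exists>n. \<exists>ws\<in>lists S. length ws = n \<and> word_prod ws = x" by blast
  from LeastI_ex[OF this] that show thesis unfolding word_length_def by blast
qed

lemma word_length_comp_le:
  assumes "x \<in> generated_by_involutions S" "y \<in> generated_by_involutions S"
  shows "word_length S (x \<circ> y) \<le> word_length S x + word_length S y"
proof -
  obtain us where us: "us \<in> lists S" "length us = word_length S x" "word_prod us = x"
    using reduced_word[OF assms(1)] .
  obtain vs where vs: "vs \<in> lists S" "length vs = word_length S y" "word_prod vs = y"
    using reduced_word[OF assms(2)] .
  show ?thesis
    using word_length_le[of "us @ vs" S] us vs by auto
qed

text \<open>
  A root is a pair of an affine function and the reflection in its zero set. The point \<open>p\<close> lies in
  the fundamental chamber, so that a root is positive if and only if its function is positive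
  at \<open>p\<close>; a group element \<open>z\<close> acts on functions by \<open>a \<mapsto> a \<circ> z\<close>, i.e. through its inverse.
\<close>

locale reflection_system =
  fixes S :: "('a \<Rightarrow> 'a) set" and \<Phi> :: "(('a \<Rightarrow> real) \<times> ('a \<Rightarrow> 'a)) set" and p :: 'a
  assumes root_act: "(a, t) \<in> \<Phi> \<Longrightarrow> s \<in> S \<Longrightarrow> (a \<circ> s, s \<circ> t \<circ> s) \<in> \<Phi>"
    and simple_root: "s \<in> S \<Longrightarrow> \<exists>a. (a, s) \<in> \<Phi> \<and> a p > 0"
    and simple_unique: "s \<in> S \<Longrightarrow> (a, t) \<in> \<Phi> \<Longrightarrow> a p > 0 \<Longrightarrow> a (s p) < 0 \<Longrightarrow> t = s"
    and root_reflect: "(a, t) \<in> \<Phi> \<Longrightarrow> a (t x) = - a x"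
    and root_neg: "(a, t) \<in> \<Phi> \<Longrightarrow> (\<lambda>x. - a x, t) \<in> \<Phi>"
    and root_nonzero: "(a, t) \<in> \<Phi> \<Longrightarrow> a p \<noteq> 0"
    and root_invol: "(a, t) \<in> \<Phi> \<Longrightarrow> t \<circ> t = id"
    and root_generated: "(a, t) \<in> \<Phi> \<Longrightarrow> t \<in> generated_by_involutions S"
begin

abbreviation "W \<equiv> generated_by_involutions S"
abbreviation "len \<equiv> word_length S"

lemma simple_invol: "s \<in> S \<Longrightarrow> s \<circ> s = id"
  using simple_root root_invol by blast

lemma inverse_ex: "z \<in> W \<Longrightarrow> \<exists>y\<in>W. z \<circ> y = id \<and> y \<circ> z = id"
  using generated_inverse simple_invol by blast

lemma inv_comp: "z \<in> W \<Longrightarrow> z \<circ> inv z = id" "z \<in> W \<Longrightarrow> inv z \<circ> z = id"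
  and inv_in: "z \<in> W \<Longrightarrow> inv z \<in> W"
  using inverse_ex[of z] inv_unique_comp by metis+

lemma act_in: 
  assumes "(a, t) \<in> \<Phi>" "z \<in> W"
  shows "(a \<circ> z, inv z \<circ> t \<circ> z) \<in> \<Phi>"
  using assms(2,1)
proof (induction arbitrary: a t rule: generated_induct)
  case id
  then show ?case by simp
next
  case (step s y)
  have "inv (s \<circ> y) = inv y \<circ> s"
    using inv_comp[OF step(2)] simple_invol[OF step(1)]
    by (intro inv_unique_comp) (metis comp_assoc comp_id)+
  then show ?case
    using step(3)[OF root_act[OF step(4,1)]] by (simp only: comp_assoc)
qed

lemma act_nonzero: "(a, t) \<in> \<Phi> \<Longrightarrow> z \<in> W \<Longrightarrow> a (z p) \<noteq> 0"
  using root_nonzero[OF act_in] by auto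

text \<open>Strong exchange, by following p along the word: stripping a letter s replaces (a, t) by
  (a \<circ> s, s t s), and at the letter where the value first turns negative
  \<open>simple_unique\<close> forces the transported reflection to be that letter. Deleting it
  amounts to multiplication by t. The conjugate form of t is kept for
  \<open>reflections_eq\<close>.\<close>

lemma exchange:
  assumes "ws \<in> lists S" "(a, t) \<in> \<Phi>" "a p > 0" "a (word_prod ws p) < 0"
  shows "\<exists>us s vs. ws = us @ s # vs \<and> t \<circ> word_prod ws = word_prod (us @ vs) \<and>
    t = word_prod us \<circ> s \<circ> inv (word_prod us)"
  using assms
proof (induction ws arbitrary: a t)
  case Nil
  then show ?case by simp
next
  case (Cons s ws)
  then have s: "s \<in> S" "ws \<in> lists S" by auto
  have ss: "s (s x) = x" for x using simple_invol[OF s(1)] by (metis comp_apply id_apply)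
  show ?case
  proof (cases "a (s p) < 0")
    case True
    then have "t = s" using simple_unique s Cons by blast
    then show ?thesis
      using ss
      by - (rule exI[of _ "[]"], rule exI[of _ s], rule exI[of _ ws],
        simp add: fun_eq_iff)
  next
    case False
    have "(a \<circ> s, s \<circ> t \<circ> s) \<in> \<Phi>" using root_act Cons s by blast
    moreover from this have "(a \<circ> s) p > 0" using False root_nonzero by fastforce
    moreover have "(a \<circ> s) (word_prod ws p) < 0" using Cons by simp
    ultimately have "\<exists>us s' vs. ws = us @ s' # vs \<and>
        s \<circ> t \<circ> s \<circ> word_prod ws = word_prod (us @ vs) \<and>
        s \<circ> t \<circ> s = word_prod us \<circ> s' \<circ> inv (word_prod us)"
      by (rule Cons.IH)
    then obtain us s' vs where ws: "ws = us @ s' # vs"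
      "s \<circ> t \<circ> s \<circ> word_prod ws = word_prod (us @ vs)"
      "s \<circ> t \<circ> s = word_prod us \<circ> s' \<circ> inv (word_prod us)"
      by (elim exE conjE)
    have us: "word_prod us \<in> W" using ws s by (auto simp: generated_by_involutions_def)
    have inv_s: "inv (s \<circ> word_prod us) = inv (word_prod us) \<circ> s"
      using inv_comp[OF us] simple_invol[OF s(1)]
      by (intro inv_unique_comp) (metis comp_assoc comp_id)+
    have "t \<circ> word_prod (s # ws) = s \<circ> (s \<circ> t \<circ> s \<circ> word_prod ws)"
      by (auto simp: ss)
    then have "t \<circ> word_prod (s # ws) = word_prod ((s # us) @ vs)"
      unfolding ws(2) by (simp only: append_Cons word_prod_Cons)
    moreover have "t = s \<circ> (s \<circ> t \<circ> s) \<circ> s" by (auto simp: ss)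
    then have "t = word_prod (s # us) \<circ> s' \<circ> inv (word_prod (s # us))"
      unfolding ws(3) word_prod_Cons inv_s by (simp only: comp_assoc)
    moreover have "s # ws = (s # us) @ s' # vs" using ws(1) by simp
    ultimately show ?thesis by blast
  qed
qed

lemma len_reflect_less:
  assumes "z \<in> W" "(a, t) \<in> \<Phi>" "a p > 0" "a (z p) < 0"
  shows "len (t \<circ> z) < len z"
proof -
  obtain ws where ws: "ws \<in> lists S" "length ws = len z" "word_prod ws = z"
    using reduced_word[OF assms(1)] .
  then obtain us s vs where "ws = us @ s # vs" "t \<circ> z = word_prod (us @ vs)"
    using exchange[OF ws(1) assms(2,3)] assms(4) by (auto simp del: o_apply)
  then show ?thesis
    using word_length_le[of "us @ vs" S] ws by auto
qed

lemma len_reflect_greater: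
  assumes "z \<in> W" "(a, t) \<in> \<Phi>" "a p > 0" "a (z p) > 0"
  shows "len z < len (t \<circ> z)"
proof -
  have "t \<circ> z \<in> W" using generated_comp root_generated assms by blast
  moreover have "a ((t \<circ> z) p) < 0" using root_reflect[OF assms(2)] assms by simp
  ultimately have "len (t \<circ> (t \<circ> z)) < len (t \<circ> z)"
    using len_reflect_less assms by blast
  then show ?thesis
    using root_invol[OF assms(2)] by (simp add: comp_assoc[symmetric])
qed

lemma len_reflect_less_iff:
  assumes "z \<in> W" "(a, t) \<in> \<Phi>" "a p > 0"
  shows "len z < len (t \<circ> z) \<longleftrightarrow> a (z p) > 0"
proof (cases "a (z p) > 0")
  case True
  then show ?thesis using len_reflect_greater[OF assms] by simp
next
  case False
  then have "a (z p) < 0" using act_nonzero[OF assms(2,1)] by linarith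
  then show ?thesis using len_reflect_less[OF assms] by simp
qed

lemma len_simple:
  assumes "z \<in> W" "(a, s) \<in> \<Phi>" "s \<in> S" "a p > 0" "a (z p) > 0"
  shows "len (s \<circ> z) = Suc (len z)"
proof -
  have "len s \<le> 1" using word_length_le[of "[s]" S] assms by simp
  then have "len (s \<circ> z) \<le> Suc (len z)"
    using word_length_comp_le[OF generated_base[OF assms(3)] assms(1)] by simp
  then show ?thesis using len_reflect_greater assms by force
qed

text \<open>A positive function a with reflection r is negative at r p, so \<open>exchange\<close>,
  applied to a word for r itself, exhibits r as a conjugate of one of its letters.\<close>

lemma reflections_eq: "coxeter_reflections W S = snd ` \<Phi>"
proof (intro set_eqI iffI)
  fix r assume "r \<in> coxeter_reflections W S"
  then obtain g s where gs: "g \<in> W" "s \<in> S" "r = g \<circ> s \<circ> inv g"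
    by (auto simp: coxeter_reflections_def)
  obtain a where a: "(a, s) \<in> \<Phi>" using simple_root gs by blast
  have "inv (inv g) = g" using inv_comp[OF gs(1)] by (intro inv_unique_comp)
  then show "r \<in> snd ` \<Phi>"
    using act_in[OF a inv_in[OF gs(1)]] gs(3) by force
next
  fix r assume "r \<in> snd ` \<Phi>"
  then obtain a0 where a0: "(a0, r) \<in> \<Phi>" by auto
  obtain a where a: "(a, r) \<in> \<Phi>" "a p > 0"
  proof (cases "a0 p > 0")
    case True
    with a0 that show ?thesis by blast
  next
    case False
    with root_nonzero[OF a0] have "- a0 p > 0" by linarith
    then show ?thesis using that[OF root_neg[OF a0]] by simp
  qed
  obtain ws where ws: "ws \<in> lists S" "word_prod ws = r"
    using root_generated[OF a0] by (auto simp: generated_by_involutions_def)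
  moreover have "a (word_prod ws p) < 0" using root_reflect[OF a(1)] a ws by simp
  ultimately obtain us s vs where us: "ws = us @ s # vs"
    "r = word_prod us \<circ> s \<circ> inv (word_prod us)"
    using exchange[OF ws(1) a] ws(2) by (auto simp del: o_apply)
  then show "r \<in> coxeter_reflections W S"
    using ws(1) by (auto simp: coxeter_reflections_def generated_by_involutions_def)
qed

text \<open>The reflection acts on the left here but on the right in \<open>bruhat_le\<close>; z t =
  (z t z^-1) z converts one into the other. A sign at z p replaces the comparison of
  lengths.\<close>

definition ascents :: "(('a \<Rightarrow> 'a) \<times> ('a \<Rightarrow> 'a)) set" where
  "ascents = {(z, t \<circ> z) | z t a. z \<in> W \<and> (a, t) \<in> \<Phi> \<and> a p > 0 \<and> a (z p) > 0}"

lemma ascentsI: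
  "z \<in> W \<Longrightarrow> (a, t) \<in> \<Phi> \<Longrightarrow> a p > 0 \<Longrightarrow> a (z p) > 0 \<Longrightarrow> (z, t \<circ> z) \<in> ascents"
  unfolding ascents_def by blast

lemma pos_root_ex:
  assumes "(a, t) \<in> \<Phi>"
  obtains b where "(b, t) \<in> \<Phi>" "b p > 0"
  using that[OF assms] that[OF root_neg[OF assms]] root_nonzero[OF assms]
  by fastforce

lemma bruhat_le_iff: "bruhat_le W S x y \<longleftrightarrow> (x, y) \<in> ascents\<^sup>*"
proof -
  have "{(z, z \<circ> t) | z t. z \<in> W \<and> t \<in> coxeter_reflections W S \<and> len z < len (z \<circ> t)} = ascents"
    (is "?A = _")
  proof (intro subset_antisym subsetI; clarify)
    fix z t assume z: "z \<in> W" "t \<in> coxeter_reflections W S" "len z < len (z \<circ> t)"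
    then obtain a where a: "(a, t) \<in> \<Phi>" by (auto simp: reflections_eq)
    have inv2: "inv (inv z) = z" using inv_comp[OF z(1)] by (intro inv_unique_comp)
    have "(a \<circ> inv z, z \<circ> t \<circ> inv z) \<in> \<Phi>"
      using act_in[OF a inv_in[OF z(1)]] inv2 by simp
    then obtain b where b: "(b, z \<circ> t \<circ> inv z) \<in> \<Phi>" "b p > 0" by (rule pos_root_ex)
    have eq: "z \<circ> t \<circ> inv z \<circ> z = z \<circ> t" using inv_comp[OF z(1)] by (simp add: comp_assoc)
    then have "b (z p) > 0" using len_reflect_less_iff[OF z(1) b] z(3) by simp
    then show "(z, z \<circ> t) \<in> ascents" using ascentsI[OF z(1) b] eq by simp
  next
    fix z y assume "(z, y) \<in> ascents"
    then obtain t a where z: "z \<in> W" "(a, t) \<in> \<Phi>" "a p > 0" "a (z p) > 0" "y = t \<circ> z"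
      by (auto simp: ascents_def)
    have "inv z \<circ> t \<circ> z \<in> coxeter_reflections W S"
      using act_in[OF z(2,1)] by (force simp: reflections_eq)
    moreover have "z \<circ> (inv z \<circ> t \<circ> z) = t \<circ> z"
      using inv_comp[OF z(1)] by (simp add: comp_assoc[symmetric])
    ultimately show "\<exists>z' t'. (z, y) = (z', z' \<circ> t') \<and> z' \<in> W \<and> t' \<in> coxeter_reflections W S
        \<and> len z' < len (z' \<circ> t')"
      using z len_reflect_greater[OF z(1-4)] by metis
  qed
  then show ?thesis unfolding bruhat_le_def by simp
qed

text \<open>For a simple reflection s with positive function a, this is the smaller of z and s
  z.\<close>

definition lower :: "('a \<Rightarrow> real) \<Rightarrow> ('a \<Rightarrow> 'a) \<Rightarrow> ('a \<Rightarrow> 'a) \<Rightarrow> 'a \<Rightarrow> 'a" where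
  "lower a s z = (if a (z p) < 0 then s \<circ> z else z)"

text \<open>For t = s both elements lower to the same one. Otherwise a \<circ> s is still positive
  at p by \<open>simple_unique\<close>, so the ascent from y to x is carried to one from s y to s x.
  If x is not lowered, \<open>lower\<close> of y lies below y, hence below x.\<close>

lemma ascents_lower:
  assumes s: "s \<in> S" "(b, s) \<in> \<Phi>" "b p > 0" and "(y, x) \<in> ascents"
  shows "(lower b s y, lower b s x) \<in> ascents\<^sup>*"
proof -
  obtain t a where y: "y \<in> W" "(a, t) \<in> \<Phi>" "a p > 0" "a (y p) > 0" "x = t \<circ> y"
    using assms(4) by (auto simp: ascents_def)
  have x: "x \<in> W" using y generated_comp root_generated by blast
  have ss: "s (s u) = u" for u using simple_invol[OF s(1)] by (metis comp_apply id_apply)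
  have s_lower: "(s \<circ> z, z) \<in> ascents" if "z \<in> W" "b (z p) < 0" for z
  proof -
    have "s \<circ> z \<in> W" using that s generated_comp generated_base by blast
    moreover have "b ((s \<circ> z) p) > 0" using root_reflect[OF s(2)] that by simp
    ultimately have "(s \<circ> z, s \<circ> (s \<circ> z)) \<in> ascents" using ascentsI s by blast
    then show ?thesis by (simp add: comp_def ss)
  qed
  have lower_le: "(lower b s z, z) \<in> ascents\<^sup>*" if "z \<in> W" for z
    using s_lower[OF that] by (auto simp: lower_def)
  show ?thesis
  proof (cases "t = s")
    case True
    have "b (x p) = - b (y p)" using y True root_reflect[OF s(2)] by simp
    moreover have "s \<circ> x = y" using y True by (simp add: comp_def ss)
    ultimately have "lower b s x = lower b s y"
      using act_nonzero[OF s(2) y(1)] True y(5) by (auto simp: lower_def)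
    then show ?thesis by simp
  next
    case False
    show ?thesis
    proof (cases "b (x p) < 0")
      case True
      have sy: "s \<circ> y \<in> W" using y s generated_comp generated_base by blast
      have "(a \<circ> s, s \<circ> t \<circ> s) \<in> \<Phi>" using root_act y s by blast
      moreover have "(a \<circ> s) p > 0"
        using simple_unique[OF s(1) y(2,3)] False act_nonzero[OF y(2) generated_base[OF s(1)]]
        by force
      moreover have "(a \<circ> s) ((s \<circ> y) p) > 0" using y by (simp add: ss)
      ultimately have "(s \<circ> y, s \<circ> t \<circ> s \<circ> (s \<circ> y)) \<in> ascents" using ascentsI sy by blast
      moreover have "s \<circ> t \<circ> s \<circ> (s \<circ> y) = s \<circ> x" using y by (auto simp: ss)
      ultimately have le: "(s \<circ> y, lower b s x) \<in> ascents\<^sup>*" using True by (simp add: lower_def)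
      show ?thesis
      proof (cases "b (y p) < 0")
        case True
        then show ?thesis using le by (simp add: lower_def)
      next
        case False
        then have "b (y p) > 0" using act_nonzero[OF s(2) y(1)] by simp
        then have "(y, s \<circ> y) \<in> ascents" using ascentsI y s by blast
        then show ?thesis using le False by (auto simp: lower_def)
      qed
    next
      case False
      then have "lower b s x = x" by (simp add: lower_def)
      then show ?thesis using lower_le[OF y(1)] assms(4) by auto
    qed
  qed
qed

lemma lifting:
  assumes "s \<in> S" "(b, s) \<in> \<Phi>" "b p > 0" and "(y, x) \<in> ascents\<^sup>*"
  shows "(lower b s y, lower b s x) \<in> ascents\<^sup>*"
  using assms(4)
proof (induction rule: rtrancl_induct)
  case (step x x')
  then show ?case using ascents_lower[OF assms(1-3) step(2)] by (metis rtrancl_trans)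
qed simp

end

section \<open>Root systems and their Weyl groups\<close>

lemma coroot_inner: "coroot \<alpha> \<bullet> x = 2 * (\<alpha> \<bullet> x) / (\<alpha> \<bullet> \<alpha>)"
  by (simp add: coroot_def)

lemma coroot_self: "\<alpha> \<noteq> 0 \<Longrightarrow> coroot \<alpha> \<bullet> \<alpha> = 2"
  by (simp add: coroot_inner)

lemma coroot_pos_iff: "\<alpha> \<noteq> 0 \<Longrightarrow> coroot \<alpha> \<bullet> x > 0 \<longleftrightarrow> \<alpha> \<bullet> x > 0"
  and coroot_zero_iff: "\<alpha> \<noteq> 0 \<Longrightarrow> coroot \<alpha> \<bullet> x = 0 \<longleftrightarrow> \<alpha> \<bullet> x = 0"
  by (simp_all add: coroot_inner zero_less_divide_iff divide_less_0_iff)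
     (metis inner_gt_zero_iff linorder_not_less inner_ge_zero)+

lemma coroot_minus: "coroot (- \<alpha>) = - coroot \<alpha>"
  by (simp add: coroot_def)

lemma root_reflection_minus: "root_reflection (- \<alpha>) = root_reflection \<alpha>"
  by (auto simp: root_reflection_def coroot_minus)

lemma root_reflection_self: "\<alpha> \<noteq> 0 \<Longrightarrow> root_reflection \<alpha> \<alpha> = - \<alpha>"
  by (simp add: root_reflection_def coroot_self scaleR_2)

lemma root_reflection_inner: "root_reflection \<alpha> x \<bullet> y = x \<bullet> root_reflection \<alpha> y"
  by (simp add: root_reflection_def coroot_def inner_diff inner_commute)

lemma root_reflection_coroot:
  "root_reflection \<alpha> x = x - (\<alpha> \<bullet> x) *\<^sub>R coroot \<alpha>"
  by (simp add: root_reflection_def coroot_def)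

lemma root_reflection_twice [simp]: "root_reflection \<alpha> (root_reflection \<alpha> x) = x"
proof (cases "\<alpha> = 0")
  case False
  then have "coroot \<alpha> \<bullet> root_reflection \<alpha> x = - (coroot \<alpha> \<bullet> x)"
    by (simp add: root_reflection_def inner_diff coroot_self)
  then show ?thesis by (simp add: root_reflection_def)
qed (simp add: root_reflection_def)

lemma root_reflection_comp: "root_reflection \<alpha> \<circ> root_reflection \<alpha> = id"
  by (auto simp: fun_eq_iff)

lemma linear_root_reflection: "linear (root_reflection \<alpha>)"
  unfolding root_reflection_def
  by (rule linearI) (simp_all add: inner_add algebra_simps)

lemma orthogonal_root_reflection: "orthogonal_transformation (root_reflection \<alpha>)"
  unfolding orthogonal_transformation_def
  by (metis linear_root_reflection root_reflection_inner root_reflection_twice)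

lemma coroot_orthogonal:
  assumes "orthogonal_transformation f"
  shows "coroot (f \<alpha>) = f (coroot \<alpha>)"
  using assms linear_scale[of f]
  by (simp add: coroot_def orthogonal_transformation_def)

lemma root_reflection_orthogonal:
  assumes "orthogonal_transformation f"
  shows "root_reflection (f \<alpha>) (f x) = f (root_reflection \<alpha> x)"
  using assms linear_diff[of f] linear_scale[of f] coroot_orthogonal[OF assms]
  by (simp add: root_reflection_def orthogonal_transformation_def)

lemma root_reflection_conj:
  "root_reflection (root_reflection \<beta> \<alpha>) =
     root_reflection \<beta> \<circ> root_reflection \<alpha> \<circ> root_reflection \<beta>"
  using root_reflection_orthogonal[OF orthogonal_root_reflection, of \<beta> \<alpha>]
  by (metis (no_types, opaque_lifting) comp_apply ext root_reflection_twice)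

section \<open>Simple roots, heights and generation by simple reflections\<close>

locale root_base =
  fixes R \<Delta> :: "'a::euclidean_space set"
  assumes rs: "root_system R" and sr: "simple_roots R \<Delta>"
begin

lemma finite_R: "finite R" and zero_notin: "0 \<notin> R" and span_R: "span R = UNIV"
  and refl_R: "\<alpha> \<in> R \<Longrightarrow> root_reflection \<alpha> ` R = R"
  and integral: "\<alpha> \<in> R \<Longrightarrow> \<beta> \<in> R \<Longrightarrow> coroot \<alpha> \<bullet> \<beta> \<in> \<int>"
  and reduced: "\<alpha> \<in> R \<Longrightarrow> c *\<^sub>R \<alpha> \<in> R \<Longrightarrow> c = 1 \<or> c = -1"
  using rs unfolding root_system_def by auto

lemma root_nz: "\<alpha> \<in> R \<Longrightarrow> \<alpha> \<noteq> 0"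
  using zero_notin by auto

lemma refl_in: "\<alpha> \<in> R \<Longrightarrow> \<beta> \<in> R \<Longrightarrow> root_reflection \<alpha> \<beta> \<in> R"
  using refl_R by blast

lemma neg_in: "\<alpha> \<in> R \<Longrightarrow> - \<alpha> \<in> R"
  using refl_in[of \<alpha> \<alpha>] root_reflection_self[OF root_nz] by simp

lemma Delta_R: "\<Delta> \<subseteq> R" and indep: "independent \<Delta>"
  and pos_or_neg: "\<alpha> \<in> R \<Longrightarrow> \<alpha> \<in> nonneg_combinations \<Delta> \<or> - \<alpha> \<in> nonneg_combinations \<Delta>"
  using sr unfolding simple_roots_def by auto

lemma finite_Delta: "finite \<Delta>"
  using Delta_R finite_R finite_subset by blast

lemma nonneg_span: "x \<in> nonneg_combinations \<Delta> \<Longrightarrow> x \<in> span \<Delta>"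
  unfolding nonneg_combinations_def by (auto intro!: span_sum span_scale intro: span_base)

lemma span_Delta: "span \<Delta> = UNIV"
proof -
  have "R \<subseteq> span \<Delta>"
    using pos_or_neg nonneg_span span_neg by (metis minus_minus subsetI)
  then show ?thesis using span_R by (metis span_minimal subspace_span top.extremum_uniqueI)
qed

lemma dual_exists: "\<exists>f. \<forall>\<gamma>\<in>\<Delta>. \<forall>\<delta>\<in>\<Delta>. \<delta> \<bullet> f \<gamma> = (if \<delta> = \<gamma> then 1 else (0::real))"
proof -
  have "\<exists>v. \<forall>\<delta>\<in>\<Delta>. \<delta> \<bullet> v = (if \<delta> = \<gamma> then 1 else (0::real))" for \<gamma>
  proof -
    obtain g :: "'a \<Rightarrow> real" where g: "linear g" "\<forall>\<delta>\<in>\<Delta>. g \<delta> = (if \<delta> = \<gamma> then 1 else 0)"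
      using linear_independent_extend[OF indep, of "\<lambda>\<delta>. if \<delta> = \<gamma> then 1 else 0"] by auto
    have "g x = x \<bullet> (\<Sum>b\<in>Basis. g b *\<^sub>R b)" for x
    proof -
      have "g x = g (\<Sum>b\<in>Basis. (x \<bullet> b) *\<^sub>R b)" by (simp add: euclidean_representation)
      also have "\<dots> = (\<Sum>b\<in>Basis. (x \<bullet> b) * g b)"
        using g(1) by (simp add: linear_sum linear_scale)
      also have "\<dots> = x \<bullet> (\<Sum>b\<in>Basis. g b *\<^sub>R b)"
        by (simp add: inner_sum_right mult.commute)
      finally show ?thesis .
    qed
    then show ?thesis using g(2) by (intro exI[of _ "\<Sum>b\<in>Basis. g b *\<^sub>R b"]) metis
  qed
  then show ?thesis by metis
qed

definition coweight :: "'a \<Rightarrow> 'a" where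
  "coweight = (SOME f. \<forall>\<gamma>\<in>\<Delta>. \<forall>\<delta>\<in>\<Delta>. \<delta> \<bullet> f \<gamma> = (if \<delta> = \<gamma> then 1 else 0))"

lemma coweight: "\<gamma> \<in> \<Delta> \<Longrightarrow> \<delta> \<in> \<Delta> \<Longrightarrow> \<delta> \<bullet> coweight \<gamma> = (if \<delta> = \<gamma> then 1 else 0)"
  using someI_ex[OF dual_exists] unfolding coweight_def by blast

text \<open>The pairing with \<open>h\<close> is the height.\<close>

definition h :: 'a where "h = (\<Sum>\<gamma>\<in>\<Delta>. coweight \<gamma>)"

lemma inner_coweight_sum:
  "\<gamma> \<in> \<Delta> \<Longrightarrow> (\<Sum>\<delta>\<in>\<Delta>. c \<delta> *\<^sub>R \<delta>) \<bullet> coweight \<gamma> = c \<gamma>"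
  using finite_Delta by (simp add: inner_sum_left coweight if_distrib cong: if_cong)

lemma simple_expansion: "(\<Sum>\<delta>\<in>\<Delta>. (x \<bullet> coweight \<delta>) *\<^sub>R \<delta>) = x"
proof -
  have "x \<in> span \<Delta>" using span_Delta by simp
  then obtain c where "x = (\<Sum>\<delta>\<in>\<Delta>. c \<delta> *\<^sub>R \<delta>)"
    using span_finite[OF finite_Delta] by auto
  then show ?thesis by (simp add: inner_coweight_sum)
qed

lemma inner_h: "x \<bullet> h = (\<Sum>\<delta>\<in>\<Delta>. x \<bullet> coweight \<delta>)"
  by (simp add: h_def inner_sum_right)

lemma simple_h: "\<delta> \<in> \<Delta> \<Longrightarrow> \<delta> \<bullet> h = 1"
  using finite_Delta by (simp add: inner_h coweight if_distrib cong: if_cong)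

lemma nonneg_iff: "x \<in> nonneg_combinations \<Delta> \<longleftrightarrow> (\<forall>\<delta>\<in>\<Delta>. x \<bullet> coweight \<delta> \<in> \<nat>)"
proof
  assume "x \<in> nonneg_combinations \<Delta>"
  then show "\<forall>\<delta>\<in>\<Delta>. x \<bullet> coweight \<delta> \<in> \<nat>"
    by (auto simp: nonneg_combinations_def inner_coweight_sum)
next
  assume "\<forall>\<delta>\<in>\<Delta>. x \<bullet> coweight \<delta> \<in> \<nat>"
  then have "\<forall>\<delta>\<in>\<Delta>. real (nat \<lfloor>x \<bullet> coweight \<delta>\<rfloor>) = x \<bullet> coweight \<delta>"
    by (auto elim!: Nats_cases)
  then have "x = (\<Sum>\<delta>\<in>\<Delta>. real (nat \<lfloor>x \<bullet> coweight \<delta>\<rfloor>) *\<^sub>R \<delta>)"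
    using simple_expansion[of x] by simp
  then show "x \<in> nonneg_combinations \<Delta>"
    unfolding nonneg_combinations_def by (intro CollectI exI conjI) auto
qed

definition dominant :: "'a \<Rightarrow> bool" where
  "dominant \<omega> \<longleftrightarrow> (\<forall>\<delta>\<in>\<Delta>. \<delta> \<bullet> \<omega> \<ge> 0)"

lemma nonneg_dominant: "x \<in> nonneg_combinations \<Delta> \<Longrightarrow> dominant \<omega> \<Longrightarrow> x \<bullet> \<omega> \<ge> 0"
  by (auto simp: nonneg_combinations_def inner_sum_left dominant_def intro!: sum_nonneg)

lemma nonneg_Nat_h:
  assumes "x \<in> nonneg_combinations \<Delta>"
  shows "x \<bullet> h \<in> \<nat>"
proof -
  obtain c where "x = (\<Sum>\<delta>\<in>\<Delta>. real (c \<delta>) *\<^sub>R \<delta>)"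
    using assms by (auto simp: nonneg_combinations_def)
  then have "x \<bullet> h = of_nat (\<Sum>\<delta>\<in>\<Delta>. c \<delta>)"
    by (simp add: inner_sum_left simple_h)
  then show ?thesis by (metis of_nat_in_Nats)
qed

lemma nonneg_h_eq_0:
  assumes "x \<in> nonneg_combinations \<Delta>" "x \<bullet> h \<le> 0"
  shows "x = 0"
proof -
  have "\<forall>\<delta>\<in>\<Delta>. x \<bullet> coweight \<delta> \<ge> 0" using assms(1) by (auto simp: nonneg_iff elim!: Nats_cases)
  moreover from this have "(\<Sum>\<delta>\<in>\<Delta>. x \<bullet> coweight \<delta>) = 0"
    using assms(2) sum_nonneg[of \<Delta> "\<lambda>\<delta>. x \<bullet> coweight \<delta>"] by (simp add: inner_h)
  ultimately have "\<forall>\<delta>\<in>\<Delta>. x \<bullet> coweight \<delta> = 0"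
    using sum_nonneg_eq_0_iff[OF finite_Delta, of "\<lambda>\<delta>. x \<bullet> coweight \<delta>"] by simp
  then show ?thesis using simple_expansion[of x] by simp
qed

abbreviation "Rp \<equiv> positive_roots R \<Delta>"

lemma Rp_iff: "\<alpha> \<in> Rp \<longleftrightarrow> \<alpha> \<in> R \<and> \<alpha> \<bullet> h > 0"
proof -
  have *: "\<alpha> \<bullet> h > 0" if "\<alpha> \<in> R" "\<alpha> \<in> nonneg_combinations \<Delta>" for \<alpha>
    using nonneg_h_eq_0[OF that(2)] root_nz[OF that(1)] by force
  then show ?thesis
    using pos_or_neg[of \<alpha>] *[of "- \<alpha>"] neg_in[of \<alpha>] unfolding positive_roots_def by force
qed

lemma Rp_R: "\<alpha> \<in> Rp \<Longrightarrow> \<alpha> \<in> R"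
  by (simp add: positive_roots_def)

lemma finite_Rp: "finite Rp"
  using finite_R by (simp add: positive_roots_def)

lemma h_nonzero: "\<alpha> \<in> R \<Longrightarrow> \<alpha> \<bullet> h \<noteq> 0"
proof -
  assume \<alpha>: "\<alpha> \<in> R"
  then have "\<alpha> \<in> Rp \<or> - \<alpha> \<in> Rp"
    using pos_or_neg neg_in unfolding positive_roots_def by blast
  then show ?thesis unfolding Rp_iff by auto
qed

lemma Rp_or: "\<alpha> \<in> R \<Longrightarrow> \<alpha> \<in> Rp \<or> - \<alpha> \<in> Rp"
  using pos_or_neg neg_in unfolding positive_roots_def by blast

lemma Rp_minus: "\<alpha> \<in> Rp \<Longrightarrow> - \<alpha> \<notin> Rp"
  by (simp add: Rp_iff)

lemma Delta_Rp: "\<delta> \<in> \<Delta> \<Longrightarrow> \<delta> \<in> Rp"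
  using Delta_R simple_h by (auto simp: Rp_iff)

lemma Rp_coweight: "\<alpha> \<in> Rp \<Longrightarrow> \<gamma> \<in> \<Delta> \<Longrightarrow> \<alpha> \<bullet> coweight \<gamma> \<ge> 0"
  by (auto simp: positive_roots_def nonneg_iff Nats_altdef2)

lemma Rp_dominant: "\<alpha> \<in> Rp \<Longrightarrow> dominant \<omega> \<Longrightarrow> \<alpha> \<bullet> \<omega> \<ge> 0"
  using nonneg_dominant by (auto simp: positive_roots_def)

text \<open>As R is reduced, a positive root other than \<delta> has a positive coefficient at some
  other simple root, and the reflection in \<delta> changes the coefficient of \<delta>
  only.\<close>

lemma simple_refl_pos:
  assumes "\<delta> \<in> \<Delta>" "\<alpha> \<in> Rp" "\<alpha> \<noteq> \<delta>"
  shows "root_reflection \<delta> \<alpha> \<in> Rp"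
proof -
  have "\<exists>\<gamma>\<in>\<Delta>. \<gamma> \<noteq> \<delta> \<and> \<alpha> \<bullet> coweight \<gamma> \<noteq> 0"
  proof (rule ccontr)
    assume "\<not> ?thesis"
    then have "(\<Sum>\<gamma>\<in>\<Delta>. (\<alpha> \<bullet> coweight \<gamma>) *\<^sub>R \<gamma>) = (\<Sum>\<gamma>\<in>\<Delta>. if \<gamma> = \<delta> then (\<alpha> \<bullet> coweight \<delta>) *\<^sub>R \<delta> else 0)"
      by (intro sum.cong) auto
    then have "\<alpha> = (\<alpha> \<bullet> coweight \<delta>) *\<^sub>R \<delta>"
      using simple_expansion[of \<alpha>] finite_Delta assms(1) by simp
    moreover from this have "\<alpha> \<bullet> coweight \<delta> = 1 \<or> \<alpha> \<bullet> coweight \<delta> = -1"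
      using reduced[of \<delta>] Delta_R assms Rp_R by (metis subsetD)
    ultimately have "\<alpha> = \<delta>"
      using Rp_coweight[OF assms(2,1)] by auto
    then show False using assms by simp
  qed
  then obtain \<gamma> where \<gamma>: "\<gamma> \<in> \<Delta>" "\<gamma> \<noteq> \<delta>" "\<alpha> \<bullet> coweight \<gamma> > 0"
    using Rp_coweight[OF assms(2)] by force
  have "root_reflection \<delta> \<alpha> \<bullet> coweight \<gamma> > 0"
    using \<gamma> assms(1) coweight[of \<gamma> \<delta>] by (simp add: root_reflection_def inner_diff)
  then have "- root_reflection \<delta> \<alpha> \<notin> Rp"
    using Rp_coweight[OF _ \<gamma>(1), of "- root_reflection \<delta> \<alpha>"] by auto
  moreover have "root_reflection \<delta> \<alpha> \<in> R"
    using refl_in Delta_R assms Rp_R by blast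
  ultimately show ?thesis using Rp_or by blast
qed

lemma simple_refl_bij:
  assumes "\<delta> \<in> \<Delta>"
  shows "bij_betw (root_reflection \<delta>) (Rp - {\<delta>}) (Rp - {\<delta>})"
proof -
  have "root_reflection \<delta> \<alpha> \<in> Rp - {\<delta>}" if "\<alpha> \<in> Rp - {\<delta>}" for \<alpha>
  proof -
    have "root_reflection \<delta> \<alpha> \<noteq> \<delta>"
    proof
      assume "root_reflection \<delta> \<alpha> = \<delta>"
      then have "\<alpha> = - \<delta>"
        using root_reflection_self root_nz Delta_R assms root_reflection_twice by (metis subsetD)
      then show False using that Delta_Rp[OF assms] Rp_minus by auto
    qed
    then show ?thesis using simple_refl_pos assms that by auto
  qed
  then show ?thesis
    by (intro bij_betw_byWitness[of _ "root_reflection \<delta>"]) auto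
qed

text \<open>Induction on the height: a positive non-simple root has positive inner product with some
  simple \<delta>, since otherwise its norm would be nonpositive. Reflecting in \<delta> gives a
  lower positive root, and the two reflections are conjugate by that of \<delta>.\<close>

lemma refl_in_simple_generated:
  assumes "\<alpha> \<in> R"
  shows "root_reflection \<alpha> \<in> generated_by_involutions (root_reflection ` \<Delta>)"
proof -
  let ?W = "generated_by_involutions (root_reflection ` \<Delta>)"
  have "root_reflection \<alpha> \<in> ?W" if "\<alpha> \<in> Rp" "\<alpha> \<bullet> h = real n" for n \<alpha>
    using that
  proof (induction n arbitrary: \<alpha> rule: less_induct)
    case (less n)
    show ?case
    proof (cases "\<alpha> \<in> \<Delta>")
      case True
      then show ?thesis by (intro generated_base) auto
    next
      case False
      have "\<exists>\<delta>\<in>\<Delta>. \<alpha> \<bullet> \<delta> > 0"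
      proof (rule ccontr)
        assume "\<not> ?thesis"
        then have "\<forall>\<delta>\<in>\<Delta>. (\<alpha> \<bullet> coweight \<delta>) * (\<alpha> \<bullet> \<delta>) \<le> 0"
          using Rp_coweight less(2) by (auto simp: mult_nonneg_nonpos not_less)
        then have "(\<Sum>\<delta>\<in>\<Delta>. (\<alpha> \<bullet> coweight \<delta>) * (\<alpha> \<bullet> \<delta>)) \<le> 0" by (intro sum_nonpos) blast
        moreover have "\<alpha> \<bullet> \<alpha> = (\<Sum>\<delta>\<in>\<Delta>. (\<alpha> \<bullet> coweight \<delta>) * (\<alpha> \<bullet> \<delta>))"
          by (subst (2) simple_expansion[of \<alpha>, symmetric]) (simp add: inner_sum_right)
        ultimately show False using root_nz Rp_R less(2) by (metis inner_gt_zero_iff not_less)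
      qed
      then obtain \<delta> where \<delta>: "\<delta> \<in> \<Delta>" "\<alpha> \<bullet> \<delta> > 0" by blast
      have ne: "\<alpha> \<noteq> \<delta>" using \<delta> False by auto
      let ?\<beta> = "root_reflection \<delta> \<alpha>"
      have \<beta>: "?\<beta> \<in> Rp" using simple_refl_pos \<delta> ne less by blast
      have "coroot \<delta> \<bullet> \<alpha> > 0"
        using \<delta> coroot_pos_iff[of \<delta> \<alpha>] root_nz Delta_R by (auto simp: inner_commute)
      then have "?\<beta> \<bullet> h < real n"
        using less(3) simple_h[OF \<delta>(1)] by (simp add: root_reflection_def inner_diff)
      moreover obtain m where m: "?\<beta> \<bullet> h = real m"
        using \<beta> nonneg_Nat_h by (auto simp: positive_roots_def elim!: Nats_cases)
      ultimately have "root_reflection ?\<beta> \<in> ?W" using less(1)[of m ?\<beta>] \<beta> by simp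
      moreover have "root_reflection \<alpha> = root_reflection \<delta> \<circ> (root_reflection ?\<beta> \<circ> root_reflection \<delta>)"
        unfolding root_reflection_conj by (auto simp: fun_eq_iff)
      moreover have "root_reflection \<delta> \<in> ?W" using \<delta> by (intro generated_base) auto
      ultimately show ?thesis using generated_comp by metis
    qed
  qed
  moreover have "\<exists>n. \<alpha> \<bullet> h = real n" if "\<alpha> \<in> Rp" for \<alpha>
    using that nonneg_Nat_h by (auto simp: positive_roots_def elim!: Nats_cases)
  ultimately have *: "root_reflection \<alpha> \<in> ?W" if "\<alpha> \<in> Rp" for \<alpha> using that by blast
  show ?thesis using Rp_or[OF assms] * root_reflection_minus by metis
qed

lemma weyl_group_simple: "weyl_group R = generated_by_involutions (root_reflection ` \<Delta>)"
  unfolding weyl_group_def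
proof (rule antisym)
  show "generated_by_involutions (root_reflection ` R) \<subseteq> generated_by_involutions (root_reflection ` \<Delta>)"
    by (rule generated_subset) (use refl_in_simple_generated in auto)
  show "generated_by_involutions (root_reflection ` \<Delta>) \<subseteq> generated_by_involutions (root_reflection ` R)"
    by (rule generated_subset) (use Delta_R generated_base in blast)
qed

abbreviation "WG \<equiv> weyl_group R"

lemma refl_WG: "\<alpha> \<in> R \<Longrightarrow> root_reflection \<alpha> \<in> WG"
  unfolding weyl_group_def by (intro generated_base) auto

lemma WG_comp: "g \<in> WG \<Longrightarrow> g' \<in> WG \<Longrightarrow> g \<circ> g' \<in> WG"
  unfolding weyl_group_def by (rule generated_comp)

lemma WG_id: "id \<in> WG"
  unfolding weyl_group_def by (rule generated_id)

lemma WG_orth: "g \<in> WG \<Longrightarrow> orthogonal_transformation g"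
  unfolding weyl_group_def
  by (induction rule: generated_induct)
     (use orthogonal_transformation_compose orthogonal_root_reflection in
       \<open>auto simp: orthogonal_transformation_id simp del: comp_apply\<close>)

lemma WG_linear: "g \<in> WG \<Longrightarrow> linear g"
  using WG_orth orthogonal_transformation_linear by blast

lemma WG_inner: "g \<in> WG \<Longrightarrow> g x \<bullet> g y = x \<bullet> y"
  using WG_orth by (auto simp: orthogonal_transformation_def)

lemma WG_R: "g \<in> WG \<Longrightarrow> \<alpha> \<in> R \<Longrightarrow> g \<alpha> \<in> R"
  unfolding weyl_group_def
  by (induction arbitrary: \<alpha> rule: generated_induct) (auto intro: refl_in)

lemma WG_inv: "g \<in> WG \<Longrightarrow> inv g \<in> WG"
  and WG_inv1: "g \<in> WG \<Longrightarrow> g (inv g x) = x" and WG_inv2: "g \<in> WG \<Longrightarrow> inv g (g x) = x"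
proof -
  assume g: "g \<in> WG"
  obtain g' where g': "g' \<in> WG" "g \<circ> g' = id" "g' \<circ> g = id"
    using generated_inverse[of "root_reflection ` R" g] g root_reflection_comp
    unfolding weyl_group_def by auto
  from g'(2,3) have "inv g = g'" by (rule inv_unique_comp)
  then show "inv g \<in> WG" "g (inv g x) = x" "inv g (g x) = x"
    using g' by (metis, metis pointfree_idE, metis pointfree_idE)
qed

lemma WG_inner_inv: "g \<in> WG \<Longrightarrow> x \<bullet> g y = inv g x \<bullet> y"
  using WG_inner[of g "inv g x" y] WG_inv1[of g x] by simp

lemma WG_nonzero: "g \<in> WG \<Longrightarrow> \<alpha> \<in> R \<Longrightarrow> \<alpha> \<bullet> g h \<noteq> 0"
  using WG_inner_inv h_nonzero WG_R WG_inv by metis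

text \<open>An element is determined by the permutation it induces on the finite spanning set
  R.\<close>

lemma finite_WG: "finite WG"
proof -
  have "inj_on (\<lambda>g. restrict g R) WG"
  proof (rule inj_onI)
    fix g g' assume g: "g \<in> WG" "g' \<in> WG" "restrict g R = restrict g' R"
    then have "g x = g' x" if "x \<in> R" for x using that by (metis restrict_apply)
    then have "g x = g' x" for x
      using linear_eq_on_span[OF WG_linear WG_linear, OF g(1,2), of R x] span_R by auto
    then show "g = g'" by auto
  qed
  moreover have "(\<lambda>g. restrict g R) ` WG \<subseteq> R \<rightarrow>\<^sub>E R"
    using WG_R by (auto simp: PiE_iff)
  moreover have "finite (R \<rightarrow>\<^sub>E R)" using finite_R by (intro finite_PiE)
  ultimately show ?thesis using finite_imageD finite_subset by blast
qed

section \<open>Lengths in the Weyl group\<close>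

sublocale fin: reflection_system "root_reflection ` \<Delta>" "{(\<lambda>x. \<alpha> \<bullet> x, root_reflection \<alpha>) |\<alpha>. \<alpha> \<in> R}" h
proof
  fix s assume "s \<in> root_reflection ` \<Delta>"
  then obtain \<delta> where \<delta>: "\<delta> \<in> \<Delta>" "s = root_reflection \<delta>" by blast
  show "\<exists>a. (a, s) \<in> {(\<lambda>x. \<alpha> \<bullet> x, root_reflection \<alpha>) |\<alpha>. \<alpha> \<in> R} \<and> a h > 0"
    using \<delta> simple_h Delta_R by (intro exI[of _ "\<lambda>x. \<delta> \<bullet> x"]) auto
next
  fix a t s
  assume at: "(a, t) \<in> {(\<lambda>x. \<alpha> \<bullet> x, root_reflection \<alpha>) |\<alpha>. \<alpha> \<in> R}"
  then obtain \<alpha> where \<alpha>: "\<alpha> \<in> R" "a = (\<lambda>x. \<alpha> \<bullet> x)" "t = root_reflection \<alpha>" by blast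
  show "a (t x) = - a x" for x
    using \<alpha> by (simp add: root_reflection_inner[symmetric] root_reflection_self root_nz)
  show "(\<lambda>x. - a x, t) \<in> {(\<lambda>x. \<alpha> \<bullet> x, root_reflection \<alpha>) |\<alpha>. \<alpha> \<in> R}"
    using \<alpha> neg_in[of \<alpha>]
    by (intro CollectI exI[of _ "- \<alpha>"]) (auto simp: root_reflection_minus)
  show "a h \<noteq> 0" using \<alpha> h_nonzero by simp
  show "t \<circ> t = id" using \<alpha> root_reflection_comp by blast
  show "t \<in> generated_by_involutions (root_reflection ` \<Delta>)"
    using \<alpha> refl_in_simple_generated by blast
  assume s: "s \<in> root_reflection ` \<Delta>"
  then obtain \<delta> where \<delta>: "\<delta> \<in> \<Delta>" "s = root_reflection \<delta>" by blast
  have "a \<circ> s = (\<lambda>x. root_reflection \<delta> \<alpha> \<bullet> x)"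
    using \<alpha> \<delta> by (auto simp: root_reflection_inner)
  then show "(a \<circ> s, s \<circ> t \<circ> s) \<in> {(\<lambda>x. \<alpha> \<bullet> x, root_reflection \<alpha>) |\<alpha>. \<alpha> \<in> R}"
    using \<alpha> \<delta> refl_in[of \<delta> \<alpha>] Delta_R root_reflection_conj[of \<delta> \<alpha>]
    by (intro CollectI exI[of _ "root_reflection \<delta> \<alpha>"]) (metis subsetD)
  assume "a h > 0" "a (s h) < 0"
  then have "\<alpha> \<in> Rp" "\<not> root_reflection \<delta> \<alpha> \<in> Rp"
    using \<alpha> \<delta> by (auto simp: Rp_iff root_reflection_inner)
  then show "t = s" using simple_refl_pos[OF \<delta>(1), of \<alpha>] \<alpha> \<delta> by blast
qed

abbreviation "lng \<equiv> weyl_length \<Delta>"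

lemma length_less_iff:
  assumes "g \<in> WG" "\<alpha> \<in> Rp"
  shows "lng g < lng (root_reflection \<alpha> \<circ> g) \<longleftrightarrow> \<alpha> \<bullet> g h > 0"
  unfolding weyl_length_def
  using fin.len_reflect_less_iff[of g "\<lambda>x. \<alpha> \<bullet> x" "root_reflection \<alpha>"] assms
  by (auto simp: weyl_group_simple Rp_iff)

lemma length_simple:
  assumes "g \<in> WG" "\<delta> \<in> \<Delta>" "\<delta> \<bullet> g h > 0"
  shows "lng (root_reflection \<delta> \<circ> g) = Suc (lng g)"
  unfolding weyl_length_def
  using fin.len_simple[of g "\<lambda>x. \<delta> \<bullet> x" "root_reflection \<delta>"] assms Delta_R
  by (auto simp: weyl_group_simple simple_h)

text \<open>Since \<beta> \<bullet> g h is the height of g^-1 \<beta>, these are the positive roots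
  that g^-1 makes negative, that is, the inversions of g^-1 in the usual convention.\<close>

definition inversions :: "('a \<Rightarrow> 'a) \<Rightarrow> 'a set" where
  "inversions g = {\<beta> \<in> Rp. \<beta> \<bullet> g h < 0}"

lemma card_inversions:
  assumes "g \<in> WG" "\<delta> \<in> \<Delta>" "\<delta> \<bullet> g h > 0"
  shows "card (inversions (root_reflection \<delta> \<circ> g)) = Suc (card (inversions g))"
proof -
  have eq: "inversions (root_reflection \<delta> \<circ> g) = insert \<delta> (root_reflection \<delta> ` inversions g)"
  proof (intro set_eqI iffI)
    fix \<beta> assume \<beta>: "\<beta> \<in> inversions (root_reflection \<delta> \<circ> g)"
    then have "\<beta> \<in> Rp" "root_reflection \<delta> \<beta> \<bullet> g h < 0"
      by (auto simp: inversions_def root_reflection_inner)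
    then show "\<beta> \<in> insert \<delta> (root_reflection \<delta> ` inversions g)"
      using simple_refl_pos[OF assms(2), of \<beta>]
      by (auto simp: inversions_def intro!: image_eqI[of _ _ "root_reflection \<delta> \<beta>"])
  next
    fix \<beta> assume "\<beta> \<in> insert \<delta> (root_reflection \<delta> ` inversions g)"
    then consider "\<beta> = \<delta>" | \<gamma> where "\<gamma> \<in> inversions g" "\<beta> = root_reflection \<delta> \<gamma>" by blast
    then show "\<beta> \<in> inversions (root_reflection \<delta> \<circ> g)"
    proof cases
      case 1
      have "\<delta> \<bullet> root_reflection \<delta> (g h) = - (\<delta> \<bullet> g h)"
        using root_reflection_self[OF root_nz] assms Delta_R
        by (simp add: root_reflection_inner[symmetric] subset_iff)
      then show ?thesis using 1 assms Delta_Rp by (auto simp: inversions_def)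
    next
      case 2
      then have "\<gamma> \<noteq> \<delta>" using assms by (auto simp: inversions_def)
      then show ?thesis using 2 simple_refl_pos[OF assms(2), of \<gamma>]
        by (auto simp: inversions_def root_reflection_inner)
    qed
  qed
  have "\<delta> \<notin> root_reflection \<delta> ` inversions g"
  proof
    assume "\<delta> \<in> root_reflection \<delta> ` inversions g"
    then obtain \<gamma> where \<gamma>: "\<gamma> \<in> inversions g" "\<delta> = root_reflection \<delta> \<gamma>" by blast
    then have "\<gamma> = - \<delta>"
      using root_reflection_twice[of \<delta> \<gamma>] root_reflection_self[OF root_nz[of \<delta>]] assms(2) Delta_R by auto
    then show False using \<gamma> Delta_Rp[OF assms(2)] Rp_minus by (auto simp: inversions_def)
  qed
  moreover have "inj_on (root_reflection \<delta>) (inversions g)"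
    by (metis inj_onI root_reflection_twice)
  moreover have "finite (inversions g)" using finite_Rp by (simp add: inversions_def)
  ultimately show ?thesis unfolding eq by (simp add: card_image)
qed

lemma length_eq_card: "g \<in> WG \<Longrightarrow> lng g = card (inversions g)"
  unfolding weyl_group_simple
proof (induction rule: generated_induct)
  case id
  have "inversions id = {}" by (auto simp: inversions_def Rp_iff)
  moreover have "lng id = 0"
    using word_length_le[of "[]" "root_reflection ` \<Delta>"] by (simp add: weyl_length_def)
  ultimately show ?case by (simp only: card.empty)
next
  case (step s y)
  then obtain \<delta> where \<delta>: "\<delta> \<in> \<Delta>" "s = root_reflection \<delta>" by blast
  have y: "y \<in> WG" using step weyl_group_simple by simp
  have sy: "root_reflection \<delta> \<circ> y \<in> WG" using y \<delta> refl_WG WG_comp Delta_R by blast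
  show ?case
  proof (cases "\<delta> \<bullet> y h > 0")
    case True
    then show ?thesis
      using card_inversions[OF y \<delta>(1)] length_simple[OF y \<delta>(1)] step(3) \<delta>(2) by presburger
  next
    case False
    then have "\<delta> \<bullet> y h < 0" using WG_nonzero[OF y] \<delta> Delta_R by force
    then have "\<delta> \<bullet> (root_reflection \<delta> \<circ> y) h > 0"
      using root_reflection_self[OF root_nz] \<delta> Delta_R
      by (simp add: root_reflection_inner[symmetric] subset_iff)
    note * = length_simple[OF sy \<delta>(1) this] card_inversions[OF sy \<delta>(1) this]
    have "root_reflection \<delta> \<circ> (root_reflection \<delta> \<circ> y) = y" by (auto simp: fun_eq_iff)
    then show ?thesis using * step(3) \<delta>(2) by presburger
  qed
qed

text \<open>The sign form lets a difference of lengths be compared term by term with a pairing with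
  2\<rho>, which \<open>height_deg_theta\<close> needs.\<close>

lemma length_eq_sum:
  assumes "g \<in> WG"
  shows "real (lng g) = (\<Sum>\<beta>\<in>Rp. (1 - sgn (\<beta> \<bullet> g h)) / 2)"
proof -
  have "(\<Sum>\<beta>\<in>Rp. (1 - sgn (\<beta> \<bullet> g h)) / 2) = (\<Sum>\<beta>\<in>Rp. if \<beta> \<bullet> g h < 0 then 1 else 0)"
    using WG_nonzero[OF assms] Rp_R by (intro sum.cong) (auto simp: sgn_if)
  also have "\<dots> = real (card (inversions g))"
    using finite_Rp by (simp add: inversions_def sum.If_cases Int_def)
  finally show ?thesis using length_eq_card[OF assms] by simp
qed

lemma length_comp_le:
  assumes "g \<in> WG" "g' \<in> WG"
  shows "lng (g \<circ> g') \<le> lng g + lng g'"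
  using word_length_comp_le assms unfolding weyl_length_def weyl_group_simple by blast

text \<open>The reflection in \<delta> permutes the positive roots other than \<delta>, so their
  part of the sum is fixed by it and hence orthogonal to \<delta>. Used for the sum of the roots and
  for that of the coroots.\<close>

lemma simple_inner_sum:
  assumes "\<delta> \<in> \<Delta>" "\<And>\<alpha>. c (root_reflection \<delta> \<alpha>) = root_reflection \<delta> (c \<alpha>)"
  shows "\<delta> \<bullet> (\<Sum>\<alpha>\<in>Rp. c \<alpha>) = \<delta> \<bullet> c \<delta>"
proof -
  let ?T = "\<Sum>\<alpha>\<in>Rp - {\<delta>}. c \<alpha>"
  have "?T = (\<Sum>\<alpha>\<in>Rp - {\<delta>}. c (root_reflection \<delta> \<alpha>))"
    using sum.reindex_bij_betw[OF simple_refl_bij[OF assms(1)], of c] by simp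
  also have "\<dots> = root_reflection \<delta> ?T"
    by (simp add: assms(2) linear_sum[OF linear_root_reflection])
  finally have "root_reflection \<delta> ?T = ?T" by simp
  then have "\<delta> \<bullet> ?T = - (\<delta> \<bullet> ?T)"
    using root_reflection_inner[of \<delta> \<delta> ?T] root_reflection_self[OF root_nz] assms(1) Delta_R
    by (simp add: subset_iff)
  then show ?thesis
    using sum.remove[OF finite_Rp Delta_Rp[OF assms(1)], of c] by (simp add: inner_add)
qed

abbreviation "\<rho>2 \<equiv> two_rho R \<Delta>"

lemma simple_two_rho: "\<delta> \<in> \<Delta> \<Longrightarrow> \<delta> \<bullet> \<rho>2 > 0"
  using simple_inner_sum[of \<delta> "\<lambda>\<alpha>. \<alpha>"] root_nz Delta_R by (auto simp: two_rho_def)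

lemma dominant_two_rho: "dominant \<rho>2"
  using simple_two_rho by (auto simp: dominant_def less_imp_le)

text \<open>By \<open>simple_rho_check2\<close> it pairs with simple roots like 2 \<open>h\<close>;
  written as a sum of coroots it visibly lies in the coroot lattice, so its multiples can serve as
  translations.\<close>

definition rho_check2 :: 'a where "rho_check2 = (\<Sum>\<alpha>\<in>Rp. coroot \<alpha>)"

lemma simple_rho_check2:
  assumes "\<delta> \<in> \<Delta>"
  shows "\<delta> \<bullet> rho_check2 = 2"
proof -
  have "\<delta> \<bullet> rho_check2 = \<delta> \<bullet> coroot \<delta>"
    unfolding rho_check2_def
    by (intro simple_inner_sum assms coroot_orthogonal orthogonal_root_reflection)
  then show ?thesis
    using coroot_self[OF root_nz] assms Delta_R by (auto simp: inner_commute)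
qed

text \<open>In the pairing of the coroot with 2\<rho>, the non-inversions of the reflection cancel
  because it permutes them and negates their pairings. Each inversion contributes a positive
  integer, and \<alpha> itself contributes 2, whence the extra 1.\<close>

lemma length_reflection_le:
  assumes "\<alpha> \<in> Rp"
  shows "real (lng (root_reflection \<alpha>)) + 1 \<le> coroot \<alpha> \<bullet> \<rho>2"
proof -
  let ?r = "root_reflection \<alpha>"
  let ?B = "inversions ?r" and ?A = "Rp - inversions ?r"
  have \<alpha>R: "\<alpha> \<in> R" and anz: "\<alpha> \<noteq> 0" using assms Rp_R root_nz by auto
  have fB: "finite ?B" and BRp: "?B \<subseteq> Rp" using finite_Rp by (auto simp: inversions_def)
  have nz: "\<beta> \<bullet> ?r h \<noteq> 0" if "\<beta> \<in> R" for \<beta>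
    using WG_nonzero[OF refl_WG] that \<alpha>R by blast
  have "?r \<beta> \<in> ?A" if "\<beta> \<in> ?A" for \<beta>
  proof -
    have "\<beta> \<in> R" "\<beta> \<bullet> h > 0" "\<beta> \<bullet> ?r h > 0"
      using that nz[of \<beta>] by (auto simp: inversions_def Rp_iff)
    then show ?thesis
      using refl_in[OF \<alpha>R] by (auto simp: inversions_def Rp_iff root_reflection_inner)
  qed
  then have bij: "bij_betw ?r ?A ?A"
    by (intro bij_betw_byWitness[of _ ?r]) auto
  have "coroot \<alpha> \<bullet> ?r \<beta> = - (coroot \<alpha> \<bullet> \<beta>)" for \<beta>
    using anz by (simp add: root_reflection_def inner_diff coroot_self)
  then have "(\<Sum>\<beta>\<in>?A. coroot \<alpha> \<bullet> \<beta>) = - (\<Sum>\<beta>\<in>?A. coroot \<alpha> \<bullet> \<beta>)"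
    using sum.reindex_bij_betw[OF bij, of "\<lambda>\<beta>. coroot \<alpha> \<bullet> \<beta>"] by (simp add: sum_negf)
  then have A: "(\<Sum>\<beta>\<in>?A. coroot \<alpha> \<bullet> \<beta>) = 0" by simp
  have "\<alpha> \<bullet> ?r h < 0"
    using assms root_reflection_self[OF anz] by (simp add: root_reflection_inner[symmetric] Rp_iff)
  then have \<alpha>B: "\<alpha> \<in> ?B" using assms by (simp add: inversions_def)
  have "coroot \<alpha> \<bullet> \<beta> \<ge> 1" if "\<beta> \<in> ?B" for \<beta>
  proof -
    have \<beta>: "\<beta> \<in> R" "\<beta> \<bullet> h > 0" "\<beta> \<bullet> ?r h < 0"
      using that by (auto simp: inversions_def Rp_iff)
    have "?r \<beta> \<bullet> h = \<beta> \<bullet> h - (coroot \<alpha> \<bullet> \<beta>) * (\<alpha> \<bullet> h)"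
      by (simp add: root_reflection_def inner_diff)
    then have "(coroot \<alpha> \<bullet> \<beta>) * (\<alpha> \<bullet> h) > 0"
      using \<beta> by (simp add: root_reflection_inner)
    then have "coroot \<alpha> \<bullet> \<beta> > 0" using assms by (simp add: Rp_iff zero_less_mult_iff)
    moreover obtain m where "coroot \<alpha> \<bullet> \<beta> = of_int m"
      using integral[OF \<alpha>R \<beta>(1)] by (auto elim: Ints_cases)
    ultimately show ?thesis by simp
  qed
  then have "(\<Sum>\<beta>\<in>?B - {\<alpha>}. coroot \<alpha> \<bullet> \<beta>) \<ge> (\<Sum>\<beta>\<in>?B - {\<alpha>}. 1)" by (intro sum_mono) auto
  moreover have "(\<Sum>\<beta>\<in>?B - {\<alpha>}. 1::real) = real (card ?B) - 1"
    using \<alpha>B fB by (simp add: of_nat_diff Suc_leI card_gt_0_iff)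
      (metis One_nat_def Suc_leI card_gt_0_iff empty_iff of_nat_1 of_nat_diff)
  moreover have "(\<Sum>\<beta>\<in>?B. coroot \<alpha> \<bullet> \<beta>) = 2 + (\<Sum>\<beta>\<in>?B - {\<alpha>}. coroot \<alpha> \<bullet> \<beta>)"
    using sum.remove[OF fB \<alpha>B, of "\<lambda>\<beta>. coroot \<alpha> \<bullet> \<beta>"] coroot_self[OF anz] by simp
  moreover have "coroot \<alpha> \<bullet> \<rho>2 = (\<Sum>\<beta>\<in>?A. coroot \<alpha> \<bullet> \<beta>) + (\<Sum>\<beta>\<in>?B. coroot \<alpha> \<bullet> \<beta>)"
    unfolding two_rho_def inner_sum_right using sum.subset_diff[OF BRp finite_Rp] by blast
  ultimately show ?thesis
    using A length_eq_card[OF refl_WG[OF \<alpha>R]] by simp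
qed

text \<open>Strip the first letter of a reduced word, g = r_\<delta> y. Then y^-1 \<delta> is
  positive, so y \<omega> pairs nonnegatively with \<delta>, and applying r_\<delta> subtracts a
  nonnegative multiple of \<delta>.\<close>

lemma dominant_inner_le:
  assumes "dominant \<omega>" "dominant \<omega>'" "g \<in> WG"
  shows "\<omega>' \<bullet> g \<omega> \<le> \<omega>' \<bullet> \<omega>"
  using assms(3)
proof (induction "lng g" arbitrary: g rule: less_induct)
  case less
  then obtain ws where ws: "ws \<in> lists (root_reflection ` \<Delta>)" "length ws = lng g" "word_prod ws = g"
    using reduced_word unfolding weyl_group_simple weyl_length_def by blast
  show ?case
  proof (cases ws)
    case Nil
    then show ?thesis using ws by simp
  next
    case (Cons s vs)
    then obtain \<delta> where \<delta>: "\<delta> \<in> \<Delta>" "s = root_reflection \<delta>" using ws by auto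
    let ?y = "word_prod vs"
    have g: "g = root_reflection \<delta> \<circ> ?y" using Cons ws \<delta> by simp
    have y: "?y \<in> WG" using ws Cons by (auto simp: weyl_group_simple generated_by_involutions_def)
    have "lng ?y \<le> length vs" using word_length_le[of vs] ws Cons by (simp add: weyl_length_def)
    then have less_y: "lng ?y < lng g" using ws Cons by simp
    then have "\<delta> \<bullet> ?y h > 0"
      using length_less_iff[OF y Delta_Rp[OF \<delta>(1)]] g by simp
    then have "inv ?y \<delta> \<in> Rp"
      using WG_R[OF WG_inv[OF y]] \<delta> Delta_R by (auto simp: Rp_iff WG_inner_inv[OF y])
    then have "\<delta> \<bullet> ?y \<omega> \<ge> 0"
      using Rp_dominant assms(1) by (simp add: WG_inner_inv[OF y])
    then have "coroot \<delta> \<bullet> ?y \<omega> \<ge> 0"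
      by (simp add: coroot_inner)
    moreover have "\<omega>' \<bullet> \<delta> \<ge> 0" using assms(2) \<delta> by (simp add: dominant_def inner_commute)
    ultimately have "\<omega>' \<bullet> g \<omega> \<le> \<omega>' \<bullet> ?y \<omega>"
      by (simp add: g root_reflection_def inner_diff)
    then show ?thesis using less(1)[OF less_y y] by simp
  qed
qed

end

section \<open>The highest root\<close>

context root_base
begin

lemma integral_ex: "\<alpha> \<in> R \<Longrightarrow> \<beta> \<in> R \<Longrightarrow> \<exists>m. coroot \<alpha> \<bullet> \<beta> = of_int m"
  using integral[of \<alpha> \<beta>] by (auto elim: Ints_cases)

text \<open>The integers pairing each root with the coroot of the other are positive. Were both at
  least 2, the norm of \<alpha> - \<beta> would vanish; so one of them is 1, and the corresponding
  reflection yields \<alpha> - \<beta> up to sign.\<close>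

lemma root_diff:
  assumes "\<alpha> \<in> R" "\<beta> \<in> R" "\<alpha> \<bullet> \<beta> > 0" "\<alpha> \<noteq> \<beta>"
  shows "\<alpha> - \<beta> \<in> R"
proof -
  have nz: "\<alpha> \<noteq> 0" "\<beta> \<noteq> 0" using assms root_nz by auto
  obtain a where a: "coroot \<alpha> \<bullet> \<beta> = of_int a" using integral_ex assms by blast
  obtain b where b: "coroot \<beta> \<bullet> \<alpha> = of_int b" using integral_ex assms by blast
  have ab: "a > 0" "b > 0"
    using coroot_pos_iff[OF nz(1), of \<beta>] coroot_pos_iff[OF nz(2), of \<alpha>] assms(3) a b
    by (auto simp: inner_commute)
  have "a = 1 \<or> b = 1"
  proof (rule ccontr)
    assume "\<not> ?thesis"
    then have "2 \<le> a" "2 \<le> b" using ab by auto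
    then have "2 * (\<alpha> \<bullet> \<alpha>) \<le> coroot \<alpha> \<bullet> \<beta> * (\<alpha> \<bullet> \<alpha>)" "2 * (\<beta> \<bullet> \<beta>) \<le> coroot \<beta> \<bullet> \<alpha> * (\<beta> \<bullet> \<beta>)"
      unfolding a b by (intro mult_right_mono; simp)+
    moreover have "coroot \<alpha> \<bullet> \<beta> * (\<alpha> \<bullet> \<alpha>) = 2 * (\<alpha> \<bullet> \<beta>)"
      "coroot \<beta> \<bullet> \<alpha> * (\<beta> \<bullet> \<beta>) = 2 * (\<alpha> \<bullet> \<beta>)"
      using nz by (simp_all add: coroot_inner inner_commute[of \<beta> \<alpha>])
    ultimately have le: "\<alpha> \<bullet> \<alpha> \<le> \<alpha> \<bullet> \<beta>" "\<beta> \<bullet> \<beta> \<le> \<alpha> \<bullet> \<beta>"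
      by linarith+
    have "(\<alpha> - \<beta>) \<bullet> (\<alpha> - \<beta>) \<le> 0" using le by (simp add: inner_diff inner_commute)
    then show False using assms(4) by (metis eq_iff_diff_eq_0 inner_gt_zero_iff not_less)
  qed
  then show ?thesis
  proof
    assume "b = 1"
    then show ?thesis using refl_in[OF assms(2,1)] b by (simp add: root_reflection_def)
  next
    assume "a = 1"
    then show ?thesis
      using neg_in[OF refl_in[OF assms(1,2)]] a by (simp add: root_reflection_def)
  qed
qed

lemma nonneg_add: "x \<in> nonneg_combinations \<Delta> \<Longrightarrow> y \<in> nonneg_combinations \<Delta> \<Longrightarrow> x + y \<in> nonneg_combinations \<Delta>"
  by (simp add: nonneg_iff inner_add)

lemma nonneg_h: "x \<in> nonneg_combinations \<Delta> \<Longrightarrow> x \<bullet> h \<ge> 0"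
  using nonneg_Nat_h[of x] by (auto elim: Nats_cases)

lemma simple_nonneg: "\<delta> \<in> \<Delta> \<Longrightarrow> \<delta> \<in> nonneg_combinations \<Delta>"
  using Delta_Rp by (auto simp: positive_roots_def)

lemma zero_nonneg: "0 \<in> nonneg_combinations \<Delta>"
  by (simp add: nonneg_iff)

definition maximal_root :: "'a \<Rightarrow> bool" where
  "maximal_root \<alpha> \<longleftrightarrow> \<alpha> \<in> R \<and> (\<forall>\<beta>\<in>R. \<beta> - \<alpha> \<in> nonneg_combinations \<Delta> \<longrightarrow> \<beta> = \<alpha>)"

text \<open>If \<alpha> paired negatively with a simple \<delta>, then \<alpha> + \<delta> would be
  a larger root by \<open>root_diff\<close>. When \<alpha> = - \<delta> that sum is 0, and \<delta>
  is the larger root instead.\<close>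

lemma maximal_dominant:
  assumes "maximal_root \<alpha>"
  shows "dominant \<alpha>"
  unfolding dominant_def
proof (intro ballI leI notI)
  fix \<delta> assume \<delta>: "\<delta> \<in> \<Delta>" "\<delta> \<bullet> \<alpha> < 0"
  have \<delta>R: "\<delta> \<in> R" "\<delta> \<noteq> 0" using \<delta> Delta_R root_nz by auto
  show False
  proof (cases "\<alpha> = - \<delta>")
    case True
    have "\<delta> - \<alpha> \<in> nonneg_combinations \<Delta>"
      using nonneg_add[OF simple_nonneg simple_nonneg] \<delta> True by simp
    then have "\<delta> = - \<delta>" using assms \<delta>R(1) True by (simp add: maximal_root_def)
    then show False using \<delta>R by (simp add: eq_neg_iff_add_eq_0 flip: scaleR_2)
  next
    case False
    then have "\<alpha> - (- \<delta>) \<in> R" 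
      using root_diff[of \<alpha> "- \<delta>"] assms \<delta> \<delta>R neg_in by (simp add: inner_commute maximal_root_def)
    then show False
      using assms simple_nonneg[OF \<delta>(1)] \<delta>R by (auto simp: maximal_root_def dest!: bspec)
  qed
qed

end

locale irreducible_base = root_base +
  assumes irr: "irreducible_root_system R"
begin

lemma R_nonempty: "R \<noteq> {}"
proof
  assume "R = {}"
  then have "(UNIV :: 'a set) = {0}" using span_R by simp
  moreover obtain b :: 'a where "b \<in> Basis" using nonempty_Basis by blast
  ultimately show False using nonzero_Basis[of b] by auto
qed

text \<open>The roots orthogonal to a whole Weyl orbit of roots split off.\<close>

lemma orbit_not_orthogonal:
  assumes "\<alpha> \<in> R" "\<theta> \<in> R"
  shows "\<exists>g\<in>WG. \<alpha> \<bullet> g \<theta> \<noteq> 0"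
proof -
  define B where "B = {\<beta> \<in> R. \<forall>g\<in>WG. \<beta> \<bullet> g \<theta> = 0}"
  have orth: "a \<bullet> b = 0" if a: "a \<in> R - B" and b: "b \<in> B" for a b
  proof -
    obtain g where g: "g \<in> WG" "a \<bullet> g \<theta> \<noteq> 0" using a by (auto simp: B_def)
    have "root_reflection a \<circ> g \<in> WG" using a g refl_WG WG_comp by blast
    then have "b \<bullet> root_reflection a (g \<theta>) = 0" using b by (auto simp: B_def)
    moreover have "b \<bullet> g \<theta> = 0" using b g by (auto simp: B_def)
    ultimately have "(coroot a \<bullet> g \<theta>) * (b \<bullet> a) = 0" by (simp add: root_reflection_def inner_diff)
    moreover have "coroot a \<bullet> g \<theta> \<noteq> 0" using g a root_nz by (simp add: coroot_zero_iff)
    ultimately show ?thesis by (simp add: inner_commute)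
  qed
  have "\<forall>A B. A \<union> B = R \<and> A \<inter> B = {} \<and> (\<forall>\<alpha>\<in>A. \<forall>\<beta>\<in>B. \<alpha> \<bullet> \<beta> = 0) \<longrightarrow> A = {} \<or> B = {}"
    using irr unfolding irreducible_root_system_def by (rule conjunct2)
  moreover have "(R - B) \<union> B = R" "(R - B) \<inter> B = {}" by (auto simp: B_def)
  ultimately have "R - B = {} \<or> B = {}"
    using orth by (elim allE[of _ "R - B"] allE[of _ B]) auto
  moreover have "\<theta> \<notin> B" using root_nz[OF assms(2)] WG_id by (force simp: B_def intro!: bexI[of _ id])
  ultimately have "B = {}" using assms(2) by blast
  then show ?thesis using assms(1) by (auto simp: B_def)
qed

lemma maximal_above:
  assumes "\<alpha> \<in> R"
  obtains \<beta> where "maximal_root \<beta>" "\<beta> - \<alpha> \<in> nonneg_combinations \<Delta>"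
proof -
  let ?S = "{\<beta> \<in> R. \<beta> - \<alpha> \<in> nonneg_combinations \<Delta>}"
  have "finite ?S" "?S \<noteq> {}" using finite_R assms zero_nonneg by auto
  then have "Max ((\<lambda>\<gamma>. \<gamma> \<bullet> h) ` ?S) \<in> (\<lambda>\<gamma>. \<gamma> \<bullet> h) ` ?S" by (intro Max_in) auto
  then obtain \<beta> where \<beta>0: "\<beta> \<in> ?S" "\<beta> \<bullet> h = Max ((\<lambda>\<gamma>. \<gamma> \<bullet> h) ` ?S)" by fastforce
  then have \<beta>: "\<beta> \<in> ?S" "\<forall>\<gamma>\<in>?S. \<gamma> \<bullet> h \<le> \<beta> \<bullet> h" using \<open>finite ?S\<close> by auto
  have "\<gamma> = \<beta>" if \<gamma>: "\<gamma> \<in> R" "\<gamma> - \<beta> \<in> nonneg_combinations \<Delta>" for \<gamma>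
  proof -
    have "\<gamma> - \<alpha> \<in> nonneg_combinations \<Delta>" using nonneg_add[OF \<gamma>(2), of "\<beta> - \<alpha>"] \<beta>(1) by simp
    then have "(\<gamma> - \<beta>) \<bullet> h \<le> 0" using \<beta>(2) \<gamma>(1) by (simp add: inner_diff)
    then show ?thesis using nonneg_h_eq_0[OF \<gamma>(2)] by simp
  qed
  then show thesis using that[of \<beta>] \<beta>(1) by (simp add: maximal_root_def)
qed

text \<open>Distinct maximal roots have nonpositive inner product by \<open>root_diff\<close>. Both
  being dominant, \<alpha> then pairs nonpositively with the whole orbit of \<beta>; the orbit is
  closed under negation, so \<alpha> is orthogonal to it, against irreducibility.\<close>

lemma maximal_unique:
  assumes max: "maximal_root \<alpha>" "maximal_root \<beta>"
  shows "\<alpha> = \<beta>"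
proof (rule ccontr)
  have assms: "\<alpha> \<in> R" "\<beta> \<in> R" using max by (auto simp: maximal_root_def)
  assume ne: "\<alpha> \<noteq> \<beta>"
  have "\<not> \<alpha> \<bullet> \<beta> > 0"
  proof
    assume "\<alpha> \<bullet> \<beta> > 0"
    then have "\<alpha> - \<beta> \<in> R" using root_diff assms ne by blast
    then have "\<alpha> - \<beta> \<in> nonneg_combinations \<Delta> \<or> \<beta> - \<alpha> \<in> nonneg_combinations \<Delta>"
      using pos_or_neg[of "\<alpha> - \<beta>"] by simp
    then show False using max ne by (auto simp: maximal_root_def)
  qed
  moreover have "dominant \<alpha>" "dominant \<beta>" using maximal_dominant max by blast+
  ultimately have le: "\<alpha> \<bullet> g \<beta> \<le> 0" if "g \<in> WG" for g
    using dominant_inner_le[of \<beta> \<alpha> g] that by linarith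
  obtain g where g: "g \<in> WG" "\<alpha> \<bullet> g \<beta> \<noteq> 0" using orbit_not_orthogonal assms by blast
  have "(g \<circ> root_reflection \<beta>) \<beta> = - g \<beta>"
    using root_reflection_self[OF root_nz[OF assms(2)]] linear_neg[OF WG_linear[OF g(1)]] by simp
  moreover have "g \<circ> root_reflection \<beta> \<in> WG" using g refl_WG WG_comp assms by blast
  ultimately have "\<alpha> \<bullet> g \<beta> \<ge> 0" using le by (metis inner_minus_right neg_le_0_iff_le)
  then show False using le[OF g(1)] g by simp
qed

abbreviation "\<theta> \<equiv> highest_root R \<Delta>"

lemma highest_root_props: "\<theta> \<in> R \<and> (\<forall>\<alpha>\<in>R. \<theta> - \<alpha> \<in> nonneg_combinations \<Delta>)"
  unfolding highest_root_def
proof (rule theI')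
  obtain \<alpha>0 where "\<alpha>0 \<in> R" using R_nonempty by blast
  then obtain \<beta> where \<beta>: "maximal_root \<beta>" using maximal_above by blast
  have above: "\<beta> - \<alpha> \<in> nonneg_combinations \<Delta>" if "\<alpha> \<in> R" for \<alpha>
    using maximal_above[OF that] maximal_unique[OF \<beta>] by metis
  show "\<exists>!\<theta>. \<theta> \<in> R \<and> (\<forall>\<alpha>\<in>R. \<theta> - \<alpha> \<in> nonneg_combinations \<Delta>)"
  proof (rule ex1I[of _ \<beta>])
    show "\<beta> \<in> R \<and> (\<forall>\<alpha>\<in>R. \<beta> - \<alpha> \<in> nonneg_combinations \<Delta>)"
      using \<beta> above by (simp add: maximal_root_def)
    fix \<theta>' assume "\<theta>' \<in> R \<and> (\<forall>\<alpha>\<in>R. \<theta>' - \<alpha> \<in> nonneg_combinations \<Delta>)"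
    then show "\<theta>' = \<beta>" using \<beta> by (simp add: maximal_root_def)
  qed
qed

lemma theta_R: "\<theta> \<in> R" and theta_above: "\<alpha> \<in> R \<Longrightarrow> \<theta> - \<alpha> \<in> nonneg_combinations \<Delta>"
  using highest_root_props by auto

lemma theta_nz: "\<theta> \<noteq> 0"
  using theta_R root_nz by blast

lemma height_le_theta: "\<alpha> \<in> R \<Longrightarrow> \<alpha> \<bullet> h \<le> \<theta> \<bullet> h"
  using nonneg_h[OF theta_above] by (simp add: inner_diff)

lemma theta_Rp: "\<theta> \<in> Rp"
  using height_le_theta[OF neg_in[OF theta_R]] h_nonzero[OF theta_R] theta_R by (simp add: Rp_iff)

lemma height_abs_le: "\<alpha> \<in> R \<Longrightarrow> \<bar>\<alpha> \<bullet> h\<bar> \<le> \<theta> \<bullet> h"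
  using height_le_theta[of \<alpha>] height_le_theta[of "- \<alpha>"] neg_in by (simp add: abs_if)

lemma theta_coweight: "\<delta> \<in> \<Delta> \<Longrightarrow> \<theta> \<bullet> coweight \<delta> > 0"
proof -
  assume \<delta>: "\<delta> \<in> \<Delta>"
  then have "(\<theta> - \<delta>) \<bullet> coweight \<delta> \<ge> 0"
    using theta_above[of \<delta>] Delta_R nonneg_iff[of "\<theta> - \<delta>"] by (auto elim!: Nats_cases dest!: bspec)
  then show ?thesis using coweight[OF \<delta> \<delta>] by (simp add: inner_diff)
qed

lemma theta_dominant: "dominant \<theta>"
  using maximal_dominant theta_R nonneg_h_eq_0 height_le_theta
  by (fastforce simp: maximal_root_def inner_diff)

text \<open>For a pairing m \<ge> 2, the root - r_\<theta> \<beta> = m \<theta> - \<beta> has height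
  at most that of \<theta> only if \<beta> is at least as high as \<theta>, which forces \<beta> =
  \<theta>.\<close>

lemma theta_pairing_le:
  assumes "\<beta> \<in> R" "\<beta> \<noteq> \<theta>"
  shows "coroot \<theta> \<bullet> \<beta> \<le> 1"
proof (rule ccontr)
  assume neg: "\<not> ?thesis"
  obtain m where m: "coroot \<theta> \<bullet> \<beta> = of_int m" using integral_ex theta_R assms by blast
  then have m2: "real_of_int m \<ge> 2" using neg by simp
  have "- root_reflection \<theta> \<beta> \<in> R" using neg_in refl_in theta_R assms by blast
  then have "0 \<le> (\<theta> + root_reflection \<theta> \<beta>) \<bullet> h" using nonneg_h[OF theta_above] by fastforce
  then have "0 \<le> \<beta> \<bullet> h - (m - 1) * (\<theta> \<bullet> h)"
    by (simp add: root_reflection_def m inner_add inner_diff algebra_simps)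
  moreover have "(real_of_int m - 1) * (\<theta> \<bullet> h) \<ge> 1 * (\<theta> \<bullet> h)"
    using m2 theta_Rp by (intro mult_right_mono) (auto simp: Rp_iff)
  ultimately have "(\<theta> - \<beta>) \<bullet> h \<le> 0" by (simp add: inner_diff)
  then show False using nonneg_h_eq_0[OF theta_above[OF assms(1)]] assms(2) by simp
qed

lemma theta_pairing:
  assumes "\<beta> \<in> R" "\<beta> \<noteq> \<theta>" "\<beta> \<noteq> - \<theta>"
  shows "coroot \<theta> \<bullet> \<beta> \<in> {-1, 0, 1}"
proof -
  obtain m where m: "coroot \<theta> \<bullet> \<beta> = of_int m" using integral_ex theta_R assms by blast
  have "coroot \<theta> \<bullet> \<beta> \<le> 1" "coroot \<theta> \<bullet> \<beta> \<ge> - 1"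
    using theta_pairing_le[OF assms(1,2)] theta_pairing_le[OF neg_in[OF assms(1)]] assms(3)
    by (auto simp: minus_equation_iff[of \<beta>])
  then have "m \<in> {-1, 0, 1}" unfolding m by auto
  then show ?thesis using m by auto
qed

text \<open>A point of the open fundamental alcove: roots take values of modulus at most 1/2 there,
  so the sign of \<beta> + n at \<open>p0\<close> is that of n, and for n = 0 that of the height of
  \<beta>.\<close>

definition p0 :: 'a where "p0 = (1 / (2 * (\<theta> \<bullet> h))) *\<^sub>R h"

lemma theta_h_pos: "\<theta> \<bullet> h > 0"
  using theta_Rp by (simp add: Rp_iff)

lemma inner_p0_pos_iff: "x \<bullet> g p0 > 0 \<longleftrightarrow> x \<bullet> g h > 0" if "linear g"
  using theta_h_pos by (simp add: p0_def linear_scale[OF that] zero_less_mult_iff zero_less_divide_iff)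

lemma inner_p0_less_1:
  assumes "\<alpha> \<in> R"
  shows "\<bar>\<alpha> \<bullet> p0\<bar> < 1"
proof -
  have "\<bar>\<alpha> \<bullet> p0\<bar> = \<bar>\<alpha> \<bullet> h\<bar> / (2 * (\<theta> \<bullet> h))"
    using theta_h_pos by (simp add: p0_def abs_mult)
  also have "\<dots> \<le> (\<theta> \<bullet> h) / (2 * (\<theta> \<bullet> h))"
    using height_abs_le[OF assms] theta_h_pos by (intro divide_right_mono) auto
  also have "\<dots> < 1" using theta_h_pos by simp
  finally show ?thesis .
qed

text \<open>\<open>k \<beta>\<close> is the least level at which the affine root with finite part \<open>\<beta>\<close> is positive, and
  \<open>\<sigma> \<beta>\<close> the corresponding reflection.\<close>

definition k :: "'a \<Rightarrow> real" where "k \<beta> = (if \<beta> \<bullet> h > 0 then 0 else 1)"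

section \<open>Affine roots and their reflections\<close>

definition afn :: "'a \<Rightarrow> real \<Rightarrow> 'a \<Rightarrow> real" where "afn \<beta> n x = \<beta> \<bullet> x + n"

definition arf :: "'a \<Rightarrow> real \<Rightarrow> 'a \<Rightarrow> 'a" where "arf \<beta> n x = x - afn \<beta> n x *\<^sub>R coroot \<beta>"

abbreviation \<sigma> :: "'a \<Rightarrow> 'a \<Rightarrow> 'a" where "\<sigma> \<beta> \<equiv> arf \<beta> (k \<beta>)"

text \<open>Only the finite parts of the affine simple roots. Their levels are recovered by
  \<open>k\<close>, 0 on \<Delta> and 1 at - \<theta>, so that all nodes are treated
  uniformly.\<close>

definition affine_base :: "'a set" where "affine_base = insert (- \<theta>) \<Delta>"

definition affine_roots :: "(('a \<Rightarrow> real) \<times> ('a \<Rightarrow> 'a)) set" where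
  "affine_roots = {(afn \<beta> (of_int n), arf \<beta> (of_int n)) |\<beta> n. \<beta> \<in> R}"

lemma k_cases: "k \<beta> = 0 \<or> k \<beta> = 1"
  by (simp add: k_def)

lemma k_int: "\<exists>n. k \<beta> = of_int n"
  using k_cases by (metis of_int_0 of_int_1)

lemma k_minus: "\<beta> \<in> R \<Longrightarrow> k (- \<beta>) = 1 - k \<beta>"
  using h_nonzero[of \<beta>] by (auto simp: k_def)

lemma k_simple: "\<delta> \<in> \<Delta> \<Longrightarrow> k \<delta> = 0" and k_theta: "k (- \<theta>) = 1"
  using theta_h_pos by (auto simp: k_def simple_h)

lemma affine_base_R: "i \<in> affine_base \<Longrightarrow> i \<in> R"
  using Delta_R neg_in theta_R by (auto simp: affine_base_def)

lemma afn_pos_iff: "\<beta> \<in> R \<Longrightarrow> afn \<beta> (of_int n) p0 > 0 \<longleftrightarrow> of_int n \<ge> k \<beta>"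
proof -
  assume \<beta>: "\<beta> \<in> R"
  have "\<bar>\<beta> \<bullet> p0\<bar> < 1" "\<beta> \<bullet> p0 \<noteq> 0" "\<beta> \<bullet> p0 > 0 \<longleftrightarrow> \<beta> \<bullet> h > 0"
    using inner_p0_less_1[OF \<beta>] inner_p0_pos_iff[of "\<lambda>x. x" \<beta>] h_nonzero[OF \<beta>] theta_h_pos
    by (auto simp: linear_iff p0_def)
  then show ?thesis by (cases "n \<le> -1"; cases "n = 0") (auto simp: afn_def k_def)
qed

lemma afn_nonzero: "\<beta> \<in> R \<Longrightarrow> afn \<beta> (of_int n) p0 \<noteq> 0"
proof -
  assume \<beta>: "\<beta> \<in> R"
  have "\<bar>\<beta> \<bullet> p0\<bar> < 1" "\<beta> \<bullet> p0 \<noteq> 0"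
    using inner_p0_less_1[OF \<beta>] h_nonzero[OF \<beta>] theta_h_pos by (auto simp: p0_def)
  then show ?thesis by (cases "n \<le> -1"; cases "n = 0") (auto simp: afn_def)
qed

lemma afn_arf: "\<beta> \<noteq> 0 \<Longrightarrow> afn \<beta> n (arf \<beta> n x) = - afn \<beta> n x"
  using coroot_self[of \<beta>] by (simp add: arf_def afn_def inner_diff inner_commute algebra_simps)

lemma arf_twice: "\<beta> \<noteq> 0 \<Longrightarrow> arf \<beta> n (arf \<beta> n x) = x"
  by (subst arf_def) (simp add: afn_arf, simp add: arf_def)

lemma arf_comp: "\<beta> \<noteq> 0 \<Longrightarrow> arf \<beta> n \<circ> arf \<beta> n = id"
  by (auto simp: arf_twice)

lemma afn_minus: "afn (- \<beta>) (- n) x = - afn \<beta> n x"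
  and arf_minus: "arf (- \<beta>) (- n) = arf \<beta> n"
  by (simp_all add: afn_def arf_def coroot_minus fun_eq_iff algebra_simps)

lemma arf_reflection: "arf \<beta> n x = root_reflection \<beta> x - n *\<^sub>R coroot \<beta>"
  by (simp add: arf_def afn_def root_reflection_coroot scaleR_add_left)

lemma afn_comp:
  "afn \<beta> n (arf i m x) = afn (root_reflection i \<beta>) (n - m * (\<beta> \<bullet> coroot i)) x"
  by (simp add: afn_def arf_def inner_diff root_reflection_def inner_commute algebra_simps)

lemma arf_conj:
  assumes "i \<noteq> 0"
  shows "arf i m (arf \<beta> n (arf i m x)) = arf (root_reflection i \<beta>) (n - m * (\<beta> \<bullet> coroot i)) x"
proof -
  have diff: "arf i m (y - c *\<^sub>R z) = arf i m y - c *\<^sub>R root_reflection i z" for y c z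
    by (simp add: arf_reflection linear_diff[OF linear_root_reflection] linear_scale[OF linear_root_reflection])
  have "arf i m (arf \<beta> n (arf i m x)) = x - afn \<beta> n (arf i m x) *\<^sub>R root_reflection i (coroot \<beta>)"
    by (subst (2) arf_def) (simp add: diff arf_twice[OF assms])
  then show ?thesis
    by (simp add: afn_comp arf_def[of "root_reflection i \<beta>"] coroot_orthogonal[OF orthogonal_root_reflection])
qed

text \<open>An affine simple reflection permutes the positive affine roots other than its own, so it
  sends the lowest positive one over \<beta> to the lowest one over the reflected \<beta>. At the
  node - \<theta> the pairing is -1, 0 or 1, and a nonzero value means that reflecting changes the
  sign of \<beta>.\<close>

lemma k_reflection:
  assumes "i \<in> affine_base" "\<beta> \<in> R" "\<beta> \<noteq> i" "\<beta> \<noteq> - i"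
  shows "k (root_reflection i \<beta>) = k \<beta> - k i * (\<beta> \<bullet> coroot i)"
proof (cases "i \<in> \<Delta>")
  case True
  have "root_reflection i \<beta> \<bullet> h > 0 \<longleftrightarrow> \<beta> \<bullet> h > 0"
  proof (cases "\<beta> \<in> Rp")
    case T: True
    then show ?thesis using simple_refl_pos[OF True T assms(3)] by (simp add: Rp_iff)
  next
    case False
    then have m: "- \<beta> \<in> Rp" using Rp_or assms by blast
    then have "root_reflection i (- \<beta>) \<in> Rp"
      using simple_refl_pos[OF True m] assms(4) by (metis minus_minus)
    then show ?thesis using m by (simp add: Rp_iff linear_neg[OF linear_root_reflection])
  qed
  then show ?thesis using k_simple[OF True] by (simp add: k_def)
next
  case False
  then have i: "i = - \<theta>" using assms by (auto simp: affine_base_def)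
  let ?m = "coroot \<theta> \<bullet> \<beta>"
  have m: "?m \<in> {-1, 0, 1}" using theta_pairing assms i by auto
  have r: "root_reflection i \<beta> = \<beta> - ?m *\<^sub>R \<theta>"
    by (simp add: i root_reflection_minus root_reflection_def)
  have rhs: "k \<beta> - k i * (\<beta> \<bullet> coroot i) = k \<beta> + ?m"
    using k_theta by (simp add: i coroot_minus inner_commute)
  have pos: "\<beta> \<in> Rp \<Longrightarrow> ?m \<ge> 0" "- \<beta> \<in> Rp \<Longrightarrow> ?m \<le> 0"
    using Rp_dominant[OF _ theta_dominant, of \<beta>] Rp_dominant[OF _ theta_dominant, of "- \<beta>"]
    by (simp_all add: coroot_inner[of \<theta>] inner_commute[of \<theta> \<beta>] divide_nonpos_nonneg)
  have ht: "\<beta> \<bullet> h < \<theta> \<bullet> h" "- (\<beta> \<bullet> h) < \<theta> \<bullet> h"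
    using nonneg_h_eq_0[OF theta_above[OF assms(2)]] nonneg_h_eq_0[OF theta_above[OF neg_in[OF assms(2)]]]
      assms i by (auto simp: inner_diff inner_add not_le[symmetric] eq_neg_iff_add_eq_0 add.commute)
  consider "?m = 0" | "?m = 1" | "?m = -1" using m by auto
  then show ?thesis
  proof cases
    case 1
    then show ?thesis using r rhs by simp
  next
    case 2
    then have "\<beta> \<bullet> h > 0" using pos Rp_or[OF assms(2)] by (auto simp: Rp_iff)
    then show ?thesis using r rhs 2 ht by (simp add: k_def inner_diff)
  next
    case 3
    then have "\<beta> \<bullet> h < 0" using pos Rp_or[OF assms(2)] by (auto simp: Rp_iff)
    then show ?thesis using r rhs 3 ht by (simp add: k_def inner_add)
  qed
qed

end

section \<open>The affine Weyl group\<close>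

context root_base
begin

abbreviation "Q \<equiv> coroot_lattice R"

lemma Q_I: "(\<Sum>\<alpha>\<in>R. real_of_int (c \<alpha>) *\<^sub>R coroot \<alpha>) \<in> Q"
  unfolding coroot_lattice_def by blast

lemma Q_add: "x \<in> Q \<Longrightarrow> y \<in> Q \<Longrightarrow> x + y \<in> Q"
proof -
  assume "x \<in> Q" "y \<in> Q"
  then obtain c d where "x = (\<Sum>\<alpha>\<in>R. real_of_int (c \<alpha>) *\<^sub>R coroot \<alpha>)"
    "y = (\<Sum>\<alpha>\<in>R. real_of_int (d \<alpha>) *\<^sub>R coroot \<alpha>)"
    by (auto simp: coroot_lattice_def)
  then have "x + y = (\<Sum>\<alpha>\<in>R. real_of_int (c \<alpha> + d \<alpha>) *\<^sub>R coroot \<alpha>)"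
    by (simp add: sum.distrib scaleR_add_left)
  then show ?thesis using Q_I[of "\<lambda>\<alpha>. c \<alpha> + d \<alpha>"] by simp
qed

lemma Q_scale: "x \<in> Q \<Longrightarrow> of_int n *\<^sub>R x \<in> Q"
proof -
  assume "x \<in> Q"
  then obtain c where "x = (\<Sum>\<alpha>\<in>R. real_of_int (c \<alpha>) *\<^sub>R coroot \<alpha>)"
    by (auto simp: coroot_lattice_def)
  then have "of_int n *\<^sub>R x = (\<Sum>\<alpha>\<in>R. real_of_int (n * c \<alpha>) *\<^sub>R coroot \<alpha>)"
    by (simp add: scaleR_sum_right)
  then show ?thesis using Q_I[of "\<lambda>\<alpha>. n * c \<alpha>"] by simp
qed

lemma Q_zero: "0 \<in> Q"
  using Q_I[of "\<lambda>_. 0"] by simp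

lemma Q_coroot: "\<alpha> \<in> R \<Longrightarrow> coroot \<alpha> \<in> Q"
proof -
  assume \<alpha>: "\<alpha> \<in> R"
  have "(\<Sum>\<beta>\<in>R. real_of_int (if \<beta> = \<alpha> then 1 else 0) *\<^sub>R coroot \<beta>) =
    (\<Sum>\<beta>\<in>R. if \<beta> = \<alpha> then coroot \<beta> else 0)"
    by (intro sum.cong) auto
  also have "\<dots> = coroot \<alpha>" using \<alpha> finite_R by simp
  finally show ?thesis using Q_I[of "\<lambda>\<beta>. if \<beta> = \<alpha> then 1 else 0"] by simp
qed

lemma Q_int:
  assumes "\<beta> \<in> R" "q \<in> Q"
  obtains n where "\<beta> \<bullet> q = of_int n"
proof -
  obtain c where c: "q = (\<Sum>\<alpha>\<in>R. real_of_int (c \<alpha>) *\<^sub>R coroot \<alpha>)"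
    using assms(2) by (auto simp: coroot_lattice_def)
  have "\<beta> \<bullet> q = (\<Sum>\<alpha>\<in>R. real_of_int (c \<alpha>) * (coroot \<alpha> \<bullet> \<beta>))"
    by (simp add: c inner_sum_right inner_commute)
  also have "\<dots> \<in> \<int>" using integral assms(1) by (intro Ints_sum Ints_mult) auto
  finally show thesis using that by (auto elim: Ints_cases)
qed

lemma Q_WG: "g \<in> WG \<Longrightarrow> q \<in> Q \<Longrightarrow> g q \<in> Q"
proof -
  assume g: "g \<in> WG" and "q \<in> Q"
  then obtain c where c: "q = (\<Sum>\<alpha>\<in>R. real_of_int (c \<alpha>) *\<^sub>R coroot \<alpha>)"
    by (auto simp: coroot_lattice_def)
  have "bij_betw g R R"
    using WG_R g WG_inv WG_inv1 WG_inv2 by (intro bij_betw_byWitness[of _ "inv g"]) auto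
  then have "(\<Sum>\<alpha>\<in>R. real_of_int (c (inv g \<alpha>)) *\<^sub>R coroot \<alpha>) =
      (\<Sum>\<alpha>\<in>R. real_of_int (c (inv g (g \<alpha>))) *\<^sub>R coroot (g \<alpha>))"
    by (rule sum.reindex_bij_betw[symmetric])
  also have "\<dots> = g q"
    using WG_inv2[OF g] coroot_orthogonal[OF WG_orth[OF g]]
    by (simp add: c linear_sum[OF WG_linear[OF g]] linear_scale[OF WG_linear[OF g]])
  finally show ?thesis using Q_I[of "\<lambda>\<alpha>. c (inv g \<alpha>)"] by simp
qed

abbreviation "AW \<equiv> affine_weyl_group R"

lemma AW_I: "g \<in> WG \<Longrightarrow> q \<in> Q \<Longrightarrow> g \<circ> translation q \<in> AW"
  unfolding affine_weyl_group_def by blast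

lemma affine_comp:
  assumes "g' \<in> WG"
  shows "(g \<circ> translation q) \<circ> (g' \<circ> translation q') = (g \<circ> g') \<circ> translation (inv g' q + q')"
proof
  fix x
  have "g' (x + (inv g' q + q')) = g' (x + q') + q"
    using WG_inv1[OF assms] linear_add[OF WG_linear[OF assms]] by (simp add: algebra_simps)
  then show "((g \<circ> translation q) \<circ> (g' \<circ> translation q')) x =
      ((g \<circ> g') \<circ> translation (inv g' q + q')) x"
    by (simp add: translation_def)
qed

lemma AW_comp: "z \<in> AW \<Longrightarrow> z' \<in> AW \<Longrightarrow> z \<circ> z' \<in> AW"
proof -
  assume "z \<in> AW" "z' \<in> AW"
  then obtain g q g' q' where gq: "g \<in> WG" "q \<in> Q" "g' \<in> WG" "q' \<in> Q"
    "z = g \<circ> translation q" "z' = g' \<circ> translation q'"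
    by (auto simp: affine_weyl_group_def)
  have "inv g' q + q' \<in> Q" using gq Q_add Q_WG WG_inv by blast
  then show ?thesis
    using AW_I[OF WG_comp[OF gq(1,3)]] affine_comp[OF gq(3)] gq(5,6) by metis
qed

end

context irreducible_base
begin

lemma arf_translation: "arf \<beta> n = root_reflection \<beta> \<circ> translation (n *\<^sub>R coroot \<beta>)" if "\<beta> \<in> R"
proof
  fix x
  have "root_reflection \<beta> (coroot \<beta>) = - coroot \<beta>"
    using coroot_orthogonal[OF orthogonal_root_reflection, of \<beta> \<beta>] root_reflection_self[OF root_nz[OF that]]
    by (simp add: coroot_minus)
  then show "arf \<beta> n x = (root_reflection \<beta> \<circ> translation (n *\<^sub>R coroot \<beta>)) x"
    by (simp add: arf_reflection translation_def linear_add[OF linear_root_reflection]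
        linear_scale[OF linear_root_reflection])
qed

lemma arf_AW: "\<beta> \<in> R \<Longrightarrow> arf \<beta> (of_int n) \<in> AW"
  using AW_I[OF refl_WG Q_scale[OF Q_coroot]] arf_translation by simp

lemma arf_zero: "arf \<beta> 0 = root_reflection \<beta>"
  by (auto simp: arf_reflection)

lemma sigma_theta: "\<sigma> (- \<theta>) = root_reflection \<theta> \<circ> translation (- coroot \<theta>)"
  using arf_translation[OF neg_in[OF theta_R], of 1]
  by (simp add: k_theta coroot_minus root_reflection_minus)

lemma affine_simple_reflections_eq: "affine_simple_reflections R \<Delta> = \<sigma> ` affine_base"
  unfolding affine_simple_reflections_def affine_base_def
  by (simp add: sigma_theta k_simple arf_zero cong: image_cong)

abbreviation "GS \<equiv> generated_by_involutions (\<sigma> ` affine_base)"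

lemma sigma_invol: "i \<in> affine_base \<Longrightarrow> \<sigma> i \<circ> \<sigma> i = id"
  using arf_comp root_nz affine_base_R by blast

lemma WG_GS: "WG \<subseteq> GS"
  unfolding weyl_group_simple
proof (rule generated_subset, clarify)
  fix \<delta> assume "\<delta> \<in> \<Delta>"
  then have "\<sigma> \<delta> = root_reflection \<delta>" "\<delta> \<in> affine_base"
    by (auto simp: k_simple arf_zero affine_base_def)
  then show "root_reflection \<delta> \<in> GS" by (metis generated_base imageI)
qed

lemma translation_add: "translation a \<circ> translation b = translation (a + b)"
  by (auto simp: translation_def)

text \<open>The vectors whose translation lies in \<open>GS\<close> form a W-stable group
  \<open>T\<close>. It contains the coroot of \<theta>, from the product of the reflections in
  \<theta> and at the affine node, and so its W-orbit. For a root \<alpha> outside that of \<theta>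
  up to sign, pick an orbit element not orthogonal to \<alpha>: its pairing with \<alpha> is 1 or
  -1, so subtracting its reflection in \<alpha> leaves the coroot of \<alpha> up to sign.\<close>

lemma GS_translation:
  assumes "q \<in> Q"
  shows "translation q \<in> GS"
proof -
  define T where "T = {q. translation q \<in> GS}"
  have add: "x + y \<in> T" if "x \<in> T" "y \<in> T" for x y
    using that generated_comp translation_add unfolding T_def by (metis mem_Collect_eq)
  have neg: "- x \<in> T" if "x \<in> T" for x
  proof -
    have "\<exists>y\<in>GS. translation x \<circ> y = id \<and> y \<circ> translation x = id"
    proof (rule generated_inverse)
      show "translation x \<in> GS" using that by (simp add: T_def)
      show "s \<circ> s = id" if "s \<in> \<sigma> ` affine_base" for s using that sigma_invol by blast
    qed
    then obtain y where y: "y \<in> GS" "translation x \<circ> y = id" by blast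
    have "y v = v - x" for v using pointfree_idE[OF y(2), of v] by (simp add: translation_def eq_diff_eq)
    then have "y = translation (- x)" by (auto simp: translation_def)
    then show ?thesis using y by (simp add: T_def)
  qed
  have zero: "0 \<in> T"
  proof -
    have "translation 0 = id" by (auto simp: translation_def)
    then show ?thesis using generated_id unfolding T_def by (metis mem_Collect_eq)
  qed
  have diff: "x - y \<in> T" if "x \<in> T" "y \<in> T" for x y
    using add[OF that(1) neg[OF that(2)]] by simp
  have act: "g x \<in> T" if "g \<in> WG" "x \<in> T" for g x
  proof -
    have "g \<circ> (translation x \<circ> inv g) \<in> GS"
      using generated_comp[OF subsetD[OF WG_GS that(1)]
          generated_comp[OF _ subsetD[OF WG_GS WG_inv[OF that(1)]]]] that(2)
      by (simp add: T_def)
    moreover have "g \<circ> (translation x \<circ> inv g) = translation (g x)"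
      using WG_inv1[OF that(1)] linear_add[OF WG_linear[OF that(1)]]
      by (auto simp: translation_def)
    ultimately show ?thesis by (simp add: T_def)
  qed
  have "\<sigma> (- \<theta>) \<in> GS" by (rule generated_base) (simp add: affine_base_def)
  then have "root_reflection \<theta> \<circ> \<sigma> (- \<theta>) \<in> GS"
    using generated_comp[OF subsetD[OF WG_GS refl_WG[OF theta_R]]] by simp
  moreover have "root_reflection \<theta> \<circ> \<sigma> (- \<theta>) = translation (- coroot \<theta>)"
    by (auto simp: sigma_theta)
  ultimately have \<theta>T: "coroot \<theta> \<in> T" using neg[of "- coroot \<theta>"] by (simp add: T_def)
  have orbit: "coroot (g \<theta>) \<in> T" if "g \<in> WG" for g
    using act[OF that \<theta>T] coroot_orthogonal[OF WG_orth[OF that]] by simp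
  have coroot_T: "coroot \<alpha> \<in> T" if \<alpha>: "\<alpha> \<in> R" for \<alpha>
  proof -
    obtain g where g: "g \<in> WG" "\<alpha> \<bullet> g \<theta> \<noteq> 0" using orbit_not_orthogonal[OF \<alpha> theta_R] by blast
    have eq: "inv g \<alpha> \<in> R" "g (inv g \<alpha>) = \<alpha>" using WG_R WG_inv WG_inv1 g \<alpha> by auto
    show ?thesis
    proof (cases "inv g \<alpha> = \<theta> \<or> inv g \<alpha> = - \<theta>")
      case True
      then have "\<alpha> = g \<theta> \<or> \<alpha> = - g \<theta>"
        using eq(2) linear_neg[OF WG_linear[OF g(1)], of \<theta>] by metis
      then show ?thesis using orbit[OF g(1)] neg by (auto simp: coroot_minus)
    next
      case False
      let ?m = "\<alpha> \<bullet> coroot (g \<theta>)"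
      have "?m = coroot \<theta> \<bullet> inv g \<alpha>"
        using WG_inner_inv[OF g(1), of \<alpha> "coroot \<theta>"] coroot_orthogonal[OF WG_orth[OF g(1)], of \<theta>]
        by (simp add: inner_commute)
      then have "?m \<in> {-1, 0, 1}" using theta_pairing[OF eq(1)] False by simp
      moreover have "?m \<noteq> 0"
        using g(2) theta_nz coroot_zero_iff[OF root_nz[OF WG_R[OF g(1) theta_R]], of \<alpha>]
        by (simp add: inner_commute)
      ultimately have m: "?m = 1 \<or> ?m = -1" by auto
      have "root_reflection \<alpha> \<circ> g \<in> WG" using refl_WG \<alpha> g WG_comp by blast
      from orbit[OF this] have "root_reflection \<alpha> (coroot (g \<theta>)) \<in> T"
        using coroot_orthogonal[OF orthogonal_root_reflection, of \<alpha> "g \<theta>"] by simp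
      then have "coroot (g \<theta>) - root_reflection \<alpha> (coroot (g \<theta>)) \<in> T"
        using diff orbit g by blast
      moreover have "coroot (g \<theta>) - root_reflection \<alpha> (coroot (g \<theta>)) = ?m *\<^sub>R coroot \<alpha>"
        by (simp add: root_reflection_coroot)
      ultimately show ?thesis using m neg by fastforce
    qed
  qed
  have scale: "of_int n *\<^sub>R x \<in> T" if "x \<in> T" for n x
  proof (induction n rule: int_induct[where k = 0])
    case base
    then show ?case using zero by simp
  next
    case (step1 i)
    then show ?case using add[OF _ that] by (simp add: scaleR_add_left)
  next
    case (step2 i)
    then show ?case using diff[OF _ that] by (simp add: scaleR_diff_left)
  qed
  obtain c where c: "q = (\<Sum>\<alpha>\<in>R. real_of_int (c \<alpha>) *\<^sub>R coroot \<alpha>)"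
    using assms by (auto simp: coroot_lattice_def)
  have "(\<Sum>\<alpha>\<in>B. real_of_int (c \<alpha>) *\<^sub>R coroot \<alpha>) \<in> T" if "finite B" "B \<subseteq> R" for B
    using that by (induction B rule: finite_induct) (auto simp: zero intro!: add scale coroot_T)
  then show ?thesis using c finite_R by (simp add: T_def)
qed

lemma AW_eq: "AW = GS"
proof
  show "AW \<subseteq> GS"
    unfolding affine_weyl_group_def
    by clarify (rule generated_comp[OF subsetD[OF WG_GS] GS_translation])
  show "GS \<subseteq> AW"
  proof
    fix z assume "z \<in> GS"
    then show "z \<in> AW"
    proof (induction rule: generated_induct)
      case id
      have "id \<circ> translation 0 = id" by (auto simp: translation_def)
      then show ?case using AW_I[OF WG_id Q_zero] by metis
    next
      case (step s y)
      then obtain i where "i \<in> affine_base" "s = \<sigma> i" by blast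
      then have "s \<in> AW" using arf_AW affine_base_R k_int[of i] by metis
      then show ?case using AW_comp step by blast
    qed
  qed
qed

sublocale aff: reflection_system "\<sigma> ` affine_base" affine_roots p0
proof
  fix s assume "s \<in> \<sigma> ` affine_base"
  then obtain i where i: "i \<in> affine_base" "s = \<sigma> i" by blast
  obtain n where n: "k i = of_int n" using k_int by blast
  have iR: "i \<in> R" using i affine_base_R by blast
  have "(afn i (k i), s) \<in> affine_roots" unfolding affine_roots_def n i using iR by blast
  moreover have "afn i (k i) p0 > 0" using afn_pos_iff[OF iR, of n] n by simp
  ultimately show "\<exists>a. (a, s) \<in> affine_roots \<and> a p0 > 0" by blast
next
  fix a t s
  assume "(a, t) \<in> affine_roots"
  then obtain \<beta> n where \<beta>: "\<beta> \<in> R" "a = afn \<beta> (of_int n)" "t = arf \<beta> (of_int n)"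
    by (auto simp: affine_roots_def)
  show "a (t x) = - a x" for x using \<beta> afn_arf root_nz by simp
  show "(\<lambda>x. - a x, t) \<in> affine_roots"
  proof -
    have "(afn (- \<beta>) (of_int (- n)), arf (- \<beta>) (of_int (- n))) \<in> affine_roots"
      unfolding affine_roots_def using neg_in[OF \<beta>(1)] by blast
    moreover have "afn (- \<beta>) (of_int (- n)) = (\<lambda>x. - a x)" using \<beta> by (auto simp: afn_minus)
    moreover have "arf (- \<beta>) (of_int (- n)) = t" using \<beta> by (simp add: arf_minus)
    ultimately show ?thesis by simp
  qed
  show "a p0 \<noteq> 0" using \<beta> afn_nonzero by simp
  show "t \<circ> t = id" using \<beta> arf_comp root_nz by simp
  show "t \<in> GS" using \<beta> arf_AW AW_eq by simp
  assume "s \<in> \<sigma> ` affine_base"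
  then obtain i where i: "i \<in> affine_base" "s = \<sigma> i" by blast
  have iR: "i \<in> R" "i \<noteq> 0" using i affine_base_R root_nz by auto
  obtain m where m: "k i = of_int m" using k_int by blast
  obtain c where c: "\<beta> \<bullet> coroot i = of_int c" using integral_ex[OF iR(1) \<beta>(1)] by (auto simp: inner_commute)
  let ?\<beta> = "root_reflection i \<beta>" and ?n = "n - m * c"
  have as: "a \<circ> s = afn ?\<beta> (of_int ?n)"
    using afn_comp[of \<beta> "of_int n" i "k i"] \<beta> i m c by (auto simp: fun_eq_iff)
  have sts: "s \<circ> t \<circ> s = arf ?\<beta> (of_int ?n)"
    using arf_conj[OF iR(2), of "k i" \<beta> "of_int n"] \<beta> i m c by (auto simp: fun_eq_iff)
  have \<beta>'R: "?\<beta> \<in> R" using refl_in iR \<beta> by blast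
  then show "(a \<circ> s, s \<circ> t \<circ> s) \<in> affine_roots" unfolding as sts affine_roots_def by blast
  assume pos: "a p0 > 0" and neg: "a (s p0) < 0"
  have kn: "of_int n \<ge> k \<beta>" using pos \<beta> afn_pos_iff by simp
  have "afn ?\<beta> (of_int ?n) p0 < 0" using neg as by (metis comp_apply)
  then have kn': "of_int ?n < k ?\<beta>" using afn_pos_iff[OF \<beta>'R, of ?n] by linarith
  \<comment> \<open>The level n is at least the lowest positive one over \<beta>, but after
    reflection it falls below the lowest one. For \<beta> = i this leaves only n = k i; \<beta> = -
    i is impossible; otherwise \<open>k_reflection\<close> moves level and bound by the same
    amount.\<close>
  consider "\<beta> = i" | "\<beta> = - i" | "\<beta> \<noteq> i" "\<beta> \<noteq> - i" by blast
  then show "t = s"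
  proof cases
    case 1
    then have "real_of_int c = 2" using c coroot_self[OF iR(2)] by (simp add: inner_commute)
    then have "of_int n - 2 * k i < 1 - k i"
      using kn' 1 m root_reflection_self[OF iR(2)] k_minus[OF iR(1)] by simp
    then have "of_int n < of_int m + (1::real)" "of_int n \<ge> (of_int m :: real)" using kn 1 m by auto
    then have "n = m" by linarith
    then show ?thesis using 1 \<beta> i m by simp
  next
    case 2
    then have "real_of_int c = - 2" using c coroot_self[OF iR(2)] by (simp add: inner_commute)
    then have "of_int n + 2 * k i < k i"
      using kn' 2 m root_reflection_self[OF iR(2)] linear_neg[OF linear_root_reflection, of i i] by simp
    moreover have "of_int n \<ge> 1 - k i" using kn 2 k_minus[OF iR(1)] by simp
    ultimately show ?thesis by linarith
  next
    case 3
    then have "k ?\<beta> = k \<beta> - of_int (m * c)" using k_reflection[OF i(1) \<beta>(1)] m c by simp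
    then show ?thesis using kn kn' by simp
  qed
qed

lemma affine_bruhat_iff: "affine_bruhat_le R \<Delta> x y \<longleftrightarrow> (x, y) \<in> aff.ascents\<^sup>*"
  using aff.bruhat_le_iff unfolding affine_bruhat_le_def AW_eq affine_simple_reflections_eq .

end

section \<open>Weighted paths in the quantum Bruhat graph\<close>

context root_base
begin

lemma sum_even:
  fixes F :: "'a \<Rightarrow> real"
  assumes "\<And>\<alpha>. \<alpha> \<in> R \<Longrightarrow> F (- \<alpha>) = F \<alpha>"
  shows "(\<Sum>\<alpha>\<in>R. F \<alpha>) = 2 * (\<Sum>\<alpha>\<in>Rp. F \<alpha>)"
proof -
  have R: "R = Rp \<union> uminus ` Rp"
  proof
    show "R \<subseteq> Rp \<union> uminus ` Rp" using Rp_or by (force intro: image_eqI[of _ uminus "- _"])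
    show "Rp \<union> uminus ` Rp \<subseteq> R" using Rp_R neg_in by auto
  qed
  have "Rp \<inter> uminus ` Rp = {}" using Rp_minus by fastforce
  then have "(\<Sum>\<alpha>\<in>R. F \<alpha>) = (\<Sum>\<alpha>\<in>Rp. F \<alpha>) + (\<Sum>\<alpha>\<in>uminus ` Rp. F \<alpha>)"
    by (subst R) (intro sum.union_disjoint finite_imageI finite_Rp)
  also have "(\<Sum>\<alpha>\<in>uminus ` Rp. F \<alpha>) = (\<Sum>\<alpha>\<in>Rp. F (- \<alpha>))"
    by (subst sum.reindex) (auto simp: inj_on_def)
  also have "\<dots> = (\<Sum>\<alpha>\<in>Rp. F \<alpha>)" using assms Rp_R by (intro sum.cong) auto
  finally show ?thesis by simp
qed

lemma WG_bij_R: "g \<in> WG \<Longrightarrow> bij_betw g R R"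
  using WG_R WG_inv WG_inv1 WG_inv2 by (intro bij_betw_byWitness[of _ "inv g"]) auto

text \<open>Inserting the sign of the height makes the summand even, so the sum can be doubled to
  all of R, where g acts by a permutation.\<close>

lemma sum_odd_WG:
  fixes f :: "'a \<Rightarrow> real"
  assumes "g \<in> WG" "\<And>\<alpha>. f (- \<alpha>) = - f \<alpha>"
  shows "(\<Sum>\<alpha>\<in>Rp. f (g \<alpha>)) = (\<Sum>\<beta>\<in>Rp. sgn (\<beta> \<bullet> g h) * f \<beta>)"
proof -
  have "2 * (\<Sum>\<alpha>\<in>Rp. f (g \<alpha>)) = 2 * (\<Sum>\<alpha>\<in>Rp. sgn (\<alpha> \<bullet> h) * f (g \<alpha>))"
    by (intro arg_cong2[where f = "(*)"] sum.cong refl) (simp add: Rp_iff)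
  also have "\<dots> = (\<Sum>\<alpha>\<in>R. sgn (\<alpha> \<bullet> h) * f (g \<alpha>))"
    by (subst sum_even) (simp_all add: assms(2) linear_neg[OF WG_linear[OF assms(1)]] sgn_minus)
  also have "\<dots> = (\<Sum>\<alpha>\<in>R. sgn (g \<alpha> \<bullet> g h) * f (g \<alpha>))"
    by (simp add: WG_inner[OF assms(1)])
  also have "\<dots> = (\<Sum>\<beta>\<in>R. sgn (\<beta> \<bullet> g h) * f \<beta>)"
    by (rule sum.reindex_bij_betw[OF WG_bij_R[OF assms(1)]])
  also have "\<dots> = 2 * (\<Sum>\<beta>\<in>Rp. sgn (\<beta> \<bullet> g h) * f \<beta>)"
    by (rule sum_even) (simp add: assms(2) sgn_minus)
  finally show ?thesis by simp
qed

lemma inv_refl_comp: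
  assumes "g \<in> WG" "\<beta> \<in> R"
  shows "inv (root_reflection \<beta> \<circ> g) x = inv g (root_reflection \<beta> x)"
proof -
  have r: "root_reflection \<beta> \<circ> g \<in> WG" using assms refl_WG WG_comp by blast
  have "(root_reflection \<beta> \<circ> g) (inv g (root_reflection \<beta> x)) = x"
    using WG_inv1[OF assms(1)] by simp
  then show ?thesis using WG_inv2[OF r] by metis
qed

lemma refl_comp_WG: "g \<in> WG \<Longrightarrow> \<beta> \<in> R \<Longrightarrow> root_reflection \<beta> \<circ> g \<in> WG"
  using refl_WG WG_comp by blast

lemma refl_refl_comp: "root_reflection \<beta> \<circ> (root_reflection \<beta> \<circ> g) = g"
  by (auto simp: fun_eq_iff)

lemma refl_inner_self: "\<beta> \<noteq> 0 \<Longrightarrow> \<beta> \<bullet> root_reflection \<beta> x = - (\<beta> \<bullet> x)"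
  using root_reflection_self[of \<beta>] by (simp add: root_reflection_inner[symmetric])

lemma ex_descent:
  assumes "g \<in> WG" "g \<noteq> id"
  shows "\<exists>\<delta>\<in>\<Delta>. \<delta> \<bullet> g h < 0"
proof -
  obtain ws where ws: "ws \<in> lists (root_reflection ` \<Delta>)" "length ws = lng g" "word_prod ws = g"
    using reduced_word assms(1) unfolding weyl_group_simple weyl_length_def by blast
  with assms(2) obtain s vs where Cons: "ws = s # vs" by (cases ws) auto
  then obtain \<delta> where \<delta>: "\<delta> \<in> \<Delta>" "s = root_reflection \<delta>" using ws by auto
  have "g = root_reflection \<delta> \<circ> word_prod vs" using ws Cons \<delta> by simp
  then have "root_reflection \<delta> \<circ> g = word_prod vs" using refl_refl_comp by simp
  moreover have "lng (word_prod vs) \<le> length vs"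
    using word_length_le[of vs] ws Cons by (simp add: weyl_length_def)
  ultimately have "lng (root_reflection \<delta> \<circ> g) < lng g" using ws Cons by simp
  then have "\<not> \<delta> \<bullet> g h > 0"
    using length_less_iff[OF assms(1) Delta_Rp[OF \<delta>(1)]] by linarith
  then show ?thesis using WG_nonzero[OF assms(1), of \<delta>] \<delta>(1) Delta_R by (intro bexI[of _ \<delta>]) auto
qed

end

context irreducible_base
begin

text \<open>
  The coefficients \<open>c\<^sub>i\<close> of the linear relation \<open>\<Sum>\<^sub>i c\<^sub>i i = 0\<close> between the elements of
  \<open>affine_base\<close> make \<open>c\<^sub>i (i \<bullet> w h)\<close> a circulation along the moves from \<open>w\<close> to \<open>r\<^sub>i w\<close>. It is positive,
  so no set of group elements can be left but not entered.
\<close>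

lemma closed_down_eq_WG:
  assumes C: "C \<subseteq> WG" "w0 \<in> C"
    and closed: "\<And>w i. w \<in> C \<Longrightarrow> i \<in> affine_base \<Longrightarrow> i \<bullet> w h > 0 \<Longrightarrow> root_reflection i \<circ> w \<in> C"
  shows "C = WG"
proof -
  have fC: "finite C" using C finite_WG finite_subset by blast
  define T where "T i = (\<Sum>w\<in>C. i \<bullet> w h)" for i
  define C1 where "C1 i = {w \<in> C. root_reflection i \<circ> w \<in> C}" for i
  have T: "T i = (\<Sum>w\<in>C - C1 i. i \<bullet> w h)" and nonpos: "w \<in> C - C1 i \<Longrightarrow> i \<bullet> w h < 0"
    if i: "i \<in> affine_base" for i w
  proof -
    have iR: "i \<in> R" using affine_base_R i by blast
    have C1: "C1 i \<subseteq> C" "finite (C1 i)" using fC by (auto simp: C1_def)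
    \<comment> \<open>On \<open>C1 i\<close> the terms of w and r_i w cancel. The remaining elements
      leave C under r_i, so by closedness their terms are negative.\<close>
    have "bij_betw (\<lambda>w. root_reflection i \<circ> w) (C1 i) (C1 i)"
      by (rule bij_betw_byWitness[of _ "\<lambda>w. root_reflection i \<circ> w"])
        (auto simp: C1_def refl_refl_comp simp del: comp_apply)
    then have "(\<Sum>w\<in>C1 i. i \<bullet> (root_reflection i \<circ> w) h) = (\<Sum>w\<in>C1 i. i \<bullet> w h)"
      by (rule sum.reindex_bij_betw)
    then have "(\<Sum>w\<in>C1 i. i \<bullet> w h) = 0"
      by (simp add: refl_inner_self[OF root_nz[OF iR]] sum_negf)
    then show "T i = (\<Sum>w\<in>C - C1 i. i \<bullet> w h)"
      unfolding T_def using sum.subset_diff[OF C1(1) fC, of "\<lambda>w. i \<bullet> w h"] by simp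
    show "i \<bullet> w h < 0" if w: "w \<in> C - C1 i"
    proof -
      have "\<not> i \<bullet> w h > 0" using w closed[OF _ i] by (auto simp: C1_def)
      moreover have "i \<bullet> w h \<noteq> 0" using w C(1) WG_nonzero iR by blast
      ultimately show ?thesis by linarith
    qed
  qed
  have T_le: "T i \<le> 0" if "i \<in> affine_base" for i
    unfolding T[OF that] using nonpos[OF that] by (intro sum_nonpos less_imp_le)
  have rel: "T (- \<theta>) + (\<Sum>\<delta>\<in>\<Delta>. (\<theta> \<bullet> coweight \<delta>) * T \<delta>) = 0"
  proof -
    have "(\<Sum>\<delta>\<in>\<Delta>. (\<theta> \<bullet> coweight \<delta>) * (\<delta> \<bullet> x)) = \<theta> \<bullet> x" for x
      by (subst (2) simple_expansion[of \<theta>, symmetric]) (simp add: inner_sum_left)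
    then have "(\<Sum>w\<in>C. \<Sum>\<delta>\<in>\<Delta>. (\<theta> \<bullet> coweight \<delta>) * (\<delta> \<bullet> w h)) = (\<Sum>w\<in>C. \<theta> \<bullet> w h)" by simp
    then have "(\<Sum>\<delta>\<in>\<Delta>. (\<theta> \<bullet> coweight \<delta>) * T \<delta>) = (\<Sum>w\<in>C. \<theta> \<bullet> w h)"
      unfolding T_def sum_distrib_left by (subst sum.swap)
    then show ?thesis by (simp add: T_def sum_negf)
  qed
  \<comment> \<open>All terms of the relation are nonpositive and add up to 0, so each vanishes. As
    the coefficients are positive, \<open>T\<close> is 0 at every simple root, and no simple
    reflection leads out of C.\<close>
  have terms: "(\<theta> \<bullet> coweight \<delta>) * T \<delta> \<le> 0" if "\<delta> \<in> \<Delta>" for \<delta>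
    using theta_coweight[OF that] T_le[of \<delta>] that by (simp add: affine_base_def mult_nonneg_nonpos)
  have "T (- \<theta>) \<le> 0" by (rule T_le) (simp add: affine_base_def)
  then have "(\<Sum>\<delta>\<in>\<Delta>. (\<theta> \<bullet> coweight \<delta>) * T \<delta>) \<ge> 0" using rel by linarith
  moreover have "(\<Sum>\<delta>\<in>\<Delta>. (\<theta> \<bullet> coweight \<delta>) * T \<delta>) \<le> 0" using terms by (intro sum_nonpos)
  ultimately have "(\<Sum>\<delta>\<in>\<Delta>. - ((\<theta> \<bullet> coweight \<delta>) * T \<delta>)) = 0" by (simp add: sum_negf)
  then have "\<forall>\<delta>\<in>\<Delta>. - ((\<theta> \<bullet> coweight \<delta>) * T \<delta>) = 0"
    using sum_nonneg_eq_0_iff[OF finite_Delta, of "\<lambda>\<delta>. - ((\<theta> \<bullet> coweight \<delta>) * T \<delta>)"] terms by simp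
  then have T0: "T \<delta> = 0" if "\<delta> \<in> \<Delta>" for \<delta> using theta_coweight[OF that] that by auto
  have step: "root_reflection \<delta> \<circ> w \<in> C" if "\<delta> \<in> \<Delta>" "w \<in> C" for \<delta> w
  proof (rule ccontr)
    assume "root_reflection \<delta> \<circ> w \<notin> C"
    then have w: "w \<in> C - C1 \<delta>" using that by (simp add: C1_def)
    have \<delta>: "\<delta> \<in> affine_base" using that by (simp add: affine_base_def)
    have "(\<Sum>w\<in>C - C1 \<delta>. - (\<delta> \<bullet> w h)) = 0" using T[OF \<delta>] T0[OF that(1)] by (simp add: sum_negf)
    moreover have "finite (C - C1 \<delta>)" using fC by simp
    ultimately have "- (\<delta> \<bullet> w h) = 0"
      using sum_nonneg_eq_0_iff[of "C - C1 \<delta>" "\<lambda>w. - (\<delta> \<bullet> w h)"] nonpos[OF \<delta>] w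
      by (auto simp: less_imp_le)
    then show False using nonpos[OF \<delta> w] by simp
  qed
  have all: "g \<circ> w0 \<in> C" if "g \<in> generated_by_involutions (root_reflection ` \<Delta>)" for g
    using that
  proof (induction rule: generated_induct)
    case id
    show ?case using C(2) by (metis id_comp)
  next
    case (step s y)
    then obtain \<delta> where "\<delta> \<in> \<Delta>" "s = root_reflection \<delta>" by blast
    then show ?case using \<open>\<And>w \<delta>. \<delta> \<in> \<Delta> \<Longrightarrow> w \<in> C \<Longrightarrow> root_reflection \<delta> \<circ> w \<in> C\<close> step(3)
      by (metis comp_assoc)
  qed
  have "v \<in> C" if "v \<in> WG" for v
  proof -
    have w0: "w0 \<in> WG" using C by blast
    have "v \<circ> inv w0 \<in> generated_by_involutions (root_reflection ` \<Delta>)"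
      using WG_comp[OF that WG_inv[OF w0]] weyl_group_simple by simp
    moreover have "v \<circ> inv w0 \<circ> w0 = v" using WG_inv2[OF w0] by (auto simp: fun_eq_iff)
    ultimately show ?thesis using all by metis
  qed
  then show ?thesis using C by blast
qed

text \<open>
  A pair \<open>(w, \<mu>)\<close> stands for \<open>w t\<^sub>\<mu>\<close> with \<open>\<mu>\<close> very antidominant; \<open>height_deg\<close> is its affine length. The
  edges lift the quantum Bruhat graph, the second component recording the weight of a path.
\<close>

definition shift :: "'a \<Rightarrow> ('a \<Rightarrow> 'a) \<Rightarrow> 'a" where
  "shift \<beta> w = k \<beta> *\<^sub>R inv w (coroot \<beta>)"

fun act :: "'a \<Rightarrow> ('a \<Rightarrow> 'a) \<times> 'a \<Rightarrow> ('a \<Rightarrow> 'a) \<times> 'a" where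
  "act \<beta> (w, \<mu>) = (root_reflection \<beta> \<circ> w, \<mu> + shift \<beta> w)"

fun height_deg :: "('a \<Rightarrow> 'a) \<times> 'a \<Rightarrow> real" where
  "height_deg (w, \<mu>) = - (\<rho>2 \<bullet> \<mu>) - real (lng w)"

text \<open>A positive sign means descent because \<mu> is antidominant: at the image of
  \<open>p0\<close> under w t_\<mu>, \<beta> takes the value of w^-1 \<beta> at \<open>p0\<close> +
  \<mu>, very negative if w^-1 \<beta> is positive. See \<open>afn_aw_sign\<close>.\<close>

definition descends :: "'a \<Rightarrow> ('a \<Rightarrow> 'a) \<times> 'a \<Rightarrow> bool" where
  "descends \<beta> x \<longleftrightarrow> \<beta> \<bullet> fst x h > 0"

definition edges :: "((('a \<Rightarrow> 'a) \<times> 'a) \<times> (('a \<Rightarrow> 'a) \<times> 'a)) set" where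
  "edges = {(x, act \<beta> x) |x \<beta>. fst x \<in> WG \<and> \<beta> \<in> R \<and> descends \<beta> x \<and>
     height_deg (act \<beta> x) = height_deg x - 1}"

lemma fst_act: "fst (act \<beta> x) = root_reflection \<beta> \<circ> fst x"
  by (cases x) simp

lemma act_WG: "fst x \<in> WG \<Longrightarrow> \<beta> \<in> R \<Longrightarrow> fst (act \<beta> x) \<in> WG"
  using refl_comp_WG by (simp only: fst_act)

lemma shift_refl:
  assumes "w \<in> WG" "\<beta> \<in> R"
  shows "shift \<beta> (root_reflection \<beta> \<circ> w) = - shift \<beta> w"
proof -
  have "root_reflection \<beta> (coroot \<beta>) = - coroot \<beta>"
    using coroot_orthogonal[OF orthogonal_root_reflection, of \<beta> \<beta>]
      root_reflection_self[OF root_nz[OF assms(2)]] by (simp add: coroot_minus)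
  then show ?thesis
    using inv_refl_comp[OF assms] linear_neg[OF WG_linear[OF WG_inv[OF assms(1)]]]
    by (simp add: shift_def)
qed

lemma act_act: "fst x \<in> WG \<Longrightarrow> \<beta> \<in> R \<Longrightarrow> act \<beta> (act \<beta> x) = x"
  using shift_refl[of "fst x" \<beta>] refl_refl_comp[of \<beta> "fst x"] by (cases x) simp

lemma descends_act: "fst x \<in> WG \<Longrightarrow> \<beta> \<in> R \<Longrightarrow> descends \<beta> (act \<beta> x) \<longleftrightarrow> \<not> descends \<beta> x"
  using WG_nonzero[of "fst x" \<beta>] refl_inner_self[OF root_nz, of \<beta>]
  by (auto simp: descends_def fst_act)

text \<open>The change of height is the sum of \<open>G\<close> over the positive roots: a pairing
  with 2\<rho>, rewritten by \<open>sum_odd_WG\<close>, minus a change of length. Roots orthogonal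
  to \<theta> contribute 0, the involution \<beta> \<mapsto> \<theta> - \<beta> on the roots of
  pairing 1 negates \<open>G\<close>, and \<theta> itself contributes -1.\<close>

lemma height_deg_theta:
  assumes "w \<in> WG" "- \<theta> \<bullet> w h > 0"
  shows "height_deg (act (- \<theta>) (w, \<mu>)) = height_deg (w, \<mu>) - 1"
proof -
  define e where "e \<beta> = sgn (\<beta> \<bullet> w h)" for \<beta>
  define G where "G \<beta> = e \<beta> * (\<beta> \<bullet> coroot \<theta>) - (e \<beta> - e (root_reflection \<theta> \<beta>)) / 2" for \<beta>
  have e_minus: "e (- \<beta>) = - e \<beta>" for \<beta> by (simp add: e_def sgn_minus)
  have rw: "root_reflection \<theta> \<circ> w \<in> WG" using assms refl_comp_WG theta_R by blast
  have "\<rho>2 \<bullet> inv w (coroot \<theta>) = (\<Sum>\<alpha>\<in>Rp. w \<alpha> \<bullet> coroot \<theta>)"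
    using WG_inner_inv[OF assms(1), of "coroot \<theta>"]
    by (simp add: two_rho_def inner_sum_left inner_commute)
  also have "\<dots> = (\<Sum>\<beta>\<in>Rp. e \<beta> * (\<beta> \<bullet> coroot \<theta>))"
    unfolding e_def by (rule sum_odd_WG[OF assms(1), of "\<lambda>x. x \<bullet> coroot \<theta>"]) simp
  finally have rho: "\<rho>2 \<bullet> inv w (coroot \<theta>) = (\<Sum>\<beta>\<in>Rp. e \<beta> * (\<beta> \<bullet> coroot \<theta>))" .
  have len: "real (lng (root_reflection \<theta> \<circ> w)) - real (lng w) =
      (\<Sum>\<beta>\<in>Rp. (e \<beta> - e (root_reflection \<theta> \<beta>)) / 2)"
    unfolding length_eq_sum[OF rw] length_eq_sum[OF assms(1)] sum_subtractf[symmetric]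
    by (intro sum.cong) (auto simp: e_def root_reflection_inner field_simps)
  have G_theta: "G \<theta> = -1"
    using assms(2) coroot_self[OF theta_nz] root_reflection_self[OF theta_nz]
    by (simp add: G_def e_def inner_commute sgn_if)
  define \<psi> where "\<psi> \<beta> = (if \<beta> \<bullet> coroot \<theta> = 1 then \<theta> - \<beta> else \<beta>)" for \<beta>
  have m: "\<beta> \<bullet> coroot \<theta> = 0 \<or> \<beta> \<bullet> coroot \<theta> = 1" if "\<beta> \<in> Rp - {\<theta>}" for \<beta>
  proof -
    have "\<beta> \<noteq> - \<theta>" using that theta_Rp Rp_minus by auto
    then have "coroot \<theta> \<bullet> \<beta> \<in> {-1, 0, 1}" using theta_pairing that Rp_R by auto
    moreover have "coroot \<theta> \<bullet> \<beta> \<ge> 0"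
      using Rp_dominant[OF _ theta_dominant, of \<beta>] that
      by (simp add: coroot_inner[of \<theta>] inner_commute[of \<theta> \<beta>])
    ultimately show ?thesis by (auto simp: inner_commute)
  qed
  have refl: "root_reflection \<theta> \<beta> = - (\<theta> - \<beta>)" if "\<beta> \<bullet> coroot \<theta> = 1" for \<beta>
    using that by (simp add: root_reflection_def inner_commute)
  have \<psi>_in: "\<psi> \<beta> \<in> Rp - {\<theta>}" if \<beta>: "\<beta> \<in> Rp - {\<theta>}" for \<beta>
  proof (cases "\<beta> \<bullet> coroot \<theta> = 1")
    case True
    have "- root_reflection \<theta> \<beta> \<in> R" using neg_in refl_in theta_R \<beta> Rp_R by blast
    then have R: "\<theta> - \<beta> \<in> R" using refl[OF True] by simp
    moreover have "(\<theta> - \<beta>) \<bullet> h \<ge> 0" using nonneg_h theta_above \<beta> Rp_R by blast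
    ultimately have "\<theta> - \<beta> \<in> Rp" using h_nonzero[OF R] by (simp add: Rp_iff)
    moreover have "\<beta> \<noteq> 0" using root_nz Rp_R \<beta> by blast
    ultimately show ?thesis using True by (simp add: \<psi>_def)
  qed (use \<beta> in \<open>simp add: \<psi>_def\<close>)
  have \<psi>_\<psi>: "\<psi> (\<psi> \<beta>) = \<beta>" for \<beta>
    using coroot_self[OF theta_nz] by (auto simp: \<psi>_def inner_diff inner_commute)
  have G_\<psi>: "G (\<psi> \<beta>) = - G \<beta>" if \<beta>: "\<beta> \<in> Rp - {\<theta>}" for \<beta>
  proof (cases "\<beta> \<bullet> coroot \<theta> = 1")
    case True
    then have T': "(\<theta> - \<beta>) \<bullet> coroot \<theta> = 1"
      using coroot_self[OF theta_nz] by (simp add: inner_diff inner_commute)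
    then have "G (\<theta> - \<beta>) = e (\<theta> - \<beta>) - (e (\<theta> - \<beta>) + e \<beta>) / 2"
      using refl[OF T'] by (simp add: G_def e_minus)
    moreover have "G \<beta> = e \<beta> - (e \<beta> + e (\<theta> - \<beta>)) / 2"
      using refl[OF True] True e_minus[of "\<theta> - \<beta>"] by (simp add: G_def)
    ultimately show ?thesis using True by (simp add: \<psi>_def field_simps)
  next
    case False
    then have 0: "\<beta> \<bullet> coroot \<theta> = 0" using m[OF \<beta>] by blast
    then have "root_reflection \<theta> \<beta> = \<beta>" by (simp add: root_reflection_def inner_commute)
    then show ?thesis using 0 by (simp add: \<psi>_def G_def)
  qed
  have "bij_betw \<psi> (Rp - {\<theta>}) (Rp - {\<theta>})"
    using \<psi>_in \<psi>_\<psi> by (intro bij_betw_byWitness[of _ \<psi>]) auto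
  then have "(\<Sum>\<beta>\<in>Rp - {\<theta>}. G \<beta>) = (\<Sum>\<beta>\<in>Rp - {\<theta>}. G (\<psi> \<beta>))"
    by (rule sum.reindex_bij_betw[symmetric])
  also have "\<dots> = - (\<Sum>\<beta>\<in>Rp - {\<theta>}. G \<beta>)" using G_\<psi> by (simp add: sum_negf)
  finally have "(\<Sum>\<beta>\<in>Rp. G \<beta>) = -1"
    using sum.remove[OF finite_Rp theta_Rp, of G] G_theta by simp
  moreover have "(\<Sum>\<beta>\<in>Rp. G \<beta>) = \<rho>2 \<bullet> inv w (coroot \<theta>) -
      (real (lng (root_reflection \<theta> \<circ> w)) - real (lng w))"
    unfolding rho len G_def by (rule sum_subtractf)
  moreover have "shift (- \<theta>) w = - inv w (coroot \<theta>)"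
    using linear_neg[OF WG_linear[OF WG_inv[OF assms(1)]]]
    by (simp add: shift_def k_theta coroot_minus)
  ultimately show ?thesis
    by (simp add: root_reflection_minus inner_add inner_diff del: comp_apply)
qed

lemma height_deg_descend:
  assumes "i \<in> affine_base" "fst x \<in> WG" "descends i x"
  shows "height_deg (act i x) = height_deg x - 1"
proof (cases "i \<in> \<Delta>")
  case True
  then show ?thesis
    using assms length_simple[of "fst x" i] k_simple[OF True]
    by (cases x) (simp add: descends_def shift_def del: comp_apply)
next
  case False
  then have "i = - \<theta>" using assms(1) by (simp add: affine_base_def)
  then show ?thesis using height_deg_theta assms by (cases x) (simp add: descends_def)
qed

lemma height_deg_act:
  assumes "i \<in> affine_base" "fst x \<in> WG"
  shows "height_deg (act i x) = height_deg x + (if descends i x then -1 else 1)"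
proof (cases "descends i x")
  case False
  have iR: "i \<in> R" using affine_base_R assms by blast
  then have "height_deg (act i (act i x)) = height_deg (act i x) - 1"
    using height_deg_descend[OF assms(1) act_WG] descends_act assms False by blast
  then show ?thesis using False act_act[OF assms(2) iR] by simp
qed (use height_deg_descend[OF assms] in simp)

text \<open>For positive \<beta> the length grows. For negative \<beta> write r_\<beta> w = w
  r_\<alpha> with \<alpha> = w^-1 \<beta>: the length drops by at most that of r_\<alpha>, which is
  less than the pairing of the added coroot with 2\<rho>.\<close>

lemma height_deg_less:
  assumes "\<beta> \<in> R" "fst x \<in> WG" "descends \<beta> x"
  shows "height_deg (act \<beta> x) < height_deg x"
proof -
  obtain w \<mu> where x: "x = (w, \<mu>)" by (cases x)
  have w: "w \<in> WG" and pos: "\<beta> \<bullet> w h > 0" using assms by (auto simp: x descends_def)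
  show ?thesis
  proof (cases "\<beta> \<in> Rp")
    case True
    then have "k \<beta> = 0" by (simp add: k_def Rp_iff)
    then show ?thesis
      using length_less_iff[OF w True] pos by (simp add: x shift_def del: comp_apply)
  next
    case False
    then have k: "k \<beta> = 1" using assms(1) by (simp add: k_def Rp_iff)
    let ?\<alpha> = "inv w \<beta>"
    have \<alpha>: "?\<alpha> \<in> Rp"
      using pos WG_R[OF WG_inv[OF w] assms(1)] by (simp add: Rp_iff WG_inner_inv[OF w])
    have co: "inv w (coroot \<beta>) = coroot ?\<alpha>"
      using coroot_orthogonal[OF WG_orth[OF WG_inv[OF w]]] by simp
    have eq: "root_reflection \<beta> \<circ> w = w \<circ> root_reflection ?\<alpha>"
      using root_reflection_orthogonal[OF WG_orth[OF w], of ?\<alpha>] WG_inv1[OF w] by (auto simp: fun_eq_iff)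
    have "w = (root_reflection \<beta> \<circ> w) \<circ> root_reflection ?\<alpha>"
      unfolding eq by (auto simp: fun_eq_iff)
    then have "lng w \<le> lng (root_reflection \<beta> \<circ> w) + lng (root_reflection ?\<alpha>)"
      using length_comp_le[OF refl_comp_WG[OF w assms(1)] refl_WG[OF Rp_R[OF \<alpha>]]] by simp
    moreover have "real (lng (root_reflection ?\<alpha>)) + 1 \<le> \<rho>2 \<bullet> coroot ?\<alpha>"
      using length_reflection_le[OF \<alpha>] by (simp add: inner_commute)
    ultimately show ?thesis by (simp add: x shift_def k co inner_add del: comp_apply)
  qed
qed

text \<open>The relation between an affine simple reflection and its conjugate of \<sigma> \<beta>;
  by \<open>k_reflection\<close> the conjugate again has the lowest positive level, so it is of the
  form \<sigma> of the reflected root.\<close>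

lemma act_comm:
  assumes "i \<in> affine_base" "\<beta> \<in> R" "\<beta> \<noteq> i" "\<beta> \<noteq> - i" "fst x \<in> WG"
  shows "act i (act \<beta> x) = act (root_reflection i \<beta>) (act i x)"
proof -
  obtain w \<mu> where x: "x = (w, \<mu>)" by (cases x)
  have w: "w \<in> WG" and iR: "i \<in> R" using assms affine_base_R by (auto simp: x)
  let ?\<beta> = "root_reflection i \<beta>"
  have lin: "linear (inv w)" using WG_linear WG_inv w by blast
  have "shift i (root_reflection \<beta> \<circ> w) =
      k i *\<^sub>R inv w (coroot i) - (k i * (\<beta> \<bullet> coroot i)) *\<^sub>R inv w (coroot \<beta>)"
    by (simp add: shift_def inv_refl_comp[OF w assms(2)] root_reflection_coroot[of \<beta> "coroot i"]
        linear_diff[OF lin] linear_scale[OF lin] scaleR_diff_right)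
  moreover have "shift ?\<beta> (root_reflection i \<circ> w) = k ?\<beta> *\<^sub>R inv w (coroot \<beta>)"
    by (simp add: shift_def inv_refl_comp[OF w iR] coroot_orthogonal[OF orthogonal_root_reflection])
  ultimately have "shift \<beta> w + shift i (root_reflection \<beta> \<circ> w) =
      shift i w + shift ?\<beta> (root_reflection i \<circ> w)"
    using k_reflection[OF assms(1-4)] by (simp add: shift_def scaleR_diff_left)
  moreover have "root_reflection i \<circ> (root_reflection \<beta> \<circ> w) =
      root_reflection ?\<beta> \<circ> (root_reflection i \<circ> w)"
    by (auto simp: fun_eq_iff root_reflection_conj)
  ultimately show ?thesis by (simp add: x add.assoc del: comp_apply)
qed

section \<open>The lifting property for edges and paths\<close>

lemma descends_comm:
  "descends (root_reflection i \<beta>) (act i x) \<longleftrightarrow> descends \<beta> x"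
  by (simp add: descends_def fst_act root_reflection_inner)

lemma edge_down: "i \<in> affine_base \<Longrightarrow> fst x \<in> WG \<Longrightarrow> descends i x \<Longrightarrow> (x, act i x) \<in> edges"
  using height_deg_descend affine_base_R unfolding edges_def by blast

lemma edge_WG: "(x, y) \<in> edges \<Longrightarrow> fst x \<in> WG" "(x, y) \<in> edges \<Longrightarrow> fst y \<in> WG"
  and edge_height: "(x, y) \<in> edges \<Longrightarrow> height_deg y = height_deg x - 1"
  using act_WG by (auto simp: edges_def)

lemma edge_not_self:
  assumes "descends i x = descends i (act \<beta> x)" "descends \<beta> x" "fst x \<in> WG" "\<beta> \<in> R" "i \<in> R"
  shows "\<beta> \<noteq> i" "\<beta> \<noteq> - i"
proof -
  show "\<beta> \<noteq> i" using assms descends_act by blast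
  have "descends i (act (- i) x) \<longleftrightarrow> \<not> descends i x"
    using descends_act[OF assms(3,5)] by (simp add: descends_def fst_act root_reflection_minus)
  then show "\<beta> \<noteq> - i" using assms(1) by blast
qed

text \<open>Conjugation by the node i gives a descending move again. Its drop is still 1, because
  \<open>act i\<close> changes the heights of both ends by the same amount.\<close>

lemma edge_same:
  assumes "(x, y) \<in> edges" "i \<in> affine_base" "descends i x = descends i y"
  shows "(act i x, act i y) \<in> edges"
proof -
  obtain \<beta> where \<beta>: "fst x \<in> WG" "\<beta> \<in> R" "descends \<beta> x" "y = act \<beta> x"
    using assms(1) by (auto simp: edges_def)
  have iR: "i \<in> R" using assms affine_base_R by blast
  have ne: "\<beta> \<noteq> i" "\<beta> \<noteq> - i" using edge_not_self[of i x \<beta>] assms(3) \<beta> iR by blast+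
  have eq: "act i y = act (root_reflection i \<beta>) (act i x)"
    using act_comm[OF assms(2) \<beta>(2) ne \<beta>(1)] \<beta>(4) by simp
  have "height_deg (act i y) = height_deg (act i x) - 1"
    using height_deg_act[OF assms(2)] edge_WG[OF assms(1)] edge_height[OF assms(1)] assms(3) by simp
  moreover have "root_reflection i \<beta> \<in> R" using refl_in iR \<beta> by blast
  moreover have "descends (root_reflection i \<beta>) (act i x)" using descends_comm \<beta> by blast
  ultimately show ?thesis
    unfolding edges_def using eq act_WG[OF \<beta>(1) iR] by fastforce
qed

text \<open>Otherwise the conjugated move from \<open>act i x\<close> to \<open>act i y\<close>
  would still descend, while its ends have the height of x minus 1 and the height of y plus 1, which
  is an increase.\<close>

lemma edge_cross:
  assumes "(x, y) \<in> edges" "i \<in> affine_base" "descends i x" "\<not> descends i y"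
  shows "y = act i x"
proof (rule ccontr)
  assume ne: "y \<noteq> act i x"
  obtain \<beta> where \<beta>: "fst x \<in> WG" "\<beta> \<in> R" "descends \<beta> x" "y = act \<beta> x"
    using assms(1) by (auto simp: edges_def)
  have iR: "i \<in> R" using assms affine_base_R by blast
  have "\<beta> \<noteq> i" "\<beta> \<noteq> - i" using ne \<beta> assms(3) by (auto simp: descends_def)
  then have eq: "act i y = act (root_reflection i \<beta>) (act i x)"
    using act_comm[OF assms(2) \<beta>(2) _ _ \<beta>(1)] \<beta>(4) by simp
  have "height_deg (act i y) < height_deg (act i x)"
    unfolding eq using \<beta>(3)
    by (intro height_deg_less refl_in iR \<beta>(2) act_WG \<beta>(1)) (simp only: descends_comm)
  then show False
    using height_deg_act[OF assms(2)] edge_WG[OF assms(1)] edge_height[OF assms(1)] assms(3,4) by simp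
qed

text \<open>Edges are carried over by \<open>edge_same\<close>. An edge from a descending to a
  non-descending pair is the move i itself and is dropped; an edge in the other direction is
  followed by the move i.\<close>

lemma path_forward:
  assumes "(x, y) \<in> edges\<^sup>*" "fst x \<in> WG" "i \<in> affine_base" "descends i x"
  shows "(act i x, if descends i y then act i y else y) \<in> edges\<^sup>*"
  using assms(1)
proof (induction rule: rtrancl_induct)
  case base
  then show ?case using assms by simp
next
  case (step y z)
  show ?case
  proof (cases "descends i y")
    case True
    show ?thesis
    proof (cases "descends i z")
      case z: True
      then show ?thesis using step True edge_same[OF step(2) assms(3)] by (auto intro: rtrancl_into_rtrancl)
    next
      case False
      then show ?thesis using step True edge_cross[OF step(2) assms(3)] by simp
    qed
  next
    case False
    then have "(act i x, z) \<in> edges\<^sup>*" using step by (auto intro: rtrancl_into_rtrancl)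
    then show ?thesis
      using edge_down[OF assms(3) edge_WG(2)[OF step(2)]] by (auto intro: rtrancl_into_rtrancl)
  qed
qed

text \<open>The dual form, where both ends are raised: the edge from \<open>act i x\<close> to x is
  put in front, which settles a descending y. For other y, either \<open>edge_same\<close> carries
  the last edge over, or that edge is the move i and the raised end has been reached before
  it.\<close>

lemma path_backward:
  assumes "(x, y) \<in> edges\<^sup>*" "fst x \<in> WG" "i \<in> affine_base" "\<not> descends i x"
  shows "(act i x, if descends i y then y else act i y) \<in> edges\<^sup>*"
proof -
  have iR: "i \<in> R" using assms affine_base_R by blast
  have "descends i (act i x)" using descends_act assms iR by blast
  then have edge: "(act i x, x) \<in> edges"
    using edge_down[OF assms(3) act_WG[OF assms(2) iR]] act_act[OF assms(2) iR] by simp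
  show ?thesis using assms(1)
  proof (induction rule: rtrancl_induct)
    case base
    then show ?case using assms by simp
  next
    case (step y z)
    have z: "(act i x, z) \<in> edges\<^sup>*"
      using edge step by (meson converse_rtrancl_into_rtrancl rtrancl_into_rtrancl)
    show ?case
    proof (cases "descends i z")
      case False
      show ?thesis
      proof (cases "descends i y")
        case True
        then have "act i z = y"
          using edge_cross[OF step(2) assms(3)] False act_act[OF edge_WG(1)[OF step(2)] iR] by simp
        then show ?thesis using step True False by simp
      next
        case y: False
        then show ?thesis
          using step False edge_same[OF step(2) assms(3)] by (auto intro: rtrancl_into_rtrancl)
      qed
    qed (use z in simp)
  qed
qed

section \<open>Minimal weights\<close>

definition aw :: "('a \<Rightarrow> 'a) \<times> 'a \<Rightarrow> 'a \<Rightarrow> 'a" where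
  "aw x = fst x \<circ> translation (snd x)"

definition deep :: "real \<Rightarrow> 'a \<Rightarrow> bool" where
  "deep M \<mu> \<longleftrightarrow> (\<forall>\<alpha>\<in>Rp. \<alpha> \<bullet> \<mu> \<le> - M)"

lemma deep_mono: "deep M \<mu> \<Longrightarrow> N \<le> M \<Longrightarrow> deep N \<mu>"
  by (force simp: deep_def)

lemma aw_AW: "fst x \<in> WG \<Longrightarrow> snd x \<in> Q \<Longrightarrow> aw x \<in> AW"
  unfolding aw_def by (rule AW_I)

lemma aw_act:
  assumes "fst x \<in> WG" "\<beta> \<in> R"
  shows "aw (act \<beta> x) = \<sigma> \<beta> \<circ> aw x"
proof -
  obtain w \<mu> where x: "x = (w, \<mu>)" by (cases x)
  have w: "w \<in> WG" using assms x by simp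
  have "\<sigma> \<beta> \<circ> aw x = (root_reflection \<beta> \<circ> translation (k \<beta> *\<^sub>R coroot \<beta>)) \<circ> (w \<circ> translation \<mu>)"
    by (simp only: arf_translation[OF assms(2)] aw_def x fst_conv snd_conv)
  also have "\<dots> = (root_reflection \<beta> \<circ> w) \<circ> translation (inv w (k \<beta> *\<^sub>R coroot \<beta>) + \<mu>)"
    by (rule affine_comp[OF w])
  also have "inv w (k \<beta> *\<^sub>R coroot \<beta>) + \<mu> = \<mu> + shift \<beta> w"
    using linear_scale[OF WG_linear[OF WG_inv[OF w]]] by (simp add: shift_def)
  finally show ?thesis by (simp add: aw_def x del: comp_apply)
qed

lemma shift_Q: "w \<in> WG \<Longrightarrow> \<beta> \<in> R \<Longrightarrow> shift \<beta> w \<in> Q"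
  unfolding shift_def using k_int[of \<beta>] Q_scale[OF Q_WG[OF WG_inv Q_coroot]] by metis

lemma act_Q: "fst x \<in> WG \<Longrightarrow> \<beta> \<in> R \<Longrightarrow> snd x \<in> Q \<Longrightarrow> snd (act \<beta> x) \<in> Q"
  using shift_Q Q_add by (cases x) simp

text \<open>A crude bound for the depth lost in one move: a shift is 0 or a coroot, so its pairing
  with a root occurs among the summands.\<close>

definition K :: real where "K = (\<Sum>\<alpha>\<in>R. \<Sum>\<beta>\<in>R. \<bar>\<alpha> \<bullet> coroot \<beta>\<bar>)"

lemma K_nonneg: "K \<ge> 0"
  unfolding K_def by (intro sum_nonneg) auto

lemma inner_shift_le:
  assumes "\<alpha> \<in> R" "\<beta> \<in> R" "w \<in> WG"
  shows "\<bar>\<alpha> \<bullet> shift \<beta> w\<bar> \<le> K"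
proof -
  let ?\<gamma> = "inv w \<beta>"
  have \<gamma>: "?\<gamma> \<in> R" using WG_R WG_inv assms by blast
  have "\<bar>\<alpha> \<bullet> shift \<beta> w\<bar> \<le> \<bar>\<alpha> \<bullet> coroot ?\<gamma>\<bar>"
    using k_cases[of \<beta>] coroot_orthogonal[OF WG_orth[OF WG_inv[OF assms(3)]], of \<beta>]
    by (auto simp: shift_def)
  also have "\<dots> \<le> (\<Sum>\<beta>\<in>R. \<bar>\<alpha> \<bullet> coroot \<beta>\<bar>)"
    using \<gamma> finite_R by (intro member_le_sum) auto
  also have "\<dots> \<le> K"
    unfolding K_def using assms(1) finite_R
    by (intro member_le_sum[of \<alpha> R "\<lambda>\<alpha>. \<Sum>\<beta>\<in>R. \<bar>\<alpha> \<bullet> coroot \<beta>\<bar>"] sum_nonneg) auto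
  finally show ?thesis .
qed

lemma deep_act:
  assumes "fst x \<in> WG" "\<beta> \<in> R" "deep (M + K) (snd x)"
  shows "deep M (snd (act \<beta> x))"
  unfolding deep_def
proof
  fix \<alpha> assume \<alpha>: "\<alpha> \<in> Rp"
  have "\<alpha> \<bullet> shift \<beta> (fst x) \<le> K" using inner_shift_le[of \<alpha> \<beta> "fst x"] Rp_R \<alpha> assms by force
  moreover have "\<alpha> \<bullet> snd x \<le> - (M + K)" using assms(3) \<alpha> by (auto simp: deep_def)
  ultimately show "\<alpha> \<bullet> snd (act \<beta> x) \<le> - M" by (cases x) (simp add: inner_add)
qed

text \<open>Depth 2 suffices: the value at \<open>p0\<close> has modulus below 1 and the level is 0
  or 1, so a translation part of modulus at least 2 decides the sign.\<close>

lemma afn_aw_sign: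
  assumes "\<beta> \<in> R" "fst x \<in> WG" "deep 2 (snd x)"
  shows "afn \<beta> (k \<beta>) (aw x p0) < 0 \<longleftrightarrow> descends \<beta> x"
    and "afn \<beta> (k \<beta>) (aw x p0) \<noteq> 0"
proof -
  obtain w \<mu> where x: "x = (w, \<mu>)" by (cases x)
  have w: "w \<in> WG" and \<mu>: "\<alpha> \<in> Rp \<Longrightarrow> \<alpha> \<bullet> \<mu> \<le> - 2" for \<alpha> using assms by (auto simp: x deep_def)
  let ?\<alpha> = "inv w \<beta>"
  have \<alpha>: "?\<alpha> \<in> R" using WG_R WG_inv w assms by blast
  have eq: "afn \<beta> (k \<beta>) (aw x p0) = ?\<alpha> \<bullet> p0 + ?\<alpha> \<bullet> \<mu> + k \<beta>"
    by (simp add: afn_def aw_def x translation_def WG_inner_inv[OF w] inner_add)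
  have "descends \<beta> x \<longleftrightarrow> ?\<alpha> \<bullet> h > 0" by (simp add: descends_def x WG_inner_inv[OF w])
  then have d: "descends \<beta> x \<longleftrightarrow> ?\<alpha> \<in> Rp" using \<alpha> by (simp add: Rp_iff)
  have p: "\<bar>?\<alpha> \<bullet> p0\<bar> < 1" using inner_p0_less_1 \<alpha> by blast
  have "?\<alpha> \<in> Rp \<and> ?\<alpha> \<bullet> \<mu> \<le> - 2 \<or> ?\<alpha> \<notin> Rp \<and> ?\<alpha> \<bullet> \<mu> \<ge> 2"
    using Rp_or[OF \<alpha>] Rp_minus[of "?\<alpha>"] \<mu>[of ?\<alpha>] \<mu>[of "- ?\<alpha>"] by auto
  then show "afn \<beta> (k \<beta>) (aw x p0) < 0 \<longleftrightarrow> descends \<beta> x" "afn \<beta> (k \<beta>) (aw x p0) \<noteq> 0"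
    using p k_cases[of \<beta>] unfolding eq d by auto
qed

lemma sigma_root: "\<beta> \<in> R \<Longrightarrow> (afn \<beta> (k \<beta>), \<sigma> \<beta>) \<in> affine_roots"
  unfolding affine_roots_def using k_int[of \<beta>] by (metis (mono_tags, lifting) mem_Collect_eq)

lemma sigma_root_pos: "\<beta> \<in> R \<Longrightarrow> afn \<beta> (k \<beta>) p0 > 0"
  using afn_pos_iff[of \<beta>] k_int[of \<beta>] by force

lemma act_ascent:
  assumes "fst x \<in> WG" "\<beta> \<in> R" "snd x \<in> Q" "deep 2 (snd x)" "descends \<beta> x"
  shows "(aw (act \<beta> x), aw x) \<in> aff.ascents"
proof -
  have z: "aw (act \<beta> x) \<in> GS"
    using aw_AW[OF act_WG act_Q] assms AW_eq by simp
  have nz: "\<beta> \<noteq> 0" using root_nz assms by blast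
  have eq: "aw (act \<beta> x) = \<sigma> \<beta> \<circ> aw x" using aw_act assms by blast
  have "afn \<beta> (k \<beta>) (aw (act \<beta> x) p0) = - afn \<beta> (k \<beta>) (aw x p0)"
    unfolding eq using afn_arf[OF nz] by simp
  then have "afn \<beta> (k \<beta>) (aw (act \<beta> x) p0) > 0" using afn_aw_sign[OF assms(2,1,4)] assms(5) by simp
  then have "(aw (act \<beta> x), \<sigma> \<beta> \<circ> aw (act \<beta> x)) \<in> aff.ascents"
    using aff.ascentsI[OF z sigma_root sigma_root_pos] assms(2) by blast
  moreover have "\<sigma> \<beta> \<circ> aw (act \<beta> x) = aw x" unfolding eq by (auto simp: arf_twice[OF nz])
  ultimately show ?thesis by simp
qed

text \<open>Each move costs at most \<open>K\<close> of depth, and depth 2 must be left at every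
  move for the sign test.\<close>

lemma path_ascents:
  assumes "(x, y) \<in> edges ^^ n" "fst x \<in> WG" "snd x \<in> Q" "deep (2 + real n * K) (snd x)"
  shows "(aw y, aw x) \<in> aff.ascents\<^sup>*"
  using assms
proof (induction n arbitrary: x)
  case 0
  then show ?case by simp
next
  case (Suc n)
  then obtain z where z: "(x, z) \<in> edges" "(z, y) \<in> edges ^^ n" by (meson relpow_Suc_D2)
  then obtain \<beta> where \<beta>: "\<beta> \<in> R" "descends \<beta> x" "z = act \<beta> x" by (auto simp: edges_def)
  have eq: "2 + real (Suc n) * K = 2 + real n * K + K" by (simp add: algebra_simps)
  have "deep (2 + real n * K + K) (snd x)" using Suc.prems(4) unfolding eq .
  then have "deep (2 + real n * K) (snd z)" using deep_act Suc.prems \<beta> by blast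
  then have "(aw y, aw z) \<in> aff.ascents\<^sup>*"
    using Suc.IH[OF z(2)] act_WG act_Q Suc.prems \<beta> by blast
  moreover have "deep 2 (snd x)"
    using deep_mono[OF Suc.prems(4), of 2] K_nonneg by simp
  then have "(aw z, aw x) \<in> aff.ascents" using act_ascent Suc.prems \<beta> by blast
  ultimately show ?case by (rule rtrancl_into_rtrancl)
qed

text \<open>
  A reflection that increases the length moves the image of the origin outwards: the point before
  the reflection lies in the convex hull of the Weyl orbit of the point after it.
\<close>

lemma ascents_orbit:
  assumes "(y, x) \<in> aff.ascents" "g \<in> WG"
  shows "\<exists>g'\<in>WG. g' \<omega> \<bullet> x 0 \<le> g \<omega> \<bullet> y 0"
proof -
  obtain t a where y: "y \<in> GS" "(a, t) \<in> affine_roots" "a p0 > 0" "a (y p0) > 0" "x = t \<circ> y"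
    using assms(1) by (auto simp: aff.ascents_def)
  obtain \<beta> n where \<beta>: "\<beta> \<in> R" "a = afn \<beta> (of_int n)" "t = arf \<beta> (of_int n)"
    using y(2) by (auto simp: affine_roots_def)
  obtain w q where wq: "w \<in> WG" "q \<in> Q" "y = w \<circ> translation q"
    using y(1) unfolding AW_eq[symmetric] by (auto simp: affine_weyl_group_def)
  let ?n = "real_of_int n"
  have n: "?n \<ge> 0" using y(3) \<beta> afn_pos_iff[OF \<beta>(1), of n] k_cases[of \<beta>] by auto
  let ?\<alpha> = "inv w \<beta>"
  have \<alpha>: "?\<alpha> \<in> R" using WG_R WG_inv wq \<beta> by blast
  have y_val: "\<beta> \<bullet> y v = ?\<alpha> \<bullet> v + ?\<alpha> \<bullet> q" for v
    by (simp add: wq translation_def WG_inner_inv[OF wq(1)] inner_add)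
  obtain m where m: "?\<alpha> \<bullet> q = of_int m" using Q_int \<alpha> wq(2) by blast
  have "afn ?\<alpha> (of_int (m + n)) p0 > 0" using y(4) by (simp add: \<beta>(2) afn_def y_val m add.assoc)
  then have mn: "real_of_int (m + n) \<ge> 0" using afn_pos_iff[OF \<alpha>, of "m + n"] k_cases[of ?\<alpha>] by auto
  have \<beta>y0: "\<beta> \<bullet> y 0 = of_int m" by (simp add: y_val m)
  have x0: "x 0 = y 0 - of_int (m + n) *\<^sub>R coroot \<beta>"
    by (simp add: y(5) \<beta>(3) arf_def afn_def \<beta>y0)
  have co: "root_reflection \<beta> (coroot \<beta>) = - coroot \<beta>"
    using coroot_orthogonal[OF orthogonal_root_reflection, of \<beta> \<beta>] root_reflection_self[OF root_nz[OF \<beta>(1)]]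
    by (simp add: coroot_minus)
  \<comment> \<open>As n and m + n are nonnegative, y 0 lies on the segment from x 0 to its
    reflection; the sign of the pairing with the coroot tells which end has the smaller inner
    product.\<close>
  have rx0: "root_reflection \<beta> (x 0) = y 0 + ?n *\<^sub>R coroot \<beta>"
    unfolding x0 linear_diff[OF linear_root_reflection] linear_scale[OF linear_root_reflection] co
    by (simp add: root_reflection_coroot \<beta>y0 scaleR_add_left)
  show ?thesis
  proof (cases "g \<omega> \<bullet> coroot \<beta> \<ge> 0")
    case True
    then have "g \<omega> \<bullet> x 0 \<le> g \<omega> \<bullet> y 0" using mn by (simp add: x0 inner_diff)
    then show ?thesis using assms(2) by blast
  next
    case False
    then have "?n * (g \<omega> \<bullet> coroot \<beta>) \<le> 0" using n by (simp add: mult_nonneg_nonpos)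
    then have "g \<omega> \<bullet> root_reflection \<beta> (x 0) \<le> g \<omega> \<bullet> y 0" by (simp add: rx0 inner_add)
    then have "(root_reflection \<beta> \<circ> g) \<omega> \<bullet> x 0 \<le> g \<omega> \<bullet> y 0" by (simp add: root_reflection_inner)
    then show ?thesis using refl_comp_WG[OF assms(2) \<beta>(1)] by blast
  qed
qed

lemma ascents_rtrancl_orbit:
  assumes "(y, x) \<in> aff.ascents\<^sup>*" "g \<in> WG"
  shows "\<exists>g'\<in>WG. g' \<omega> \<bullet> x 0 \<le> g \<omega> \<bullet> y 0"
  using assms(1)
proof (induction rule: rtrancl_induct)
  case base
  then show ?case using assms(2) by blast
next
  case (step x z)
  then obtain g' where g': "g' \<in> WG" "g' \<omega> \<bullet> x 0 \<le> g \<omega> \<bullet> y 0" by blast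
  obtain g'' where "g'' \<in> WG" "g'' \<omega> \<bullet> z 0 \<le> g' \<omega> \<bullet> x 0" using ascents_orbit[OF step(2) g'(1)] by blast
  then show ?case using g' by force
qed

text \<open>Since - \<mu> is dominant, \<omega> \<bullet> \<mu> is the least inner product of \<mu>
  with the orbit of \<omega>, and \<open>ascents_rtrancl_orbit\<close> bounds some such product by
  \<omega> \<bullet> \<nu>.\<close>

lemma ascents_same_dominance:
  assumes "w \<in> WG" "deep 0 \<mu>" "(aw (w, \<nu>), aw (w, \<mu>)) \<in> aff.ascents\<^sup>*" "dominant \<omega>"
  shows "0 \<le> \<omega> \<bullet> (\<nu> - \<mu>)"
proof -
  obtain g where g: "g \<in> WG" "g \<omega> \<bullet> w \<mu> \<le> w \<omega> \<bullet> w \<nu>"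
    using ascents_rtrancl_orbit[OF assms(3,1)] by (auto simp: aw_def translation_def)
  have "dominant (- \<mu>)" using assms(2) Delta_Rp by (auto simp: dominant_def deep_def)
  moreover have ig: "inv w \<circ> g \<in> WG" using WG_comp WG_inv assms(1) g by blast
  ultimately have "(- \<mu>) \<bullet> (inv w \<circ> g) \<omega> \<le> (- \<mu>) \<bullet> \<omega>" using dominant_inner_le assms(4) by blast
  then have "\<omega> \<bullet> \<mu> \<le> \<mu> \<bullet> inv w (g \<omega>)" by (simp add: inner_commute)
  also have "\<dots> = g \<omega> \<bullet> w \<mu>" using WG_inner_inv[OF assms(1), of "g \<omega>" \<mu>] by (simp add: inner_commute)
  also have "\<dots> \<le> \<omega> \<bullet> \<nu>" using g WG_inner[OF assms(1)] by simp
  finally show ?thesis by (simp add: inner_diff)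
qed

text \<open>\<open>weight w v \<kappa>\<close>: the minimal weight of a path from \<open>w\<close> to \<open>v\<close> is \<open>\<kappa>\<close>, and \<open>\<kappa>\<close> governs the Bruhat
  order between \<open>v t\<^sub>\<nu>\<close> and \<open>w t\<^sub>\<mu>\<close> for very antidominant \<open>\<mu>\<close>, \<open>\<nu>\<close>.\<close>

definition weight :: "('a \<Rightarrow> 'a) \<Rightarrow> ('a \<Rightarrow> 'a) \<Rightarrow> 'a \<Rightarrow> bool" where
  "weight w v \<kappa> \<longleftrightarrow> ((w, 0), (v, \<kappa>)) \<in> edges\<^sup>* \<and>
     (\<exists>M. \<forall>\<mu>\<in>Q. \<forall>\<nu>\<in>Q. deep M \<mu> \<longrightarrow> deep M \<nu> \<longrightarrow> (aw (v, \<nu>), aw (w, \<mu>)) \<in> aff.ascents\<^sup>* \<longrightarrow>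
       (\<forall>\<omega>. dominant \<omega> \<longrightarrow> 0 \<le> \<omega> \<bullet> (\<nu> - \<mu> - \<kappa>)))"

lemma weight_refl: "w \<in> WG \<Longrightarrow> weight w w 0"
  unfolding weight_def using ascents_same_dominance by (auto intro!: exI[of _ 0])

section \<open>Translated paths and the existence of minimal weights\<close>

definition translate :: "'a \<Rightarrow> ('a \<Rightarrow> 'a) \<times> 'a \<Rightarrow> ('a \<Rightarrow> 'a) \<times> 'a" where
  "translate \<tau> x = (fst x, snd x + \<tau>)"

lemma act_translate: "act \<beta> (translate \<tau> x) = translate \<tau> (act \<beta> x)"
  by (cases x) (simp add: translate_def)

lemma edge_translate: "(x, y) \<in> edges \<Longrightarrow> (translate \<tau> x, translate \<tau> y) \<in> edges"
proof -
  assume "(x, y) \<in> edges"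
  then obtain \<beta> where \<beta>: "fst x \<in> WG" "\<beta> \<in> R" "descends \<beta> x" "y = act \<beta> x"
    "height_deg (act \<beta> x) = height_deg x - 1"
    by (auto simp: edges_def)
  have "height_deg (translate \<tau> z) = height_deg z - \<rho>2 \<bullet> \<tau>" for z
    by (cases z) (simp add: translate_def inner_add)
  then have "height_deg (act \<beta> (translate \<tau> x)) = height_deg (translate \<tau> x) - 1"
    using \<beta> by (simp add: act_translate)
  moreover have "fst (translate \<tau> x) \<in> WG" "descends \<beta> (translate \<tau> x)"
    using \<beta> by (simp_all add: translate_def descends_def)
  ultimately show ?thesis unfolding edges_def \<beta>(4) act_translate[symmetric] using \<beta>(2) by blast
qed

lemma path_translate: "(x, y) \<in> edges ^^ n \<Longrightarrow> (translate \<tau> x, translate \<tau> y) \<in> edges ^^ n"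
proof (induction n arbitrary: y)
  case (Suc n)
  then obtain z where z: "(x, z) \<in> edges ^^ n" "(z, y) \<in> edges" by auto
  show ?case using relpow_Suc_I[OF Suc.IH[OF z(1)] edge_translate[OF z(2)]] .
qed simp

lemma path_translate_rtrancl: "(x, y) \<in> edges\<^sup>* \<Longrightarrow> (translate \<tau> x, translate \<tau> y) \<in> edges\<^sup>*"
  using path_translate by (metis rtrancl_imp_relpow relpow_imp_rtrancl)

lemma path_height: "(x, y) \<in> edges ^^ n \<Longrightarrow> height_deg x - height_deg y = real n"
proof (induction n arbitrary: y)
  case (Suc n)
  then obtain z where z: "(x, z) \<in> edges ^^ n" "(z, y) \<in> edges" by auto
  then show ?case using Suc.IH[OF z(1)] edge_height[OF z(2)] by simp
qed simp

lemma lower_aw: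
  assumes "i \<in> affine_base" "fst x \<in> WG" "deep 2 (snd x)"
  shows "aff.lower (afn i (k i)) (\<sigma> i) (aw x) = aw (if descends i x then act i x else x)"
  using afn_aw_sign(1)[of i x] aw_act[of x i] assms affine_base_R
  by (auto simp: aff.lower_def simp del: comp_apply)

lemma ascents_descend:
  assumes "i \<in> affine_base" "fst x \<in> WG" "fst y \<in> WG" "deep 2 (snd x)" "deep 2 (snd y)"
    and "(aw y, aw x) \<in> aff.ascents\<^sup>*"
  shows "(aw (if descends i y then act i y else y), aw (if descends i x then act i x else x)) \<in> aff.ascents\<^sup>*"
proof -
  have iR: "i \<in> R" using affine_base_R assms by blast
  have "(aff.lower (afn i (k i)) (\<sigma> i) (aw y), aff.lower (afn i (k i)) (\<sigma> i) (aw x)) \<in> aff.ascents\<^sup>*"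
    using aff.lifting[OF _ sigma_root[OF iR] sigma_root_pos[OF iR] assms(6)] assms(1) by blast
  then show ?thesis unfolding lower_aw[OF assms(1,2,4)] lower_aw[OF assms(1,3,5)] .
qed

text \<open>Both halves of \<open>weight\<close> are transported from the lowered pair: the path by
  \<open>path_backward\<close>, or by one edge put in front if v stays; the bound by lifting in the
  affine Bruhat order.\<close>

lemma weight_step:
  assumes i: "i \<in> affine_base" "i \<bullet> w h > 0" and w: "w \<in> WG" and v: "v \<in> WG"
    and weight: "weight (root_reflection i \<circ> w) (if i \<bullet> v h > 0 then root_reflection i \<circ> v else v) \<kappa>"
  shows "\<exists>\<kappa>'. weight w v \<kappa>'"
proof -
  have iR: "i \<in> R" using affine_base_R i by blast
  define s where "s = (if i \<bullet> v h > 0 then shift i v else 0)"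
  define v' where "v' = (if i \<bullet> v h > 0 then root_reflection i \<circ> v else v)"
  \<comment> \<open>Lowering adds \<open>shift i w\<close> to \<mu> and s to \<nu>; this choice
    keeps the excess \<nu> - \<mu> - \<kappa>' unchanged.\<close>
  define \<kappa>' where "\<kappa>' = \<kappa> + shift i w - s"
  let ?w' = "root_reflection i \<circ> w"
  have w': "?w' \<in> WG" using refl_comp_WG w iR by blast
  have path: "((?w', 0), (v', \<kappa>)) \<in> edges\<^sup>*" using weight unfolding weight_def v'_def by blast
  obtain M where M: "\<And>\<mu> \<nu> \<omega>. \<mu> \<in> Q \<Longrightarrow> \<nu> \<in> Q \<Longrightarrow> deep M \<mu> \<Longrightarrow> deep M \<nu> \<Longrightarrow>
      (aw (v', \<nu>), aw (?w', \<mu>)) \<in> aff.ascents\<^sup>* \<Longrightarrow> dominant \<omega> \<Longrightarrow> 0 \<le> \<omega> \<bullet> (\<nu> - \<mu> - \<kappa>)"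
    using weight unfolding weight_def v'_def by blast
  have dw: "descends i (w, \<mu>)" for \<mu> using i(2) by (simp add: descends_def)
  have dv: "(if descends i (v, \<nu>) then act i (v, \<nu>) else (v, \<nu>)) = (v', \<nu> + s)" for \<nu>
    by (simp add: descends_def v'_def s_def del: comp_apply)
  have act_w': "act i (?w', \<mu>) = (w, \<mu> - shift i w)" for \<mu>
    using shift_refl[OF w iR] refl_refl_comp[of i w] by (simp del: comp_apply)
  have not_dw': "\<not> descends i (?w', \<mu>)" for \<mu>
    using descends_act[of "(w, \<mu>)" i] w iR dw by (simp add: descends_def del: comp_apply)
  have "((w, - shift i w), (v, \<kappa> - s)) \<in> edges\<^sup>*"
  proof (cases "i \<bullet> v h > 0")
    case True
    have v'_eq: "v' = root_reflection i \<circ> v" "s = shift i v" using True by (simp_all add: v'_def s_def)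
    have "\<not> descends i (v', \<kappa>)"
      using descends_act[of "(v, \<kappa>)" i] v iR True by (simp add: v'_eq descends_def del: comp_apply)
    moreover have "act i (v', \<kappa>) = (v, \<kappa> - s)"
      using shift_refl[OF v iR] refl_refl_comp[of i v] by (simp add: v'_eq del: comp_apply)
    ultimately show ?thesis
      using path_backward[OF path _ i(1) not_dw'] w' act_w'[of 0] by (simp del: comp_apply)
  next
    case False
    have "((w, - shift i w), (?w', 0)) \<in> edges"
      using edge_down[OF i(1), of "(w, - shift i w)"] w dw by (simp del: comp_apply)
    then show ?thesis using path False
      by (simp add: v'_def s_def del: comp_apply)
  qed
  from path_translate_rtrancl[OF this, of "shift i w"]
  have path': "((w, 0), (v, \<kappa>')) \<in> edges\<^sup>*"
    by (simp add: translate_def \<kappa>'_def algebra_simps)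
  \<comment> \<open>Depth 2 validates the sign test, and depth M + \<open>K\<close> leaves depth M
    after one shift.\<close>
  have "0 \<le> \<omega> \<bullet> (\<nu> - \<mu> - \<kappa>')"
    if \<mu>: "\<mu> \<in> Q" "deep (max M 2 + K) \<mu>" and \<nu>: "\<nu> \<in> Q" "deep (max M 2 + K) \<nu>"
      and le: "(aw (v, \<nu>), aw (w, \<mu>)) \<in> aff.ascents\<^sup>*" and \<omega>: "dominant \<omega>" for \<mu> \<nu> \<omega>
  proof -
    have deep2: "deep 2 \<mu>" "deep 2 \<nu>" "deep M \<nu>"
      using deep_mono[OF \<mu>(2)] deep_mono[OF \<nu>(2)] K_nonneg by (auto intro: max.coboundedI1 max.coboundedI2)
    have "(aw (v', \<nu> + s), aw (?w', \<mu> + shift i w)) \<in> aff.ascents\<^sup>*"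
      using ascents_descend[OF i(1), of "(w, \<mu>)" "(v, \<nu>)"] w v deep2 le dw[of \<mu>] dv[of \<nu>]
      by (simp del: comp_apply)
    moreover have "\<mu> + shift i w \<in> Q" using Q_add \<mu> shift_Q w iR by blast
    moreover have "\<nu> + s \<in> Q" using Q_add \<nu> shift_Q v iR Q_zero by (simp add: s_def)
    moreover have "deep M (\<mu> + shift i w)"
      using deep_act[of "(w, \<mu>)" i M] w iR deep_mono[OF \<mu>(2), of "M + K"] by simp
    moreover have "deep M (\<nu> + s)"
      using deep_act[of "(v, \<nu>)" i M] v iR deep_mono[OF \<nu>(2), of "M + K"] deep2(3) by (simp add: s_def)
    ultimately have "0 \<le> \<omega> \<bullet> ((\<nu> + s) - (\<mu> + shift i w) - \<kappa>)" using M \<omega> by blast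
    moreover have "(\<nu> + s) - (\<mu> + shift i w) - \<kappa> = \<nu> - \<mu> - \<kappa>'" by (simp add: \<kappa>'_def)
    ultimately show ?thesis by simp
  qed
  then show ?thesis unfolding weight_def using path' by (intro exI[of _ \<kappa>'] conjI exI[of _ "max M 2 + K"]) auto
qed

text \<open>The set of reachable elements is closed under descending affine simple moves, each of
  which is an edge.\<close>

lemma path_exists:
  assumes "w \<in> WG" "v \<in> WG"
  shows "\<exists>\<nu>. ((w, \<mu>), (v, \<nu>)) \<in> edges\<^sup>*"
proof -
  define C where "C = {v \<in> WG. \<exists>\<nu>. ((w, \<mu>), (v, \<nu>)) \<in> edges\<^sup>*}"
  have "C = WG"
  proof (rule closed_down_eq_WG)
    show "C \<subseteq> WG" by (auto simp: C_def)
    show "w \<in> C" using assms by (auto simp: C_def)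
    fix u i assume u: "u \<in> C" and i: "i \<in> affine_base" "i \<bullet> u h > 0"
    then obtain \<nu> where \<nu>: "u \<in> WG" "((w, \<mu>), (u, \<nu>)) \<in> edges\<^sup>*" by (auto simp: C_def)
    have "((u, \<nu>), act i (u, \<nu>)) \<in> edges"
      using edge_down[OF i(1)] \<nu> i(2) by (simp add: descends_def del: act.simps)
    then have "((w, \<mu>), (root_reflection i \<circ> u, \<nu> + shift i u)) \<in> edges\<^sup>*"
      using \<nu>(2) by (simp del: comp_apply)
    then show "root_reflection i \<circ> u \<in> C"
      using refl_comp_WG[OF \<nu>(1)] affine_base_R i(1) by (auto simp: C_def simp del: comp_apply)
  qed
  then show ?thesis using assms(2) by (auto simp: C_def)
qed

text \<open>
  In a counterexample at minimal distance \<open>n\<close>, every move of \<open>w\<close> must be accompanied by the move of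
  \<open>v = w g\<close>. This then holds at all \<open>u \<in> W\<close>, but it fails at \<open>u = 1\<close> for a left descent of \<open>g\<close>.
\<close>

lemma weight_exists_aux:
  "w \<in> WG \<Longrightarrow> v \<in> WG \<Longrightarrow> ((w, \<mu>), (v, \<nu>)) \<in> edges ^^ n \<Longrightarrow> \<exists>\<kappa>. weight w v \<kappa>"
proof (induction n arbitrary: w v \<mu> \<nu> rule: less_induct)
  case (less n)
  show ?case
  proof (rule ccontr)
    assume none: "\<nexists>\<kappa>. weight w v \<kappa>"
    define g where "g = inv w \<circ> v"
    have g: "g \<in> WG" using WG_comp WG_inv less.prems unfolding g_def by blast
    have wg: "w \<circ> g = v" using WG_inv1[OF less.prems(1)] by (auto simp: g_def)
    \<comment> \<open>Moving both elements on the left preserves w^-1 v = g, so a counterexample is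
      recorded by its first component alone.\<close>
    define C where "C = {w \<in> WG. (\<exists>\<mu> \<nu>. ((w, \<mu>), (w \<circ> g, \<nu>)) \<in> edges ^^ n) \<and>
      (\<nexists>\<kappa>. weight w (w \<circ> g) \<kappa>)}"
    have step: "i \<bullet> (u \<circ> g) h > 0 \<and> root_reflection i \<circ> u \<in> C"
      if u: "u \<in> C" and i: "i \<in> affine_base" "i \<bullet> u h > 0" for u i
    proof -
      have iR: "i \<in> R" using affine_base_R i by blast
      obtain \<mu> \<nu> where u': "u \<in> WG" "((u, \<mu>), (u \<circ> g, \<nu>)) \<in> edges ^^ n"
        "\<nexists>\<kappa>. weight u (u \<circ> g) \<kappa>" using u by (auto simp: C_def simp del: comp_apply)
      have ug: "u \<circ> g \<in> WG" using WG_comp u' g by blast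
      let ?u = "root_reflection i \<circ> u"
      have ru: "?u \<in> WG" using refl_comp_WG u'(1) iR by blast
      have du: "descends i (u, \<mu>)" using i by (simp add: descends_def)
      note fwd = path_forward[OF relpow_imp_rtrancl[OF u'(2)] _ i(1) du]
      have hu: "height_deg (act i (u, \<mu>)) = height_deg (u, \<mu>) - 1"
        using height_deg_descend[OF i(1) _ du] u'(1) by simp
      have n: "height_deg (u, \<mu>) - height_deg (u \<circ> g, \<nu>) = real n" by (rule path_height[OF u'(2)])
      have sync: "i \<bullet> (u \<circ> g) h > 0"
      proof (rule ccontr)
        assume no: "\<not> i \<bullet> (u \<circ> g) h > 0"
        then have "((act i (u, \<mu>)), (u \<circ> g, \<nu>)) \<in> edges\<^sup>*"
          using fwd u'(1) by (simp add: descends_def del: act.simps)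
        then obtain m where m: "((act i (u, \<mu>)), (u \<circ> g, \<nu>)) \<in> edges ^^ m"
          by (meson rtrancl_imp_relpow)
        \<comment> \<open>The start drops by one in height while the target stays, so the path is
          shorter by one and the induction hypothesis applies.\<close>
        from path_height[OF m] hu n have "real m + 1 = real n" by linarith
        then have "m < n" by linarith
        then obtain \<kappa> where "weight ?u (u \<circ> g) \<kappa>"
          using less.IH[of m ?u "u \<circ> g" "\<mu> + shift i u" \<nu>] m ru ug by (auto simp del: comp_apply)
        then have "\<exists>\<kappa>. weight u (u \<circ> g) \<kappa>" using weight_step[OF i u'(1) ug] no by (simp del: comp_apply)
        then show False using u'(3) by blast
      qed
      have rug: "root_reflection i \<circ> (u \<circ> g) = ?u \<circ> g" by (simp only: comp_assoc)
      have dug: "descends i (u \<circ> g, \<nu>)" using sync by (simp add: descends_def)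
      then have "(act i (u, \<mu>), act i (u \<circ> g, \<nu>)) \<in> edges\<^sup>*"
        using fwd u'(1) by (simp del: act.simps)
      then obtain m where m: "(act i (u, \<mu>), act i (u \<circ> g, \<nu>)) \<in> edges ^^ m"
        by (meson rtrancl_imp_relpow)
      have "height_deg (act i (u \<circ> g, \<nu>)) = height_deg (u \<circ> g, \<nu>) - 1"
        using height_deg_descend[OF i(1) _ dug] ug by simp
      with path_height[OF m] hu n have "real m = real n" by linarith
      then have "((?u, \<mu> + shift i u), (?u \<circ> g, \<nu> + shift i (u \<circ> g))) \<in> edges ^^ n"
        using m unfolding act.simps rug by simp
      moreover have "\<nexists>\<kappa>. weight ?u (?u \<circ> g) \<kappa>"
        using weight_step[OF i u'(1) ug] sync u'(3) rug by (auto simp del: comp_apply)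
      ultimately show ?thesis using sync ru by (auto simp: C_def simp del: comp_apply)
    qed
    have "C = WG"
    proof (rule closed_down_eq_WG)
      show "C \<subseteq> WG" by (auto simp: C_def)
      show "w \<in> C" using less.prems none wg by (auto simp: C_def simp del: comp_apply)
    qed (use step in blast)
    then have id: "id \<in> C" using WG_id by blast
    then have "g \<noteq> id" using weight_refl[OF WG_id] unfolding C_def by (metis (mono_tags, lifting) comp_id mem_Collect_eq)
    then obtain \<delta> where \<delta>: "\<delta> \<in> \<Delta>" "\<delta> \<bullet> g h < 0" using ex_descent g by blast
    have "\<delta> \<bullet> (id \<circ> g) h > 0"
      using step[OF id, of \<delta>] \<delta>(1) simple_h by (simp add: affine_base_def)
    then show False using \<delta>(2) by simp
  qed
qed

lemma weight_exists: "w \<in> WG \<Longrightarrow> v \<in> WG \<Longrightarrow> \<exists>\<kappa>. weight w v \<kappa>"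
  using path_exists[of w v 0] weight_exists_aux by (metis rtrancl_imp_relpow)

section \<open>The embedding\<close>

text \<open>For large N the vector N 2\<rho> - x is dominant. Testing x against it leaves minus the
  squared norm of x, because 2\<rho> is orthogonal to x.\<close>

lemma dominance_zero:
  assumes "\<And>\<omega>. dominant \<omega> \<Longrightarrow> 0 \<le> \<omega> \<bullet> x" "\<rho>2 \<bullet> x = 0"
  shows "x = 0"
proof -
  define N where "N = (\<Sum>\<delta>\<in>\<Delta>. \<bar>\<delta> \<bullet> x\<bar> / (\<delta> \<bullet> \<rho>2))"
  have "\<delta> \<bullet> (N *\<^sub>R \<rho>2 - x) \<ge> 0" if \<delta>: "\<delta> \<in> \<Delta>" for \<delta>
  proof -
    have pos: "\<delta> \<bullet> \<rho>2 > 0" using simple_two_rho \<delta> by blast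
    have "\<bar>\<delta> \<bullet> x\<bar> / (\<delta> \<bullet> \<rho>2) \<le> N"
      unfolding N_def using simple_two_rho
      by (intro member_le_sum[of \<delta> \<Delta> "\<lambda>\<delta>. \<bar>\<delta> \<bullet> x\<bar> / (\<delta> \<bullet> \<rho>2)"] \<delta> finite_Delta)
        (auto simp: less_imp_le)
    then have "\<bar>\<delta> \<bullet> x\<bar> \<le> N * (\<delta> \<bullet> \<rho>2)" using pos by (simp add: pos_divide_le_eq)
    then show ?thesis by (simp add: inner_diff)
  qed
  then have "dominant (N *\<^sub>R \<rho>2 - x)" by (simp add: dominant_def)
  from assms(1)[OF this] have "x \<bullet> x \<le> 0" using assms(2) by (simp add: inner_diff)
  then show ?thesis by (metis inner_gt_zero_iff not_less)
qed

lemma deep_exists: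
  assumes "finite S"
  shows "\<exists>\<tau>\<in>Q. \<forall>s\<in>S. deep M (s + \<tau>)"
proof -
  define B where "B = (\<Sum>s\<in>S. \<Sum>\<alpha>\<in>Rp. \<bar>\<alpha> \<bullet> s\<bar>)"
  \<comment> \<open>B bounds every pairing of a positive root with an element of S, and each
    positive root pairs to at least 1 with \<open>rho_check2\<close>; so subtracting N copies
    reaches depth M.\<close>
  define N where "N = nat \<lceil>\<bar>M\<bar> + B\<rceil>"
  have "rho_check2 \<in> Q"
  proof -
    have "(\<Sum>\<alpha>\<in>A. coroot \<alpha>) \<in> Q" if "finite A" "A \<subseteq> Rp" for A
      using that by (induction A rule: finite_induct) (use Q_zero Q_add Q_coroot Rp_R in auto)
    then show ?thesis using finite_Rp by (simp add: rho_check2_def)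
  qed
  then have \<tau>: "of_int (- int N) *\<^sub>R rho_check2 \<in> Q" by (rule Q_scale)
  have "\<alpha> \<bullet> (s + of_int (- int N) *\<^sub>R rho_check2) \<le> - M" if s: "s \<in> S" and \<alpha>: "\<alpha> \<in> Rp" for s \<alpha>
  proof -
    have "\<alpha> \<bullet> rho_check2 = (\<Sum>\<delta>\<in>\<Delta>. (\<alpha> \<bullet> coweight \<delta>) * (\<delta> \<bullet> rho_check2))"
      by (subst (1) simple_expansion[of \<alpha>, symmetric]) (simp add: inner_sum_left)
    also have "\<dots> = 2 * (\<alpha> \<bullet> h)" by (simp add: simple_rho_check2 inner_h sum_distrib_left mult.commute)
    finally have eq: "\<alpha> \<bullet> rho_check2 = 2 * (\<alpha> \<bullet> h)" .
    have "\<alpha> \<bullet> h \<in> \<nat>" "\<alpha> \<bullet> h > 0" using \<alpha> nonneg_Nat_h by (auto simp: positive_roots_def Rp_iff[symmetric])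
      (use \<alpha> Rp_iff in blast)
    then have "\<alpha> \<bullet> h \<ge> 1" by (auto elim!: Nats_cases)
    then have "2 * (\<alpha> \<bullet> h) \<ge> 1" by simp
    then have "real N * (\<alpha> \<bullet> rho_check2) \<ge> real N * 1" unfolding eq by (intro mult_left_mono) auto
    moreover have "\<bar>\<alpha> \<bullet> s\<bar> \<le> (\<Sum>\<alpha>\<in>Rp. \<bar>\<alpha> \<bullet> s\<bar>)"
      using \<alpha> finite_Rp by (intro member_le_sum) auto
    moreover have "(\<Sum>\<alpha>\<in>Rp. \<bar>\<alpha> \<bullet> s\<bar>) \<le> B"
      unfolding B_def using s assms
      by (intro member_le_sum[of s S "\<lambda>s. \<Sum>\<alpha>\<in>Rp. \<bar>\<alpha> \<bullet> s\<bar>"] sum_nonneg) auto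
    moreover have "real N \<ge> \<bar>M\<bar> + B" unfolding N_def by (rule real_nat_ceiling_ge)
    ultimately show ?thesis by (simp add: inner_add inner_diff)
  qed
  then show ?thesis unfolding deep_def by (intro bexI[OF _ \<tau>] ballI)
qed

lemma path_Q: "(x, y) \<in> edges ^^ n \<Longrightarrow> snd x \<in> Q \<Longrightarrow> snd y \<in> Q"
proof (induction n arbitrary: y)
  case (Suc n)
  then obtain z where z: "(x, z) \<in> edges ^^ n" "(z, y) \<in> edges" by auto
  then have "snd z \<in> Q" using Suc by blast
  then show ?case using z(2) act_Q by (auto simp: edges_def)
qed simp

definition wt :: "('a \<Rightarrow> 'a) \<Rightarrow> ('a \<Rightarrow> 'a) \<Rightarrow> 'a" where
  "wt w v = (SOME \<kappa>. weight w v \<kappa>)"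

text \<open>The distance from w to v in the quantum Bruhat graph, by \<open>min_walk\<close> and
  \<open>walk_length_ge\<close>.\<close>

definition wt_dist :: "('a \<Rightarrow> 'a) \<Rightarrow> ('a \<Rightarrow> 'a) \<Rightarrow> real" where
  "wt_dist w v = height_deg (w, 0) - height_deg (v, wt w v)"

lemma weight_wt: "w \<in> WG \<Longrightarrow> v \<in> WG \<Longrightarrow> weight w v (wt w v)"
  unfolding wt_def using weight_exists by (rule someI_ex)

lemma wt_path:
  assumes "w \<in> WG" "v \<in> WG"
  obtains n where "((w, 0), (v, wt w v)) \<in> edges ^^ n" "real n = wt_dist w v"
proof -
  have "((w, 0), (v, wt w v)) \<in> edges\<^sup>*" using weight_wt[OF assms] by (simp add: weight_def)
  then obtain n where n: "((w, 0), (v, wt w v)) \<in> edges ^^ n" by (meson rtrancl_imp_relpow)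
  then show thesis using that path_height[OF n] by (simp add: wt_dist_def)
qed

lemma wt_Q: "w \<in> WG \<Longrightarrow> v \<in> WG \<Longrightarrow> wt w v \<in> Q"
  using wt_path[of w v] path_Q Q_zero by (metis snd_conv)

text \<open>Edges are invariant under translation, so the path can be moved deep enough for
  \<open>path_ascents\<close> to turn it into a Bruhat relation, to which the bound in
  \<open>weight\<close> applies.\<close>

lemma path_weight_ge:
  assumes "w \<in> WG" "v \<in> WG" "((w, \<mu>), (v, \<nu>)) \<in> edges ^^ n" "dominant \<omega>"
  shows "0 \<le> \<omega> \<bullet> (\<nu> - \<mu> - wt w v)"
proof -
  obtain M where M: "\<And>\<mu> \<nu> \<omega>. \<mu> \<in> Q \<Longrightarrow> \<nu> \<in> Q \<Longrightarrow> deep M \<mu> \<Longrightarrow> deep M \<nu> \<Longrightarrow>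
      (aw (v, \<nu>), aw (w, \<mu>)) \<in> aff.ascents\<^sup>* \<Longrightarrow> dominant \<omega> \<Longrightarrow> 0 \<le> \<omega> \<bullet> (\<nu> - \<mu> - wt w v)"
    using weight_wt[OF assms(1,2)] unfolding weight_def by blast
  define N where "N = max M (2 + real n * K)"
  obtain \<tau> where \<tau>: "\<tau> \<in> Q" "deep N \<tau>" "deep N (\<nu> - \<mu> + \<tau>)"
    using deep_exists[of "{0, \<nu> - \<mu>}" N] by auto
  have path: "((w, \<tau>), (v, \<nu> - \<mu> + \<tau>)) \<in> edges ^^ n"
    using path_translate[OF assms(3), of "\<tau> - \<mu>"] by (simp add: translate_def algebra_simps)
  have "deep (2 + real n * K) \<tau>" using deep_mono[OF \<tau>(2)] by (simp add: N_def)
  then have "(aw (v, \<nu> - \<mu> + \<tau>), aw (w, \<tau>)) \<in> aff.ascents\<^sup>*"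
    using path_ascents[OF path] assms(1) \<tau>(1) by simp
  moreover have "\<nu> - \<mu> + \<tau> \<in> Q" using path_Q[OF path] \<tau>(1) by simp
  moreover have "deep M \<tau>" "deep M (\<nu> - \<mu> + \<tau>)" using deep_mono \<tau> by (auto simp: N_def)
  ultimately have "0 \<le> \<omega> \<bullet> (\<nu> - \<mu> + \<tau> - \<tau> - wt w v)" using M \<tau>(1) assms(4) by blast
  then show ?thesis by simp
qed

text \<open>The length exceeds \<open>wt_dist\<close> by the pairing of 2\<rho> with the excess
  weight, which is nonnegative on all dominant vectors; by \<open>dominance_zero\<close> it is 0
  once its pairing with 2\<rho> is.\<close>

lemma path_length:
  assumes "w \<in> WG" "v \<in> WG" "((w, \<mu>), (v, \<nu>)) \<in> edges ^^ n"
  shows "real n \<ge> wt_dist w v" and "real n = wt_dist w v \<Longrightarrow> \<nu> = \<mu> + wt w v"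
proof -
  have n: "real n = wt_dist w v + \<rho>2 \<bullet> (\<nu> - \<mu> - wt w v)"
    using path_height[OF assms(3)] by (simp add: wt_dist_def inner_diff)
  then show "real n \<ge> wt_dist w v" using path_weight_ge[OF assms dominant_two_rho] by simp
  assume "real n = wt_dist w v"
  then have "\<nu> - \<mu> - wt w v = 0"
    using n path_weight_ge[OF assms] by (intro dominance_zero) auto
  then show "\<nu> = \<mu> + wt w v" by (simp add: algebra_simps)
qed

section \<open>Walks in the quantum Bruhat graph and lifted paths\<close>

abbreviation "D \<equiv> with_proj (quantum_bruhat_graph R \<Delta>)"

lemma verts_D: "verts D = WG"
  by (simp add: quantum_bruhat_graph_def)

lemma arc_refl_comp:
  assumes "w \<in> WG" "\<alpha> \<in> R"
  shows "root_reflection (w \<alpha>) \<circ> w = w \<circ> root_reflection \<alpha>"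
  using root_reflection_orthogonal[OF WG_orth[OF assms(1)]] by (auto simp: fun_eq_iff)

lemma arc_edge:
  assumes "(w, v) \<in> arcs D"
  shows "\<exists>\<nu>. ((w, \<mu>), (v, \<nu>)) \<in> edges"
proof -
  obtain \<alpha> where \<alpha>: "w \<in> WG" "\<alpha> \<in> Rp" "v = w \<circ> root_reflection \<alpha>"
    and len: "lng v = lng w + 1 \<or> real (lng v) = real (lng w) + 1 - coroot \<alpha> \<bullet> \<rho>2"
    using assms by (auto simp: quantum_bruhat_graph_def simp del: comp_apply)
  have \<alpha>R: "\<alpha> \<in> R" using \<alpha> Rp_R by blast
  let ?\<beta> = "w \<alpha>"
  have \<beta>: "?\<beta> \<in> R" using WG_R \<alpha> \<alpha>R by blast
  have v: "root_reflection ?\<beta> \<circ> w = v" using arc_refl_comp \<alpha> \<alpha>R by simp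
  have pos: "?\<beta> \<bullet> w h > 0" using \<alpha> WG_inner by (simp add: Rp_iff)
  have inv: "inv w (coroot ?\<beta>) = coroot \<alpha>"
    using coroot_orthogonal[OF WG_orth[OF \<alpha>(1)], of \<alpha>] WG_inv2[OF \<alpha>(1)] by simp
  have act: "act ?\<beta> (w, \<mu>) = (v, \<mu> + k ?\<beta> *\<^sub>R coroot \<alpha>)"
    using v by (simp add: shift_def inv del: comp_apply)
  have up: "lng w < lng v \<longleftrightarrow> ?\<beta> \<in> Rp"
  proof (cases "?\<beta> \<in> Rp")
    case True
    then show ?thesis using length_less_iff[OF \<alpha>(1) True] v pos by simp
  next
    case False
    then have "- ?\<beta> \<in> Rp" using Rp_or \<beta> by blast
    then show ?thesis
      using length_less_iff[OF \<alpha>(1), of "- ?\<beta>"] v pos False by (simp add: root_reflection_minus)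
  qed
  have "height_deg (v, \<mu> + k ?\<beta> *\<^sub>R coroot \<alpha>) = height_deg (w, \<mu>) - 1"
    using len
  proof
    assume l: "lng v = lng w + 1"
    then have "k ?\<beta> = 0" using up by (simp add: k_def Rp_iff)
    then show ?thesis using l by simp
  next
    assume l: "real (lng v) = real (lng w) + 1 - coroot \<alpha> \<bullet> \<rho>2"
    \<comment> \<open>A reflection has length at least 1, so its coroot pairs to at least 2 with
      2\<rho>: an arc of the second kind does decrease the length, and its level is 1.\<close>
    have "lng id < lng (root_reflection \<alpha> \<circ> id)"
      using length_less_iff[OF WG_id \<alpha>(2)] \<alpha>(2) by (simp add: Rp_iff)
    then have "lng (root_reflection \<alpha>) \<ge> 1" by simp
    then have "coroot \<alpha> \<bullet> \<rho>2 \<ge> 2" using length_reflection_le[OF \<alpha>(2)] by linarith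
    then have "\<not> lng w < lng v" using l by linarith
    then have "k ?\<beta> = 1" using up \<beta> by (simp add: k_def Rp_iff)
    then show ?thesis using l by (simp add: inner_add inner_commute)
  qed
  then have "((w, \<mu>), (v, \<mu> + k ?\<beta> *\<^sub>R coroot \<alpha>)) \<in> edges"
    unfolding edges_def act[symmetric] using \<alpha>(1) \<beta> pos
    by (intro CollectI exI[of _ "(w, \<mu>)"] exI[of _ ?\<beta>]) (simp add: descends_def del: act.simps)
  then show ?thesis by blast
qed

lemma edge_arc:
  assumes "((w, \<mu>), (v, \<nu>)) \<in> edges"
  shows "(w, v) \<in> arcs D"
proof -
  obtain \<beta> where \<beta>: "w \<in> WG" "\<beta> \<in> R" "\<beta> \<bullet> w h > 0" "v = root_reflection \<beta> \<circ> w"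
    "\<nu> = \<mu> + shift \<beta> w" and len: "height_deg (v, \<nu>) = height_deg (w, \<mu>) - 1"
    using assms by (auto simp: edges_def descends_def simp del: comp_apply height_deg.simps)
  let ?\<alpha> = "inv w \<beta>"
  have \<alpha>: "?\<alpha> \<in> Rp" using WG_R WG_inv \<beta> by (simp add: Rp_iff WG_inner_inv[OF \<beta>(1)])
  have w\<alpha>: "w ?\<alpha> = \<beta>" using WG_inv1 \<beta>(1) by blast
  have v: "v = w \<circ> root_reflection ?\<alpha>" using arc_refl_comp[OF \<beta>(1) Rp_R[OF \<alpha>]] \<beta>(4) w\<alpha> by simp
  have "shift \<beta> w = k \<beta> *\<^sub>R coroot ?\<alpha>"
    using coroot_orthogonal[OF WG_orth[OF WG_inv[OF \<beta>(1)]]] by (simp add: shift_def)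
  then have "lng v = lng w + 1 \<or> real (lng v) = real (lng w) + 1 - coroot ?\<alpha> \<bullet> \<rho>2"
    using len k_cases[of \<beta>] by (auto simp: \<beta>(5) inner_add inner_commute)
  then show ?thesis
    using \<beta>(1) \<alpha> v by (simp add: quantum_bruhat_graph_def del: comp_apply) blast
qed

lemma wf_D: "wf_digraph D"
proof
  fix e assume e: "e \<in> arcs D"
  obtain w v where e': "e = (w, v)" by (cases e)
  then obtain \<nu> where "((w, 0), (v, \<nu>)) \<in> edges" using arc_edge e by blast
  then show "tail D e \<in> verts D" "head D e \<in> verts D"
    using edge_WG e' verts_D by (metis fst_conv with_proj_simps(4), metis fst_conv snd_conv with_proj_simps(5))
qed

sublocale D: wf_digraph D by (rule wf_D)

lemma walk_path:
  "D.awalk w p v \<Longrightarrow> \<exists>\<nu>. ((w, \<mu>), (v, \<nu>)) \<in> edges ^^ length p"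
proof (induction p arbitrary: w \<mu>)
  case Nil
  then show ?case by (simp add: D.awalk_Nil_iff)
next
  case (Cons e p)
  obtain a b where e: "e = (a, b)" by (cases e)
  have *: "(a, b) \<in> arcs D" "a = w" "D.awalk b p v" using Cons.prems e by (simp_all add: D.awalk_Cons_iff)
  obtain \<nu>' where \<nu>': "((w, \<mu>), (b, \<nu>')) \<in> edges" using arc_edge * by blast
  obtain \<nu> where "((b, \<nu>'), (v, \<nu>)) \<in> edges ^^ length p" using Cons.IH[OF *(3)] by blast
  with \<nu>' show ?case by (metis length_Cons relpow_Suc_I2)
qed

lemma path_walk:
  "((w, \<mu>), (v, \<nu>)) \<in> edges ^^ n \<Longrightarrow> w \<in> WG \<Longrightarrow> \<exists>p. D.awalk w p v \<and> length p = n"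
proof (induction n arbitrary: w \<mu>)
  case 0
  then show ?case using verts_D by (auto simp: D.awalk_Nil_iff)
next
  case (Suc n)
  then obtain b \<nu>' where b: "((w, \<mu>), (b, \<nu>')) \<in> edges" "((b, \<nu>'), (v, \<nu>)) \<in> edges ^^ n"
    by (metis relpow_Suc_D2 surj_pair)
  then have "b \<in> WG" using edge_WG by fastforce
  then obtain p where "D.awalk b p v" "length p = n" using Suc.IH b by blast
  then have "D.awalk w ((w, b) # p) v \<and> length ((w, b) # p) = Suc n"
    using edge_arc[OF b(1)] by (simp add: D.awalk_Cons_iff)
  then show ?case by blast
qed

lemma min_walk:
  assumes "w \<in> WG" "v \<in> WG"
  obtains p where "D.awalk w p v" "real (length p) = wt_dist w v"
  using wt_path[OF assms] path_walk assms by metis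

lemma walk_length_ge: "w \<in> WG \<Longrightarrow> v \<in> WG \<Longrightarrow> D.awalk w p v \<Longrightarrow> real (length p) \<ge> wt_dist w v"
  using walk_path[of w p v 0] path_length(1) by blast

text \<open>The lengths in \<open>height_deg\<close> cancel, so the defect in the triangle
  inequality is a pairing of 2\<rho> with weights only.\<close>

lemma wt_dist_triangle:
  "wt_dist u w + wt_dist w v - wt_dist u v = \<rho>2 \<bullet> (wt u w + wt w v - wt u v)"
  by (simp add: wt_dist_def inner_add inner_diff)

text \<open>Both parts of a shortest walk through w are shortest, so by \<open>path_length\<close>
  the lifted walk carries weight \<open>wt u w\<close> at w and \<open>wt u v\<close> at v.\<close>

lemma tilted_wt:
  assumes "u \<in> WG" "w \<in> WG" "v \<in> WG" "tilted_bruhat_le R \<Delta> u w v"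
  shows "\<exists>n. real n = wt_dist w v \<and> ((w, wt u w), (v, wt u v)) \<in> edges ^^ n"
proof -
  obtain p where p: "D.awalk u p v" "\<And>q. D.awalk u q v \<Longrightarrow> length p \<le> length q"
    "w \<in> set (D.awalk_verts u p)"
    using assms(4) unfolding tilted_bruhat_le_def shortest_walk_def by blast
  obtain p1 p2 where p12: "p = p1 @ p2" "D.awalk u p1 w" "D.awalk w p2 v"
    using D.awalk_decomp[OF p(1,3)] by blast
  obtain q1 where q1: "D.awalk u q1 w" "real (length q1) = wt_dist u w" using min_walk assms by blast
  obtain q2 where q2: "D.awalk w q2 v" "real (length q2) = wt_dist w v" using min_walk assms by blast
  obtain q where q: "D.awalk u q v" "real (length q) = wt_dist u v" using min_walk assms by blast
  have l1: "real (length p1) = wt_dist u w"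
    using p(2)[OF D.awalk_appendI[OF q1(1) p12(3)]] p12 q1(2) walk_length_ge[OF assms(1,2) p12(2)] by simp
  have l2: "real (length p2) = wt_dist w v"
    using p(2)[OF D.awalk_appendI[OF p12(2) q2(1)]] p12 q2(2) walk_length_ge[OF assms(2,3) p12(3)] by simp
  have l: "real (length p1 + length p2) = wt_dist u v"
    using p(2)[OF q(1)] p12(1) q(2) walk_length_ge[OF assms(1,3) p(1)] by simp
  obtain \<nu>1 where \<nu>1: "((u, 0), (w, \<nu>1)) \<in> edges ^^ length p1" using walk_path[OF p12(2)] by blast
  obtain \<nu>2 where \<nu>2: "((w, \<nu>1), (v, \<nu>2)) \<in> edges ^^ length p2" using walk_path[OF p12(3)] by blast
  have "\<nu>1 = wt u w" using path_length(2)[OF assms(1,2) \<nu>1 l1] by simp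
  moreover have "((u, 0), (v, \<nu>2)) \<in> edges ^^ (length p1 + length p2)"
    using \<nu>1 \<nu>2 by (auto simp: relpow_add)
  then have "\<nu>2 = wt u v" using path_length(2)[OF assms(1,3) _ l] by fastforce
  ultimately show ?thesis using \<nu>2 l2 by blast
qed

lemma tilted_if:
  assumes "u \<in> WG" "w \<in> WG" "v \<in> WG" "wt_dist u w + wt_dist w v \<le> wt_dist u v"
  shows "tilted_bruhat_le R \<Delta> u w v"
proof -
  obtain q1 where q1: "D.awalk u q1 w" "real (length q1) = wt_dist u w" using min_walk assms by blast
  obtain q2 where q2: "D.awalk w q2 v" "real (length q2) = wt_dist w v" using min_walk assms by blast
  have walk: "D.awalk u (q1 @ q2) v" by (rule D.awalk_appendI[OF q1(1) q2(1)])
  have "length (q1 @ q2) \<le> length q" if "D.awalk u q v" for q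
    using walk_length_ge[OF assms(1,3) that] q1(2) q2(2) assms(4) by simp
  then have "shortest_walk D u (q1 @ q2) v" using walk unfolding shortest_walk_def by blast
  moreover have "w \<in> set (D.awalk_verts u (q1 @ q2))"
  proof -
    have "w \<in> set (D.awalk_verts w q2)" by (rule D.hd_in_awalk_verts(1)[OF q2(1)])
    moreover have "D.awlast u q1 = w" using q1(1) by (rule D.awalkE)
    ultimately show ?thesis using D.awalk_verts_append2[OF walk] by (metis Un_iff set_append)
  qed
  ultimately show ?thesis unfolding tilted_bruhat_le_def by blast
qed

text \<open>The linear part of the affine map determines w, whatever the translation; this gives
  injectivity of the embedding.\<close>

lemma aw_inj: "w \<in> WG \<Longrightarrow> w' \<in> WG \<Longrightarrow> aw (w, \<mu>) = aw (w', \<mu>') \<Longrightarrow> w = w'"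
proof
  fix x assume w: "w \<in> WG" "w' \<in> WG" and eq: "aw (w, \<mu>) = aw (w', \<mu>')"
  have aw: "aw (g, \<nu>) x - aw (g, \<nu>) 0 = g x" if "g \<in> WG" for g \<nu>
    by (simp add: aw_def translation_def linear_add[OF WG_linear[OF that]])
  show "w x = w' x" using aw[OF w(1), of \<mu>] aw[OF w(2), of \<mu>'] unfolding eq by simp
qed

lemma tilted_embedding:
  assumes u: "u \<in> WG"
  shows "\<exists>\<tau>\<in>Q. \<forall>w\<in>WG. \<forall>v\<in>WG. tilted_bruhat_le R \<Delta> u w v \<longleftrightarrow>
    (aw (v, wt u v + \<tau>), aw (w, wt u w + \<tau>)) \<in> aff.ascents\<^sup>*"
proof -
  define P where "P w v M \<longleftrightarrow> (\<forall>\<mu>\<in>Q. \<forall>\<nu>\<in>Q. deep M \<mu> \<longrightarrow> deep M \<nu> \<longrightarrow>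
      (aw (v, \<nu>), aw (w, \<mu>)) \<in> aff.ascents\<^sup>* \<longrightarrow> (\<forall>\<omega>. dominant \<omega> \<longrightarrow> 0 \<le> \<omega> \<bullet> (\<nu> - \<mu> - wt w v)))" for w v M
  have "\<exists>M. P w v M" if "w \<in> WG" "v \<in> WG" for w v
    using weight_wt[OF that] unfolding weight_def P_def by blast
  then obtain M where M: "P w v (M w v)" if "w \<in> WG" "v \<in> WG" for w v by metis
  \<comment> \<open>One depth for all pairs: each summand covers the threshold of the weight bound
    as well as the depth that \<open>path_ascents\<close> asks for along a shortest path.\<close>
  define N where "N = (\<Sum>w\<in>WG. \<Sum>v\<in>WG. \<bar>M w v\<bar> + 2 + \<bar>wt_dist w v\<bar> * K)"
  have N: "\<bar>M w v\<bar> + 2 + \<bar>wt_dist w v\<bar> * K \<le> N" if "w \<in> WG" "v \<in> WG" for w v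
  proof -
    have nonneg: "0 \<le> \<bar>M w v\<bar> + 2 + \<bar>wt_dist w v\<bar> * K" for w v using K_nonneg by simp
    have "\<bar>M w v\<bar> + 2 + \<bar>wt_dist w v\<bar> * K \<le> (\<Sum>v\<in>WG. \<bar>M w v\<bar> + 2 + \<bar>wt_dist w v\<bar> * K)"
      using that finite_WG nonneg by (intro member_le_sum) auto
    also have "\<dots> \<le> N"
      unfolding N_def using that finite_WG nonneg
      by (intro member_le_sum[of w WG "\<lambda>w. \<Sum>v\<in>WG. \<bar>M w v\<bar> + 2 + \<bar>wt_dist w v\<bar> * K"] sum_nonneg) auto
    finally show ?thesis .
  qed
  have "finite (wt u ` WG)" using finite_WG by simp
  then obtain \<tau> where \<tau>: "\<tau> \<in> Q" "\<And>w. w \<in> WG \<Longrightarrow> deep N (wt u w + \<tau>)"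
    using deep_exists[of "wt u ` WG" N] by auto
  have Qw: "wt u w + \<tau> \<in> Q" if "w \<in> WG" for w using Q_add wt_Q u that \<tau>(1) by blast
  have "tilted_bruhat_le R \<Delta> u w v \<longleftrightarrow> (aw (v, wt u v + \<tau>), aw (w, wt u w + \<tau>)) \<in> aff.ascents\<^sup>*"
    if w: "w \<in> WG" and v: "v \<in> WG" for w v
  proof
    assume "tilted_bruhat_le R \<Delta> u w v"
    then obtain n where n: "real n = wt_dist w v" "((w, wt u w), (v, wt u v)) \<in> edges ^^ n"
      using tilted_wt u w v by blast
    have path: "((w, wt u w + \<tau>), (v, wt u v + \<tau>)) \<in> edges ^^ n"
      using path_translate[OF n(2), of \<tau>] by (simp add: translate_def)
    have "2 + real n * K \<le> N" using N[OF w v] n(1) K_nonneg by (simp add: abs_if split: if_splits)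
    then show "(aw (v, wt u v + \<tau>), aw (w, wt u w + \<tau>)) \<in> aff.ascents\<^sup>*"
      using path_ascents[OF path] w Qw[OF w] deep_mono[OF \<tau>(2)[OF w]] by simp
  next
    assume le: "(aw (v, wt u v + \<tau>), aw (w, wt u w + \<tau>)) \<in> aff.ascents\<^sup>*"
    have "M w v \<le> N" using N[OF w v] K_nonneg mult_nonneg_nonneg[OF abs_ge_zero K_nonneg, of "wt_dist w v"] by linarith
    then have "deep (M w v) (wt u w + \<tau>)" "deep (M w v) (wt u v + \<tau>)"
      using deep_mono \<tau>(2) w v by blast+
    then have "0 \<le> \<rho>2 \<bullet> (wt u v + \<tau> - (wt u w + \<tau>) - wt w v)"
      using M[OF w v] Qw w v le dominant_two_rho unfolding P_def by blast
    then have "wt_dist u w + wt_dist w v \<le> wt_dist u v"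
      using wt_dist_triangle[of u w v] by (simp add: inner_add inner_diff)
    then show "tilted_bruhat_le R \<Delta> u w v" using tilted_if u w v by blast
  qed
  then show ?thesis using \<tau>(1) by blast
qed

end

theorem theorem4p4:
  fixes R \<Delta> :: "'a::euclidean_space set" and u :: "'a \<Rightarrow> 'a"
  assumes "irreducible_root_system R"
    and "simple_roots R \<Delta>"
    and "u \<in> weyl_group R"
  shows "\<exists>f :: ('a \<Rightarrow> 'a) \<Rightarrow> ('a \<Rightarrow> 'a).
           f ` weyl_group R \<subseteq> affine_weyl_group R \<and>
           inj_on f (weyl_group R) \<and>
           (\<forall>w \<in> weyl_group R. \<forall>v \<in> weyl_group R.
              tilted_bruhat_le R \<Delta> u w v \<longleftrightarrow> affine_bruhat_le R \<Delta> (f v) (f w))"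
proof -
  interpret irreducible_base R \<Delta>
    using assms(1,2) by unfold_locales (auto simp: irreducible_root_system_def)
  obtain \<tau> where \<tau>: "\<tau> \<in> Q"
    "\<forall>w\<in>WG. \<forall>v\<in>WG. tilted_bruhat_le R \<Delta> u w v \<longleftrightarrow>
       (aw (v, wt u v + \<tau>), aw (w, wt u w + \<tau>)) \<in> aff.ascents\<^sup>*"
    using tilted_embedding[OF assms(3)] by blast
  define f where "f w = aw (w, wt u w + \<tau>)" for w
  have "f ` WG \<subseteq> AW"
  proof (rule image_subsetI)
    fix w assume "w \<in> WG"
    then show "f w \<in> AW"
      unfolding f_def using aw_AW[of "(w, wt u w + \<tau>)"] Q_add[OF wt_Q[OF assms(3)] \<tau>(1)] by simp
  qed
  moreover have "inj_on f WG" unfolding f_def by (rule inj_onI) (rule aw_inj)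
  moreover have "\<forall>w\<in>WG. \<forall>v\<in>WG. tilted_bruhat_le R \<Delta> u w v \<longleftrightarrow> affine_bruhat_le R \<Delta> (f v) (f w)"
    unfolding affine_bruhat_iff f_def by (rule \<tau>(2))
  ultimately show ?thesis by blast
qed

end
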